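(* For all sufficiently large even integers $k$ and real $x>0$, the following estimates hold, with absolute implied constants. (i) If $x\leq k^2/(32\pi^2+1)$, then $$\langle \mathcal S(x,f)\rangle \ll e^{-\sqrt k}.$$ (ii) If $k^2/(32\pi^2-1)\leq x\leq k^2/(16\pi^2+1)$, then $$\langle \mathcal S(x,f)\rangle = \frac{(-1)^{k/2}}{4\pi}k+\mathcal O(k^{7/8}).$$
   Context: For an even integer $k$, $\mathcal B_k$ denotes a basis of the space of holomorphic cusp forms of weight $k$ for $\mathrm{SL}_2(\mathbb Z)$ consisting of orthogonal Hecke eigenforms. Each $f\in\mathcal B_k$ has Fourier expansion $f(z)=\sum_{n\geq1}\lambda_f(n)n^{(k-1)/2}e^{2\pi i nz}$, normalised so that $\lambda_f(1)=1$; the eigenvalues $\lambda_f(n)$ are real. Set $\mathcal S(x,f)=\sum_{x<n\leq 2x}\lambda_f(n)$. For a quantity $g(f)$ depending on $f$, set $\langle g(f)\rangle=\sum_{f\in\mathcal B_k}\omega(f)g(f)$, with harmonic weights $\omega(f)=\frac{\Gamma(k-1)}{(4\pi)^{k-1}\|f\|^2}$, where $\|f\|^2=\int_{\mathrm{SL}_2(\mathbb Z)\backslash\mathbb H}|f(u+iv)|^2v^{k-2}\,du\,dv$ is the Petersson norm squared. $F\ll G$ and $F=\mathcal O(G)$ mean $|F|\leq C|G|$ for some constant $C>0$.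
   Formalization: Part (i) is proved for x outside [1/2,1); for 1/2 ≤ x < 1 the sum S(x,f) is the single term λ_f(1)=1, whose harmonic average tends to 1 as k grows, so the stated bound e^{-√k} fails there. *)

theory Defs
  imports "HOL-Complex_Analysis.Complex_Analysis" "HOL-Library.Function_Algebras"
begin

abbreviation upper_half_plane :: "complex set" where
  "upper_half_plane \<equiv> {z. Im z > 0}"

definition scale_fun :: "complex \<Rightarrow> (complex \<Rightarrow> complex) \<Rightarrow> complex \<Rightarrow> complex" where
  "scale_fun c f = (\<lambda>z. c * f z)"

interpretation cfun: vector_space scale_fun
  by unfold_locales (auto simp: scale_fun_def fun_eq_iff algebra_simps)

(* Functions on the upper half-plane are represented as functions on all of the
   complex plane that are 0 elsewhere, so that equality of functions is equality
   on the half-plane. *)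
definition cusp_forms :: "int \<Rightarrow> (complex \<Rightarrow> complex) set" where
  "cusp_forms k = {f.
     f holomorphic_on upper_half_plane \<and>
     (\<forall>z. z \<notin> upper_half_plane \<longrightarrow> f z = 0) \<and>
     (\<forall>a b c d :: int. a * d - b * c = 1 \<longrightarrow>
        (\<forall>z\<in>upper_half_plane.
           f ((of_int a * z + of_int b) / (of_int c * z + of_int d)) =
           (of_int c * z + of_int d) powi k * f z)) \<and>
     (f \<longlongrightarrow> 0) (filtercomap Im at_top)}"

definition hecke_operator ::
  "int \<Rightarrow> nat \<Rightarrow> (complex \<Rightarrow> complex) \<Rightarrow> complex \<Rightarrow> complex" where
  "hecke_operator k n f = (\<lambda>z. of_nat n powi (k - 1) *
     (\<Sum>d | d dvd n. of_nat d powi (- k) *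
        (\<Sum>b<d. f ((of_nat (n div d) * z + of_nat b) / of_nat d))))"

definition hecke_eigenform :: "int \<Rightarrow> (complex \<Rightarrow> complex) \<Rightarrow> bool" where
  "hecke_eigenform k f \<longleftrightarrow>
     f \<in> cusp_forms k \<and> f \<noteq> 0 \<and>
     (\<forall>n\<ge>1. \<exists>\<mu>. hecke_operator k n f = scale_fun \<mu> f)"

definition fourier_coeff :: "(complex \<Rightarrow> complex) \<Rightarrow> nat \<Rightarrow> complex" where
  "fourier_coeff f = (THE a. \<forall>z\<in>upper_half_plane.
     (\<lambda>n. a n * exp (2 * of_real pi * \<i> * of_nat n * z)) sums f z)"

(* The numbers lambda_f(n) of the expansion of f with coefficients
   lambda_f(n) n^((k-1)/2); they are real for a normalised eigenform, but this is
   a theorem and is not built into the type. *)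
definition hecke_lambda :: "int \<Rightarrow> (complex \<Rightarrow> complex) \<Rightarrow> nat \<Rightarrow> complex" where
  "hecke_lambda k f n =
     fourier_coeff f n / of_real (real n powr ((real_of_int k - 1) / 2))"

definition fundamental_domain :: "complex set" where
  "fundamental_domain = {z. Im z > 0 \<and> \<bar>Re z\<bar> \<le> 1 / 2 \<and> cmod z \<ge> 1}"

definition petersson_inner ::
  "int \<Rightarrow> (complex \<Rightarrow> complex) \<Rightarrow> (complex \<Rightarrow> complex) \<Rightarrow> complex" where
  "petersson_inner k f g =
     (LINT z:fundamental_domain|lborel. f z * cnj (g z) * of_real (Im z powi (k - 2)))"

definition petersson_norm_sq :: "int \<Rightarrow> (complex \<Rightarrow> complex) \<Rightarrow> real" where
  "petersson_norm_sq k f =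
     (LINT z:fundamental_domain|lborel. (cmod (f z))\<^sup>2 * Im z powi (k - 2))"

definition hecke_basis :: "int \<Rightarrow> (complex \<Rightarrow> complex) set \<Rightarrow> bool" where
  "hecke_basis k B \<longleftrightarrow>
     cfun.independent B \<and> cfun.span B = cusp_forms k \<and>
     pairwise (\<lambda>f g. petersson_inner k f g = 0) B \<and>
     (\<forall>f\<in>B. hecke_eigenform k f \<and> hecke_lambda k f 1 = 1)"

definition harmonic_weight :: "int \<Rightarrow> (complex \<Rightarrow> complex) \<Rightarrow> real" where
  "harmonic_weight k f =
     Gamma (real_of_int k - 1) / ((4 * pi) powi (k - 1) * petersson_norm_sq k f)"

(* The space of cusp forms is finite-dimensional, so a basis B is finite and the
   sum is a genuine one. *)
definition harmonic_average ::
  "int \<Rightarrow> (complex \<Rightarrow> complex) set \<Rightarrow> ((complex \<Rightarrow> complex) \<Rightarrow> complex) \<Rightarrow> complex" where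
  "harmonic_average k B g = (\<Sum>f\<in>B. of_real (harmonic_weight k f) * g f)"

(* For 1/2 <= x < 1 this sum is the single term lambda_f(1), so for a normalised
   basis its harmonic average is that of the constant 1, which by the Petersson
   formula tends to 1 as k grows. *)
definition hecke_sum :: "int \<Rightarrow> real \<Rightarrow> (complex \<Rightarrow> complex) \<Rightarrow> complex" where
  "hecke_sum k x f = (\<Sum>n | x < real n \<and> real n \<le> 2 * x. hecke_lambda k f n)"

end

theory Submission imports Defs "HOL-Real_Asymp.Real_Asymp" begin

text \<open>
  For \<open>n \<ge> 2\<close>, Petersson's formula evaluates the average of the \<open>n\<close>-th eigenvalue as
  \<open>2\<pi> (-1)^(k/2) \<Sum>c\<ge>1. S(1,n;c)/c * J(k-1)(4\<pi> \<surd>n / c)\<close>, with Kloosterman sums \<open>S(1,n;c)\<close> and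
  Bessel functions \<open>J(k-1)\<close>. The two ranges of \<open>x\<close> reflect that \<open>J(k-1)\<close> is exponentially small
  for arguments below \<open>k-1\<close> by a constant factor, and oscillates above \<open>k-1\<close>. The arguments that
  occur are at most \<open>4\<pi> \<surd>(2x) / c\<close>. If \<open>x \<le> k^2/(32\<pi>^2+1)\<close>, they are all below \<open>k-1\<close> by a constant
  factor, so that every term is exponentially small (\<open>average_below_transition\<close>). If
  \<open>x \<le> k^2/(16\<pi>^2+1)\<close>, this is still so for \<open>c \<ge> 2\<close>, and there remains the term \<open>c = 1\<close>, which is
  \<open>2\<pi> (-1)^(k/2)\<close> times the sum of \<open>J(k-1)(4\<pi> \<surd>n)\<close> over \<open>x < n \<le> 2x\<close>. Up to \<open>O(\<surd>k)\<close> that sum is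
  the integral of \<open>J(k-1)(4\<pi> \<surd>t)\<close> over \<open>x \<le> t \<le> 2x\<close>, that is \<open>1/(8\<pi>^2)\<close> times the integral of
  \<open>y J(k-1)(y)\<close> from \<open>4\<pi> \<surd>x\<close>, which lies below the transition, to \<open>4\<pi> \<surd>(2x)\<close>, which lies above it
  by a constant factor as soon as \<open>x \<ge> k^2/(32\<pi>^2-1)\<close>. That integral is \<open>k + O(\<surd>k)\<close>, and the main
  term \<open>(-1)^(k/2) k/(4\<pi>)\<close> follows (\<open>average_above_transition\<close>).

  The facts on \<open>J n\<close> come from its power series and recurrences. The energy
  \<open>(x J')^2 + (x^2 - n^2) J^2\<close> has derivative \<open>2 x J^2\<close>. It is therefore nonnegative, which makes
  the logarithmic derivative of \<open>J n\<close> at least \<open>\<surd>(n^2 - x^2)/x\<close> for \<open>x < n\<close> and yields the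
  exponential decay (\<open>bessel_J_le_powr\<close>); and it is at most \<open>x^2/n\<close>, which bounds \<open>x J'\<close>, hence
  the variation of \<open>J n\<close>, for \<open>x > n\<close> (\<open>abs_bessel_euler_le\<close>). Bessel's equation turns the first
  moment of \<open>J n\<close> into \<open>n\<close> times the integral of \<open>n J n(x)/x\<close>, up to the boundary term \<open>Y J'(Y)\<close>;
  that integral over the half-line is \<open>1\<close> by a Laplace transform, and its tail is small by one
  integration by parts (\<open>bessel_moment_approx\<close>).

  Petersson's formula is proved with the Poincare series \<open>P\<close> of index \<open>1\<close>. Grouping its terms by
  residue classes and applying Lipschitz's formula to each class gives its Fourier coefficients
  (\<open>poincare_series_cusp_form\<close>). Unfolding gives \<open><f, P> = a(1) \<Gamma>(k-1)/(4\<pi>)^(k-1)\<close> for every cusp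
  form \<open>f\<close> with first coefficient \<open>a(1)\<close> (\<open>petersson_inner_poincare\<close>). Hence the coordinate of \<open>P\<close>
  at a basis element \<open>f\<close> is the harmonic weight of \<open>f\<close> (\<open>poincare_series_in_basis\<close>), and comparing
  \<open>n\<close>-th Fourier coefficients gives the formula (\<open>petersson_formula_kloosterman\<close>).
\<close>

section \<open>Fourier expansions of cusp forms\<close>

definition qexp :: "complex \<Rightarrow> complex" where
  "qexp z = exp (2 * of_real pi * \<i> * z)"

lemma qexp_add: "qexp (z + w) = qexp z * qexp w"
  by (simp add: qexp_def distrib_left exp_add)

lemma qexp_of_int [simp]: "qexp (of_int m) = 1"
  using exp_integer_2pi[of "of_int m"] by (simp add: qexp_def mult_ac)

lemma qexp_add_of_int [simp]: "qexp (z + of_int m) = qexp z"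
  by (simp add: qexp_add)

lemma norm_qexp: "norm (qexp z) = exp (- 2 * pi * Im z)"
  by (simp add: qexp_def)

lemma qexp_nonzero [simp]: "qexp z \<noteq> 0"
  by (simp add: qexp_def)

lemma qexp_power: "qexp z ^ n = exp (2 * of_real pi * \<i> * of_nat n * z)"
  by (simp add: qexp_def exp_of_nat_mult[symmetric] mult_ac)

lemma holomorphic_on_qexp: "qexp holomorphic_on A"
  unfolding qexp_def[abs_def] by (intro holomorphic_intros)

lemma norm_qexp_less_1: "Im z > 0 \<Longrightarrow> norm (qexp z) < 1"
  by (simp add: norm_qexp)

lemma qexp_eqD:
  assumes "qexp z = qexp w" shows "\<exists>m. z = w + of_int m"
proof -
  obtain m where m: "2 * of_real pi * \<i> * z = 2 * of_real pi * \<i> * w + of_int (2 * m) * pi * \<i>"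
    using assms unfolding qexp_def exp_eq by blast
  hence "2 * of_real pi * \<i> * z = 2 * of_real pi * \<i> * (w + of_int m)"
    by (simp add: algebra_simps)
  hence "z = w + of_int m" by (subst (asm) mult_left_cancel) auto
  thus ?thesis by blast
qed

lemma qexp_inverse:
  assumes "q \<noteq> 0"
  shows "qexp (Ln q / (2 * of_real pi * \<i>)) = q" "Im (Ln q / (2 * of_real pi * \<i>)) = - ln (norm q) / (2 * pi)"
  using assms by (auto simp: qexp_def Im_divide power2_eq_square)

lemma qexp_inverse_Im_pos:
  assumes "q \<noteq> 0" "norm q < 1"
  shows "Im (Ln q / (2 * of_real pi * \<i>)) > 0"
  unfolding qexp_inverse(2)[OF assms(1)] using assms ln_less_zero[of "norm q"]
  by (intro divide_pos_pos) auto

lemma qexp_surj: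
  assumes "q \<noteq> 0" "norm q < 1"
  obtains z where "Im z > 0" "qexp z = q"
  using that[OF qexp_inverse_Im_pos[OF assms] qexp_inverse(1)[OF assms(1)]] .

text \<open>
  In the variable \<open>q = e(z)\<close> both expansions are power series on the punctured unit disc, so this
  is the identity theorem for power series; the constant term is reached by continuity at \<open>0\<close>.
\<close>
lemma fourier_series_unique:
  assumes a: "\<And>z. Im z > 0 \<Longrightarrow> (\<lambda>n. a n * exp (2 * of_real pi * \<i> * of_nat n * z)) sums f z"
    and b: "\<And>z. Im z > 0 \<Longrightarrow> (\<lambda>n. b n * exp (2 * of_real pi * \<i> * of_nat n * z)) sums f z"
  shows "a = b"
proof -
  define c where "c n = a n - b n" for n
  have c0: "(\<lambda>n. c n * q ^ n) sums 0" if q: "q \<noteq> 0" "norm q < 1" for q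
  proof -
    obtain z where z: "Im z > 0" "qexp z = q" using qexp_surj[OF q] by blast
    from sums_diff[OF a[OF z(1)] b[OF z(1)]]
    show ?thesis unfolding qexp_power[symmetric] z(2) by (simp add: c_def left_diff_distrib)
  qed
  define F where "F q = (\<Sum>n. c n * q ^ n)" for q
  have "summable (\<lambda>n. c n * (1/2) ^ n)"
    using c0[of "1/2"] by (simp add: sums_iff)
  hence "isCont F 0" unfolding F_def by (rule isCont_powser) auto
  hence "(F \<longlongrightarrow> F 0) (at 0)" by (simp add: isCont_def)
  moreover have "eventually (\<lambda>q. F q = 0) (at 0)"
  proof -
    have "eventually (\<lambda>q::complex. q \<in> ball 0 1) (at 0)"
      by (rule eventually_at_in_open') auto
    moreover have "eventually (\<lambda>q::complex. q \<noteq> 0) (at 0)" by (auto simp: eventually_at_filter)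
    ultimately show ?thesis
      by eventually_elim (use c0 in \<open>auto simp: F_def sums_iff\<close>)
  qed
  hence "(F \<longlongrightarrow> 0) (at 0)" by (rule tendsto_eventually)
  ultimately have "F 0 = 0" by (rule tendsto_unique[rotated 1]) simp
  moreover have "F 0 = c 0" unfolding F_def by (rule powser_zero)
  ultimately have c00: "c 0 = 0" by simp
  have "c m = 0" for m
  proof (rule ccontr)
    assume m: "c m \<noteq> 0"
    hence m0: "m > 0" using c00 by (cases m) auto
    have sums0: "(\<lambda>n. c n * (x - 0) ^ n) sums 0" if "norm (x - 0) < 1" for x
      using c0[of x] c00 that by (cases "x = 0") auto
    obtain s where s: "0 < s" "\<And>z. z \<in> cball 0 s - {0::complex} \<Longrightarrow> (0::complex) \<noteq> 0"
      by (rule powser_0_nonzero[of 1 0 c "\<lambda>_. 0", OF _ sums0 refl m m0]) auto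
    from s(2)[of "of_real s"] s(1) show False by auto
  qed
  thus ?thesis by (auto simp: c_def)
qed

lemma fourier_coeff_eqI:
  assumes "\<And>z. Im z > 0 \<Longrightarrow> (\<lambda>n. a n * exp (2 * of_real pi * \<i> * of_nat n * z)) sums f z"
  shows "fourier_coeff f = a"
  unfolding fourier_coeff_def
proof (rule the_equality)
  show "\<forall>z\<in>upper_half_plane. (\<lambda>n. a n * exp (2 * of_real pi * \<i> * of_nat n * z)) sums f z"
    using assms by simp
next
  fix b assume "\<forall>z\<in>upper_half_plane. (\<lambda>n. b n * exp (2 * of_real pi * \<i> * of_nat n * z)) sums f z"
  thus "b = a" using assms by (intro fourier_series_unique) auto
qed

lemma cusp_form_translate:
  assumes "f \<in> cusp_forms k" "Im z > 0"
  shows "f (z + of_int m) = f z"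
proof -
  have "\<forall>a b c d :: int. a * d - b * c = 1 \<longrightarrow>
        (\<forall>z\<in>upper_half_plane.
           f ((of_int a * z + of_int b) / (of_int c * z + of_int d)) =
           (of_int c * z + of_int d) powi k * f z)"
    using assms by (simp add: cusp_forms_def)
  from this[rule_format, of 1 1 m 0 z] assms(2) show ?thesis by simp
qed

lemma cusp_form_qexp_cong:
  assumes "f \<in> cusp_forms k" "Im z > 0" "Im w > 0" "qexp z = qexp w"
  shows "f z = f w"
  using qexp_eqD[OF assms(4)] cusp_form_translate[OF assms(1,3)] by auto

text \<open>
  A cusp form descends to a function of \<open>q = e(z)\<close>. The descended function is holomorphic on the
  punctured disc, as is seen with two branches of the logarithm, and it extends by \<open>0\<close> to the
  centre because the form vanishes at the cusp.
\<close>
lemma cusp_form_on_disc: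
  assumes f: "f \<in> cusp_forms k"
  obtains h where "h holomorphic_on ball 0 1" "h 0 = 0" "\<And>z. Im z > 0 \<Longrightarrow> f z = h (qexp z)"
proof -
  have hol: "f holomorphic_on upper_half_plane" and lim: "(f \<longlongrightarrow> 0) (filtercomap Im at_top)"
    using f by (auto simp: cusp_forms_def)
  define g where "g q = f (Ln q / (2 * of_real pi * \<i>))" for q
  \<comment> \<open>The disc without the nonpositive reals and the disc without the nonnegative reals cover
    the punctured disc; the second is handled by the logarithm of -q.\<close>
  define A B :: "complex set" where "A = ball 0 1 - \<real>\<^sub>\<le>\<^sub>0" and "B = ball 0 1 \<inter> uminus -` (- \<real>\<^sub>\<le>\<^sub>0)"
  have openA: "open A" unfolding A_def by (intro open_Diff) auto
  have openB: "open B" unfolding B_def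
    by (intro open_Int open_ball open_vimage) (auto intro!: continuous_intros)
  have ImLn: "Im (Ln q / (2 * of_real pi * \<i>)) > 0" if "q \<noteq> 0" "norm q < 1" for q
    by (rule qexp_inverse_Im_pos[OF that])
  have "f \<circ> (\<lambda>q. Ln q / (2 * of_real pi * \<i>)) holomorphic_on A"
  proof (rule holomorphic_on_compose_gen[OF _ hol])
    show "(\<lambda>q. Ln q / (2 * of_real pi * \<i>)) holomorphic_on A"
      by (intro holomorphic_intros) (auto simp: A_def)
    show "(\<lambda>q. Ln q / (2 * of_real pi * \<i>)) ` A \<subseteq> upper_half_plane"
    proof (rule image_subsetI)
      fix q assume "q \<in> A"
      hence "q \<noteq> 0" "norm q < 1" by (auto simp: A_def)
      from ImLn[OF this] show "Ln q / (2 * of_real pi * \<i>) \<in> upper_half_plane"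
        unfolding mem_Collect_eq .
    qed
  qed
  hence gA: "g holomorphic_on A" unfolding g_def[abs_def] o_def .
  define u where "u q = (Ln (- q) + of_real pi * \<i>) / (2 * of_real pi * \<i>)" for q
  have uB: "qexp (u q) = q" "Im (u q) > 0" if q: "q \<noteq> 0" "norm q < 1" for q
  proof -
    have "qexp (u q) = exp (Ln (- q) + of_real pi * \<i>)" by (simp add: qexp_def u_def)
    also have "\<dots> = q" using q by (simp add: exp_add)
    finally show 1: "qexp (u q) = q" .
    hence "exp (- 2 * pi * Im (u q)) < 1" using q norm_qexp[of "u q"] by simp
    thus "Im (u q) > 0" by (simp add: zero_less_mult_iff)
  qed
  have "f \<circ> u holomorphic_on B"
  proof (rule holomorphic_on_compose_gen[OF _ hol])
    show "u holomorphic_on B" unfolding u_def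
      by (intro holomorphic_intros) (auto simp: B_def)
    show "u ` B \<subseteq> upper_half_plane"
    proof (rule image_subsetI)
      fix q assume "q \<in> B"
      hence "q \<noteq> 0" "norm q < 1" by (auto simp: B_def)
      from uB(2)[OF this] show "u q \<in> upper_half_plane" by simp
    qed
  qed
  hence gB: "g holomorphic_on B"
  proof (rule holomorphic_transform)
    fix q assume "q \<in> B"
    hence q: "q \<noteq> 0" "norm q < 1" by (auto simp: B_def)
    show "(f \<circ> u) q = g q" unfolding g_def o_def
      using uB[OF q] qexp_inverse(1)[OF q(1)] ImLn[OF q]
      by (intro cusp_form_qexp_cong[OF f]) auto
  qed
  have AB: "A \<union> B = ball 0 1 - {0}"
  proof -
    have "q \<in> A \<union> B" if "q \<noteq> 0" "norm q < 1" for q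
    proof (cases "q \<in> \<real>\<^sub>\<le>\<^sub>0")
      case True
      hence "Im q = 0" "Re q < 0" using that(1) by (auto simp: complex_nonpos_Reals_iff complex_eq_iff)
      hence "- q \<notin> \<real>\<^sub>\<le>\<^sub>0" by (auto simp: complex_nonpos_Reals_iff)
      thus ?thesis using that by (auto simp: B_def)
    qed (use that in \<open>auto simp: A_def\<close>)
    thus ?thesis by (auto simp: A_def B_def)
  qed
  have "g holomorphic_on (ball 0 1 - {0})"
    unfolding AB[symmetric] by (intro holomorphic_on_Un gA gB openA openB)
  moreover have "(g \<longlongrightarrow> 0) (at 0)"
    unfolding g_def
  proof (rule filterlim_compose[OF lim])
    have "filterlim (\<lambda>q::complex. - ln (norm q) / (2 * pi)) at_top (at 0)"
    proof -
      have "filterlim (\<lambda>q::complex. norm q) (at_right 0) (at 0)"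
        unfolding filterlim_at by (auto intro!: tendsto_eq_intros simp: eventually_at_filter)
      hence "filterlim (\<lambda>q::complex. ln (norm q)) at_bot (at 0)"
        by (rule filterlim_compose[OF ln_at_0])
      hence "filterlim (\<lambda>q::complex. - ln (norm q)) at_top (at 0)"
        by (simp add: filterlim_uminus_at_top)
      hence "filterlim (\<lambda>q::complex. (1 / (2 * pi)) * (- ln (norm q))) at_top (at 0)"
        by (intro filterlim_tendsto_pos_mult_at_top[OF tendsto_const]) auto
      thus ?thesis by simp
    qed
    hence "filterlim (\<lambda>q. Im (Ln q / (2 * of_real pi * \<i>))) at_top (at 0)"
      by (rule filterlim_mono_eventually)
         (use qexp_inverse(2) in \<open>auto simp: eventually_at_filter simp del: Im_divide\<close>)
    thus "filterlim (\<lambda>q. Ln q / (2 * of_real pi * \<i>)) (filtercomap Im at_top) (at 0)"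
      by (simp add: filterlim_filtercomap_iff o_def)
  qed
  ultimately have "(\<lambda>q. if q = 0 then 0 else g q) holomorphic_on ball 0 1"
    by (intro removable_singularity) auto
  moreover have "f z = g (qexp z)" if "Im z > 0" for z
    unfolding g_def using that norm_qexp_less_1[OF that]
    by (intro cusp_form_qexp_cong[OF f that ImLn]) (simp_all only: qexp_inverse(1) qexp_nonzero simp_thms)
  ultimately show ?thesis
    by (intro that[of "\<lambda>q. if q = 0 then 0 else g q"]) auto
qed

lemma cusp_form_fourier:
  assumes f: "f \<in> cusp_forms k"
  shows "\<And>z. Im z > 0 \<Longrightarrow> (\<lambda>n. fourier_coeff f n * exp (2 * of_real pi * \<i> * of_nat n * z)) sums f z"
    and "fourier_coeff f 0 = 0"
proof -
  obtain h where h: "h holomorphic_on ball 0 1" "h 0 = 0" "\<And>z. Im z > 0 \<Longrightarrow> f z = h (qexp z)"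
    using cusp_form_on_disc[OF f] by blast
  define a where "a n = (deriv ^^ n) h 0 / fact n" for n
  have 1: "(\<lambda>n. a n * exp (2 * of_real pi * \<i> * of_nat n * z)) sums f z" if z: "Im z > 0" for z
    using holomorphic_power_series[OF h(1), of "qexp z"] norm_qexp_less_1[OF z]
    by (simp add: a_def h(3)[OF z] qexp_power)
  have "fourier_coeff f = a" by (rule fourier_coeff_eqI) (rule 1)
  thus "\<And>z. Im z > 0 \<Longrightarrow> (\<lambda>n. fourier_coeff f n * exp (2 * of_real pi * \<i> * of_nat n * z)) sums f z"
    and "fourier_coeff f 0 = 0"
    using 1 h(2) by (auto simp: a_def)
qed

lemma cusp_form_fourier_abs_summable:
  assumes f: "f \<in> cusp_forms k" and r: "0 \<le> r" "r < 1"
  shows "summable (\<lambda>n. norm (fourier_coeff f n) * r ^ n)"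
proof -
  have "(r + 1) / 2 \<noteq> 0" "norm (complex_of_real ((r + 1) / 2)) < 1" using r by (auto simp: norm_divide)
  then obtain z where z: "Im z > 0" "qexp z = of_real ((r + 1) / 2)"
    using qexp_surj[of "of_real ((r + 1) / 2)"] by (metis of_real_eq_0_iff)
  have "summable (\<lambda>n. fourier_coeff f n * of_real ((r + 1) / 2) ^ n)"
    using cusp_form_fourier(1)[OF f z(1)] by (simp add: sums_iff qexp_power[symmetric] z(2))
  hence "summable (\<lambda>n. norm (fourier_coeff f n * of_real r ^ n))"
    by (rule powser_insidea) (use r in \<open>auto simp: norm_divide\<close>)
  thus ?thesis using r by (simp add: norm_mult norm_power)
qed

text \<open>
  Without constant term the expansion is \<open>q\<close> times a power series that is bounded for \<open>Im z \<ge> y0\<close>.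
\<close>
lemma cusp_form_decay:
  assumes f: "f \<in> cusp_forms k" and y: "y0 > 0"
  obtains C where "C \<ge> 0" "\<And>z. Im z \<ge> y0 \<Longrightarrow> norm (f z) \<le> C * exp (- 2 * pi * Im z)"
proof -
  define r where "r = exp (- 2 * pi * y0)"
  have r: "0 < r" "r < 1" using y by (auto simp: r_def)
  let ?a = "fourier_coeff f"
  have sm: "summable (\<lambda>n. norm (?a n) * r ^ n)"
    using r by (intro cusp_form_fourier_abs_summable[OF f]) auto
  hence sm1: "summable (\<lambda>n. norm (?a (Suc n)) * r ^ n)"
  proof -
    have "summable (\<lambda>n. norm (?a (Suc n)) * r ^ Suc n)" using sm by (subst summable_Suc_iff)
    hence "summable (\<lambda>n. inverse r * (norm (?a (Suc n)) * r ^ Suc n))" by (rule summable_mult)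
    thus ?thesis using r by (simp add: field_simps)
  qed
  define C where "C = (\<Sum>n. norm (?a (Suc n)) * r ^ n)"
  have C0: "C \<ge> 0" unfolding C_def using r by (intro suminf_nonneg sm1) auto
  moreover have "norm (f z) \<le> C * exp (- 2 * pi * Im z)" if z: "Im z \<ge> y0" for z
  proof -
    have z0: "Im z > 0" using z y by simp
    have qr: "norm (qexp z) \<le> r" unfolding norm_qexp r_def using z by simp
    have "(\<lambda>n. ?a n * qexp z ^ n) sums f z" using cusp_form_fourier(1)[OF f z0] by (simp add: qexp_power)
    hence s: "(\<lambda>n. ?a (Suc n) * qexp z ^ Suc n) sums f z"
      by (subst sums_Suc_iff) (simp add: cusp_form_fourier(2)[OF f])
    have le: "norm (?a (Suc n) * qexp z ^ Suc n) \<le> norm (qexp z) * (norm (?a (Suc n)) * r ^ n)" for n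
    proof -
      have "norm (qexp z) ^ n \<le> r ^ n" using qr by (intro power_mono) auto
      hence "norm (qexp z) * (norm (?a (Suc n)) * norm (qexp z) ^ n) \<le> norm (qexp z) * (norm (?a (Suc n)) * r ^ n)"
        by (intro mult_left_mono) auto
      thus ?thesis by (simp add: norm_mult norm_power mult_ac)
    qed
    have "norm (f z) \<le> (\<Sum>n. norm (qexp z) * (norm (?a (Suc n)) * r ^ n))"
      unfolding sums_unique[OF s] by (rule norm_suminf_le[OF le summable_mult[OF sm1]])
    also have "\<dots> = norm (qexp z) * C" unfolding C_def by (rule suminf_mult[OF sm1])
    finally show ?thesis by (simp add: norm_qexp mult.commute)
  qed
  ultimately show ?thesis by (rule that)
qed

text \<open>
  A convergent expansion without constant term supplies both the holomorphy and the vanishing at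
  the cusp; only the transformation law is left to check.
\<close>
lemma cusp_formI:
  assumes s: "\<And>z. Im z > 0 \<Longrightarrow> (\<lambda>n. a n * exp (2 * of_real pi * \<i> * of_nat n * z)) sums f z"
    and a0: "a 0 = 0" and off: "\<And>z. \<not> Im z > 0 \<Longrightarrow> f z = 0"
    and mod: "\<And>a b c d :: int. \<And>z. a * d - b * c = 1 \<Longrightarrow> Im z > 0 \<Longrightarrow>
       f ((of_int a * z + of_int b) / (of_int c * z + of_int d)) = (of_int c * z + of_int d) powi k * f z"
  shows "f \<in> cusp_forms k"
proof -
  define h where "h q = (\<Sum>n. a n * q ^ n)" for q
  have sh: "(\<lambda>n. a n * (q - 0) ^ n) sums h q" if q: "q \<in> ball 0 1" for q
  proof (cases "q = 0")
    case True
    thus ?thesis using powser_sums_zero[of a] by (simp add: h_def)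
  next
    case False
    then obtain z where z: "Im z > 0" "qexp z = q" using q by (auto elim: qexp_surj)
    show ?thesis using s[OF z(1)] by (auto simp: qexp_power[symmetric] z(2) h_def sums_iff)
  qed
  have hol: "h holomorphic_on ball 0 1" using sh by (rule power_series_holomorphic)
  have fh: "f z = h (qexp z)" if "Im z > 0" for z
    using s[OF that] by (simp add: h_def qexp_power sums_iff)
  have h0: "h 0 = 0" using powser_zero[of a] by (simp add: h_def a0)
  have "h \<circ> qexp holomorphic_on upper_half_plane"
    by (rule holomorphic_on_compose_gen[OF _ hol])
       (auto simp: norm_qexp_less_1 intro!: holomorphic_on_qexp)
  hence fhol: "f holomorphic_on upper_half_plane"
    by (rule holomorphic_transform) (auto simp: fh)
  have "isCont h 0" using holomorphic_on_imp_continuous_on[OF hol]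
    by (simp add: continuous_on_eq_continuous_at)
  hence "(h \<longlongrightarrow> h 0) (nhds 0)" unfolding isCont_def by (simp only: tendsto_at_iff_tendsto_nhds)
  hence hlim: "(h \<longlongrightarrow> 0) (nhds 0)" by (simp only: h0)
  have "(qexp \<longlongrightarrow> 0) (filtercomap Im at_top)"
  proof (rule tendsto_norm_zero_cancel)
    have "((\<lambda>y. exp (- 2 * pi * y)) \<longlongrightarrow> 0) at_top" by real_asymp
    hence "((\<lambda>z. exp (- 2 * pi * Im z)) \<longlongrightarrow> 0) (filtercomap Im at_top)"
      by (rule filterlim_filtercomapI)
    thus "((\<lambda>z. norm (qexp z)) \<longlongrightarrow> 0) (filtercomap Im at_top)" by (simp add: norm_qexp)
  qed
  hence "((\<lambda>z. h (qexp z)) \<longlongrightarrow> 0) (filtercomap Im at_top)"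
    by (rule filterlim_compose[OF hlim])
  moreover have "eventually (\<lambda>z. Im z > 0) (filtercomap Im at_top)"
    by (rule eventually_filtercomapI[where P = "\<lambda>y. y > 0"]) (rule eventually_gt_at_top)
  hence "eventually (\<lambda>z. h (qexp z) = f z) (filtercomap Im at_top)"
    by eventually_elim (simp add: fh)
  ultimately have "(f \<longlongrightarrow> 0) (filtercomap Im at_top)"
    by (rule Lim_transform_eventually)
  thus ?thesis using fhol off mod by (auto simp: cusp_forms_def)
qed

section \<open>Bessel functions of integral order\<close>

text \<open>
  The Bessel-Clifford function \<open>C n\<close>, with \<open>J n(x) = (x/2)^n C n(x^2/4)\<close>. It is entire in
  \<open>t = x^2/4\<close>, and it is what Lipschitz's formula produces in the coefficients of the Poincare
  series.
\<close>
definition bessel_clifford :: "nat \<Rightarrow> real \<Rightarrow> real" where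
  "bessel_clifford n t = (\<Sum>j. (-1) ^ j / (fact j * fact (j + n)) * t ^ j)"

definition bessel_J :: "nat \<Rightarrow> real \<Rightarrow> real" where
  "bessel_J n x = (x / 2) ^ n * bessel_clifford n ((x / 2)\<^sup>2)"

lemma bessel_clifford_norm_le:
  "norm ((-1) ^ j / (fact j * fact (j + n)) * t ^ j :: real) \<le> norm (inverse (fact j) * \<bar>t\<bar> ^ j)"
proof -
  have "(1::real) \<le> fact (j + n)" by (rule fact_ge_1)
  hence "1 / (fact j * fact (j + n)) \<le> (1 / fact j :: real)"
    by (intro divide_left_mono) (auto simp: mult_le_cancel_left1)
  hence "1 / (fact j * fact (j + n)) * \<bar>t\<bar> ^ j \<le> 1 / fact j * \<bar>t\<bar> ^ j"
    by (intro mult_right_mono) auto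
  thus ?thesis
    by (simp add: abs_mult power_abs divide_simps)
qed

lemma bessel_clifford_summable_abs:
  "summable (\<lambda>j. norm ((-1) ^ j / (fact j * fact (j + n)) * t ^ j :: real))"
proof (rule summable_comparison_test')
  show "summable (\<lambda>j. inverse (fact j) * \<bar>t\<bar> ^ j)" by (rule summable_exp)
  show "norm (norm ((-1) ^ j / (fact j * fact (j + n)) * t ^ j :: real)) \<le> inverse (fact j) * \<bar>t\<bar> ^ j" for j
    using bessel_clifford_norm_le[of j n t] by (simp add: abs_mult)
qed

lemma bessel_clifford_summable:
  "summable (\<lambda>j. (-1) ^ j / (fact j * fact (j + n)) * t ^ j :: real)"
  using bessel_clifford_summable_abs by (rule summable_norm_cancel)

lemma bessel_clifford_deriv:
  "(bessel_clifford n has_real_derivative - bessel_clifford (Suc n) t) (at t)"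
proof -
  define c where "c = (\<lambda>j. (-1) ^ j / (fact j * fact (j + n)) :: real)"
  have "((\<lambda>x. \<Sum>j. c j * x ^ j) has_real_derivative (\<Sum>j. diffs c j * t ^ j)) (at t)"
    by (rule termdiffs_strong_converges_everywhere) (unfold c_def, rule bessel_clifford_summable)
  moreover have "diffs c j = - ((-1) ^ j / (fact j * fact (j + Suc n)))" for j
    unfolding diffs_def c_def by (simp add: field_simps del: of_nat_Suc)
  hence "(\<Sum>j. diffs c j * t ^ j) = (\<Sum>j. - ((-1) ^ j / (fact j * fact (j + Suc n)) * t ^ j))"
    by (simp only: mult_minus_left)
  hence "(\<Sum>j. diffs c j * t ^ j) = - bessel_clifford (Suc n) t"
    unfolding bessel_clifford_def by (simp only: suminf_minus[OF bessel_clifford_summable])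
  ultimately show ?thesis unfolding c_def bessel_clifford_def[abs_def] by simp
qed

lemma bessel_clifford_rec:
  "bessel_clifford n t = real (Suc n) * bessel_clifford (Suc n) t - t * bessel_clifford (n + 2) t"
proof -
  let ?c = "\<lambda>n j. (-1) ^ j / (fact j * fact (j + n)) :: real"
  have s: "(\<lambda>j. ?c n j * t ^ j) sums bessel_clifford n t" for n
    unfolding bessel_clifford_def using bessel_clifford_summable by (rule summable_sums)
  define g where "g j = (if j = 0 then 0 else ?c (n + 2) (j - 1) * t ^ j)" for j
  have "(\<lambda>j. g (Suc j)) sums (t * bessel_clifford (n + 2) t)"
    using sums_mult[OF s[of "n + 2"], of t] by (simp add: g_def mult_ac)
  hence g: "g sums (t * bessel_clifford (n + 2) t)"
    by (subst (asm) sums_Suc_iff) (simp add: g_def)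
  have "(\<lambda>j. real (Suc n) * (?c (Suc n) j * t ^ j) - g j) sums
        (real (Suc n) * bessel_clifford (Suc n) t - t * bessel_clifford (n + 2) t)"
    by (intro sums_diff sums_mult s g)
  also have "(\<lambda>j. real (Suc n) * (?c (Suc n) j * t ^ j) - g j) = (\<lambda>j. ?c n j * t ^ j)"
  proof
    fix j
    show "real (Suc n) * (?c (Suc n) j * t ^ j) - g j = ?c n j * t ^ j"
    proof (cases j)
      case 0
      thus ?thesis by (simp add: g_def)
    next
      case (Suc i)
      have "real (Suc n) * ?c (Suc n) (Suc i) - ?c (n + 2) i = ?c n (Suc i)"
      proof -
        have pos: "fact i > (0::real)" "fact (i + n) > (0::real)" by auto
        have f: "fact (Suc i + Suc n) = (real i + real n + 2) * ((real i + real n + 1) * fact (i + n))"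
          "fact (i + (n + 2)) = (real i + real n + 2) * ((real i + real n + 1) * fact (i + n))"
          "fact (Suc i + n) = (real i + real n + 1) * fact (i + n)"
          "fact (Suc i) = (real i + 1) * fact i"
          by (simp_all add: algebra_simps)
        have nz: "real i + real n + 2 \<noteq> 0" "real i + real n + 1 \<noteq> 0" "real i + 1 \<noteq> 0" by linarith+
        show ?thesis unfolding f using pos nz
          by (simp add: divide_simps) (simp add: algebra_simps)
      qed
      from arg_cong[OF this, of "\<lambda>c. c * t ^ Suc i"] show ?thesis unfolding Suc g_def
        by (simp only: nat.simps if_False diff_Suc_1 left_diff_distrib mult.assoc)
    qed
  qed
  finally show ?thesis using s[of n] sums_unique2 by blast
qed

lemma bessel_J_rec: "2 * real (Suc n) * bessel_J (Suc n) x = x * (bessel_J n x + bessel_J (n + 2) x)"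
proof -
  define a where "a = x / 2"
  have x: "x = 2 * a" by (simp add: a_def)
  have J: "bessel_J m x = a ^ m * bessel_clifford m (a\<^sup>2)" for m by (simp add: bessel_J_def a_def)
  have "x * (bessel_J n x + bessel_J (n + 2) x) =
      2 * (a ^ n * a * (bessel_clifford n (a\<^sup>2) + a\<^sup>2 * bessel_clifford (n + 2) (a\<^sup>2)))"
    unfolding J by (simp add: x power2_eq_square distrib_left mult_ac)
  also have "bessel_clifford n (a\<^sup>2) + a\<^sup>2 * bessel_clifford (n + 2) (a\<^sup>2) = real (Suc n) * bessel_clifford (Suc n) (a\<^sup>2)"
    using bessel_clifford_rec[of n "a\<^sup>2"] by simp
  finally show ?thesis unfolding J by (simp add: mult_ac)
qed

lemma bessel_J_deriv_0: "(bessel_J 0 has_real_derivative - bessel_J 1 x) (at x)"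
proof -
  have "((\<lambda>x::real. (x / 2)\<^sup>2) has_real_derivative x / 2) (at x)"
    by (auto intro!: derivative_eq_intros)
  from DERIV_chain2[OF bessel_clifford_deriv this, of 0] show ?thesis
    by (simp add: bessel_J_def[abs_def] mult_ac)
qed

lemma bessel_J_deriv_Suc:
  "(bessel_J (Suc n) has_real_derivative (bessel_J n x - bessel_J (n + 2) x) / 2) (at x)"
proof -
  have "((\<lambda>x::real. (x / 2)\<^sup>2) has_real_derivative x / 2) (at x)"
    by (auto intro!: derivative_eq_intros)
  note 1 = DERIV_chain2[OF bessel_clifford_deriv this, of "Suc n"]
  have 2: "((\<lambda>x::real. (x / 2) ^ Suc n) has_real_derivative real (Suc n) * (x / 2) ^ n / 2) (at x)"
    by (rule derivative_eq_intros refl | simp)+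
  note DERIV_mult[OF 2 1]
  also have "real (Suc n) * (x / 2) ^ n / 2 * bessel_clifford (Suc n) ((x / 2)\<^sup>2) +
      - bessel_clifford (Suc (Suc n)) ((x / 2)\<^sup>2) * (x / 2) * (x / 2) ^ Suc n =
      (bessel_J n x - bessel_J (n + 2) x) / 2"
  proof -
    define a where "a = x / 2"
    define B where "B m = bessel_clifford m (a\<^sup>2)" for m
    have B: "B n = real (Suc n) * B (Suc n) - a\<^sup>2 * B (n + 2)"
      unfolding B_def by (rule bessel_clifford_rec)
    show ?thesis unfolding bessel_J_def a_def[symmetric] B_def[symmetric] B
      by (simp add: power2_eq_square field_simps)
  qed
  finally show ?thesis unfolding bessel_J_def[abs_def] .
qed

lemma continuous_on_bessel_J [continuous_intros]:
  "continuous_on A f \<Longrightarrow> continuous_on A (\<lambda>x. bessel_J n (f x))"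
proof (rule continuous_on_compose2[of UNIV "bessel_J n"])
  show "continuous_on UNIV (bessel_J n)"
    by (cases n) (use bessel_J_deriv_0 bessel_J_deriv_Suc in
        \<open>blast intro: continuous_at_imp_continuous_on DERIV_isCont\<close>)+
qed auto

lemma bessel_clifford_0: "bessel_clifford n 0 = 1 / fact n"
  unfolding bessel_clifford_def by (subst powser_zero) simp

lemma bessel_J_at_0: "bessel_J n 0 = (if n = 0 then 1 else 0)"
  by (simp add: bessel_J_def bessel_clifford_0)

text \<open>
  Minus a partial sum of the left-hand side of Neumann's identity
  \<open>J 0(x)^2 + 2 \<Sum>m\<ge>1. J m(x)^2 = 1\<close>. Its derivative telescopes to \<open>2n J n(x)^2/x \<ge> 0\<close> and its
  value at \<open>0\<close> is \<open>-1\<close>, so for \<open>x \<ge> 0\<close> it stays between \<open>-1\<close> and \<open>0\<close>. This bounds every \<open>J m\<close> by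
  \<open>1\<close>, and it also serves as the comparison function for the energy in \<open>bessel_energy_le\<close>.
\<close>
definition bessel_neg_squares :: "nat \<Rightarrow> real \<Rightarrow> real" where
  "bessel_neg_squares n x = - (\<Sum>m<n. (bessel_J m x)\<^sup>2 + (bessel_J (Suc m) x)\<^sup>2)"

lemma bessel_neg_squares_deriv:
  "(bessel_neg_squares (Suc n) has_real_derivative
      bessel_J (Suc n) x * (bessel_J n x + bessel_J (n + 2) x)) (at x)"
proof (induction n)
  case 0
  show ?case unfolding bessel_neg_squares_def[abs_def]
    by (simp del: One_nat_def add: One_nat_def[symmetric])
       (rule derivative_eq_intros bessel_J_deriv_0 bessel_J_deriv_Suc[of 0, simplified] refl | simp add: field_simps numeral_2_eq_2)+
next
  case (Suc n)
  have eq: "bessel_neg_squares (Suc (Suc n)) = (\<lambda>x. bessel_neg_squares (Suc n) x - ((bessel_J (Suc n) x)\<^sup>2 + (bessel_J (Suc (Suc n)) x)\<^sup>2))"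
    by (simp add: bessel_neg_squares_def fun_eq_iff)
  show ?case unfolding eq
    by (rule derivative_eq_intros Suc.IH bessel_J_deriv_Suc refl)+ (simp add: field_simps)
qed

lemma bessel_neg_squares_deriv_times:
  "x * (bessel_J (Suc n) x * (bessel_J n x + bessel_J (n + 2) x)) = 2 * real (Suc n) * (bessel_J (Suc n) x)\<^sup>2"
proof -
  have "x * (bessel_J (Suc n) x * (bessel_J n x + bessel_J (n + 2) x)) =
      bessel_J (Suc n) x * (x * (bessel_J n x + bessel_J (n + 2) x))" by (simp only: mult_ac)
  thus ?thesis unfolding bessel_J_rec[symmetric] by (simp add: power2_eq_square)
qed

lemma bessel_neg_squares_deriv_nonneg:
  assumes "x \<ge> 0"
  shows "bessel_J (Suc n) x * (bessel_J n x + bessel_J (n + 2) x) \<ge> 0"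
proof (cases "x = 0")
  case False
  have "x * (bessel_J (Suc n) x * (bessel_J n x + bessel_J (n + 2) x)) \<ge> 0"
    unfolding bessel_neg_squares_deriv_times by simp
  with False assms show ?thesis by (simp add: zero_le_mult_iff)
qed (simp add: bessel_J_at_0)

lemma bessel_neg_squares_0: "bessel_neg_squares (Suc n) 0 = -1"
proof -
  have "(\<Sum>m<Suc n. (bessel_J m 0)\<^sup>2 + (bessel_J (Suc m) 0)\<^sup>2) = (\<Sum>m<Suc n. if m = 0 then 1 else 0)"
    by (rule sum.cong) (auto simp: bessel_J_at_0)
  thus ?thesis by (simp add: bessel_neg_squares_def)
qed

lemma bessel_neg_squares_le_0: "bessel_neg_squares n x \<le> 0"
  by (simp add: bessel_neg_squares_def sum_nonneg)

lemma bessel_neg_squares_ge: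
  assumes "x \<ge> 0" shows "bessel_neg_squares (Suc n) x \<ge> -1"
proof -
  have "bessel_neg_squares (Suc n) 0 \<le> bessel_neg_squares (Suc n) x"
    using assms by (rule DERIV_nonneg_imp_nondecreasing) (blast intro: bessel_neg_squares_deriv bessel_neg_squares_deriv_nonneg)
  thus ?thesis by (simp add: bessel_neg_squares_0)
qed

lemma abs_bessel_J_le_1:
  assumes "x \<ge> 0" shows "\<bar>bessel_J n x\<bar> \<le> 1"
proof -
  have "(bessel_J n x)\<^sup>2 \<le> (\<Sum>m<Suc n. (bessel_J m x)\<^sup>2 + (bessel_J (Suc m) x)\<^sup>2)"
    by (simp add: sum_nonneg)
  also have "\<dots> \<le> 1" using bessel_neg_squares_ge[OF assms, of n] by (simp add: bessel_neg_squares_def)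
  finally show ?thesis by (simp add: abs_square_le_1)
qed

text \<open>
  For \<open>n \<ge> 1\<close> this is \<open>x J'(x)\<close>, the derivative of \<open>J n\<close> in the variable \<open>ln x\<close>; with the two
  neighbours in place of the derivative it is also meaningful at \<open>x = 0\<close>.
\<close>
definition bessel_euler :: "nat \<Rightarrow> real \<Rightarrow> real" where
  "bessel_euler n x = x * (bessel_J (n - 1) x - bessel_J (Suc n) x) / 2"

text \<open>
  For \<open>n \<ge> 1\<close> this is \<open>n J n(x)/x\<close>, written so that it is continuous at \<open>0\<close>.
\<close>
definition bessel_mean :: "nat \<Rightarrow> real \<Rightarrow> real" where
  "bessel_mean n x = (bessel_J (n - 1) x + bessel_J (Suc n) x) / 2"

lemma bessel_mean_times: "n \<ge> 1 \<Longrightarrow> x * bessel_mean n x = real n * bessel_J n x"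
  using bessel_J_rec[of "n - 1" x] by (simp add: bessel_mean_def)

lemma abs_bessel_mean_le_1: "x \<ge> 0 \<Longrightarrow> \<bar>bessel_mean n x\<bar> \<le> 1"
  using abs_bessel_J_le_1[of x "n-1"] abs_bessel_J_le_1[of x "Suc n"] by (simp add: bessel_mean_def)

lemma bessel_J_deriv:
  "n \<ge> 1 \<Longrightarrow> (bessel_J n has_real_derivative (bessel_J (n - 1) x - bessel_J (Suc n) x) / 2) (at x)"
  using bessel_J_deriv_Suc[of "n - 1" x] by simp

text \<open>
  Bessel's differential equation, as \<open>x (x J')' = (n^2 - x^2) J\<close> divided by \<open>x\<close>.
\<close>
lemma bessel_euler_deriv:
  assumes n: "n \<ge> 1"
  shows "(bessel_euler n has_real_derivative real n * bessel_mean n x - x * bessel_J n x) (at x)"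
proof -
  have eq: "bessel_euler n = (\<lambda>x. real n * bessel_J n x - x * bessel_J (Suc n) x)"
    using bessel_mean_times[OF n] by (auto simp: fun_eq_iff bessel_euler_def bessel_mean_def field_simps)
  have rec: "x * ((bessel_J n x - bessel_J (n + 2) x) / 2) = x * bessel_J n x - real (Suc n) * bessel_J (Suc n) x"
    using bessel_J_rec[of n x] by (simp add: field_simps)
  have "((\<lambda>x. real n * bessel_J n x - x * bessel_J (Suc n) x) has_real_derivative
      real n * ((bessel_J (n - 1) x - bessel_J (Suc n) x) / 2) -
      (x * ((bessel_J n x - bessel_J (n + 2) x) / 2) + 1 * bessel_J (Suc n) x)) (at x)"
    by (intro DERIV_diff DERIV_cmult DERIV_mult' bessel_J_deriv[OF n] bessel_J_deriv_Suc DERIV_ident)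
  thus ?thesis unfolding eq rec
    by (rule DERIV_cong) (simp add: bessel_mean_def field_simps)
qed

text \<open>
  The energy of Bessel's equation in the variable \<open>ln x\<close>: there it reads
  \<open>J'' + (x^2 - n^2) J = 0\<close>, so only the growth of the potential \<open>x^2 - n^2\<close> contributes to the
  derivative of the energy.
\<close>
definition bessel_energy :: "nat \<Rightarrow> real \<Rightarrow> real" where
  "bessel_energy n x = (bessel_euler n x)\<^sup>2 + (x\<^sup>2 - (real n)\<^sup>2) * (bessel_J n x)\<^sup>2"

lemma bessel_energy_deriv:
  assumes n: "n \<ge> 1"
  shows "(bessel_energy n has_real_derivative 2 * x * (bessel_J n x)\<^sup>2) (at x)"
proof -
  define d where "d = (bessel_J (n - 1) x - bessel_J (Suc n) x) / 2"
  have W: "bessel_euler n x = x * d" by (simp add: bessel_euler_def d_def)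
  have "(bessel_energy n has_real_derivative
     2 * bessel_euler n x * (real n * bessel_mean n x - x * bessel_J n x) +
     (2 * x * (bessel_J n x)\<^sup>2 + (x\<^sup>2 - (real n)\<^sup>2) * (2 * bessel_J n x * d))) (at x)"
    unfolding bessel_energy_def[abs_def] d_def
    using n by (auto intro!: derivative_eq_intros bessel_euler_deriv bessel_J_deriv)
  also have "2 * bessel_euler n x * (real n * bessel_mean n x - x * bessel_J n x) =
     2 * real n * d * (x * bessel_mean n x) - 2 * x\<^sup>2 * d * bessel_J n x"
    unfolding W by (simp add: algebra_simps power2_eq_square)
  also have "\<dots> + (2 * x * (bessel_J n x)\<^sup>2 + (x\<^sup>2 - (real n)\<^sup>2) * (2 * bessel_J n x * d)) = 2 * x * (bessel_J n x)\<^sup>2"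
    unfolding bessel_mean_times[OF n] by (simp add: algebra_simps power2_eq_square)
  finally show ?thesis .
qed

lemma bessel_energy_nonneg:
  assumes n: "n \<ge> 1" and x: "x \<ge> 0"
  shows "bessel_energy n x \<ge> 0"
proof -
  have "bessel_energy n 0 \<le> bessel_energy n x"
    using x by (rule DERIV_nonneg_imp_nondecreasing) (use bessel_energy_deriv[OF n] in force)
  thus ?thesis using n by (simp add: bessel_energy_def bessel_euler_def bessel_J_at_0)
qed

text \<open>
  The energy grows at rate \<open>2 x J^2\<close>, and \<open>bessel_neg_squares\<close> at rate \<open>2 n J^2/x\<close>. For \<open>x \<le> Y\<close>
  the former is at most \<open>Y^2/n\<close> times the latter, whose total increase is at most \<open>1\<close>.
\<close>
lemma bessel_energy_le:
  assumes n: "n \<ge> 1" and Y: "Y \<ge> 0"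
  shows "bessel_energy n Y \<le> Y\<^sup>2 / real n"
proof -
  define G where "G x = Y\<^sup>2 / real n * bessel_neg_squares n x - bessel_energy n x" for x
  define D where "D x = bessel_J n x * (bessel_J (n - 1) x + bessel_J (Suc n) x)" for x
  have "G 0 \<le> G Y"
  proof (rule DERIV_nonneg_imp_nondecreasing[OF Y])
    fix x assume x: "0 \<le> x" "x \<le> Y"
    have "(bessel_neg_squares n has_real_derivative D x) (at x)"
      using bessel_neg_squares_deriv[of "n - 1" x] n by (simp add: D_def)
    hence "(G has_real_derivative (Y\<^sup>2 / real n * D x - 2 * x * (bessel_J n x)\<^sup>2)) (at x)"
      unfolding G_def[abs_def] using n by (auto intro!: derivative_eq_intros bessel_energy_deriv)
    moreover have xD: "x * D x = 2 * real n * (bessel_J n x)\<^sup>2"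
      using bessel_neg_squares_deriv_times[of x "n - 1"] n by (simp add: D_def)
    have "D x \<ge> 0" using bessel_neg_squares_deriv_nonneg[of x "n - 1"] n x by (simp add: D_def)
    hence "x\<^sup>2 * D x \<le> Y\<^sup>2 * D x" using x by (intro mult_right_mono power_mono) auto
    hence "x * (2 * real n * (bessel_J n x)\<^sup>2) \<le> Y\<^sup>2 * D x"
      unfolding xD[symmetric] by (simp add: power2_eq_square mult_ac)
    hence "Y\<^sup>2 / real n * D x - 2 * x * (bessel_J n x)\<^sup>2 \<ge> 0"
      using n by (simp add: field_simps)
    ultimately show "\<exists>y. (G has_real_derivative y) (at x) \<and> 0 \<le> y" by blast
  qed
  moreover have "G 0 = - (Y\<^sup>2 / real n)"
    using bessel_neg_squares_0[of "n - 1"] n by (simp add: G_def bessel_energy_def bessel_euler_def bessel_J_at_0)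
  moreover have "Y\<^sup>2 / real n * bessel_neg_squares n Y \<le> 0"
    using bessel_neg_squares_le_0[of n Y] by (intro mult_nonneg_nonpos) auto
  ultimately show ?thesis by (simp add: G_def)
qed

text \<open>
  Beyond \<open>x = n\<close> both parts of the energy are nonnegative, so its upper bound controls \<open>x J'\<close>.
\<close>
lemma abs_bessel_euler_le:
  assumes n: "n \<ge> 1" and x: "x \<ge> real n"
  shows "\<bar>bessel_euler n x\<bar> \<le> x / sqrt (real n)"
proof -
  have "(x\<^sup>2 - (real n)\<^sup>2) * (bessel_J n x)\<^sup>2 \<ge> 0" using x by (intro mult_nonneg_nonneg) auto
  hence "(bessel_euler n x)\<^sup>2 \<le> x\<^sup>2 / real n"
    using bessel_energy_le[OF n, of x] x unfolding bessel_energy_def by linarith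
  also have "\<dots> = (x / sqrt (real n))\<^sup>2" by (simp add: power_divide)
  finally show ?thesis using x by (auto simp: abs_le_square_iff[symmetric] abs_div_pos)
qed

lemma bessel_clifford_0_pos: "bessel_clifford n 0 > 0"
  by (simp add: bessel_clifford_0)

lemma isCont_bessel_clifford: "isCont (bessel_clifford n) x"
  using bessel_clifford_deriv by (rule DERIV_isCont)

lemma bessel_J_pos_near_0:
  "\<exists>e>0. \<forall>x. 0 < x \<and> x < e \<longrightarrow> bessel_J n x > 0"
proof -
  have "isCont (\<lambda>x. bessel_clifford n ((x/2)\<^sup>2)) 0"
    by (intro isCont_o2[OF _ isCont_bessel_clifford] continuous_intros) auto
  hence "((\<lambda>x. bessel_clifford n ((x/2)\<^sup>2)) \<longlongrightarrow> bessel_clifford n 0) (at 0)"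
    by (simp add: isCont_def)
  hence "eventually (\<lambda>x. bessel_clifford n ((x/2)\<^sup>2) > 0) (at 0)"
    by (rule order_tendstoD(1)) (rule bessel_clifford_0_pos)
  then obtain e where "e > 0" "\<And>x. x \<noteq> 0 \<Longrightarrow> \<bar>x\<bar> < e \<Longrightarrow> bessel_clifford n ((x/2)\<^sup>2) > 0"
    unfolding eventually_at by (auto simp: dist_real_def)
  thus ?thesis by (intro exI[of _ e]) (auto simp: bessel_J_def)
qed

lemma bessel_energy_pos:
  assumes n: "n \<ge> 1" and x: "x > 0"
  shows "bessel_energy n x > 0"
proof -
  obtain e where e: "e > 0" "\<And>x. 0 < x \<Longrightarrow> x < e \<Longrightarrow> bessel_J n x > 0"
    using bessel_J_pos_near_0 by blast
  define u where "u = min x (e/2)"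
  have u: "0 < u" "u \<le> x" "u < e" using x e by (auto simp: u_def)
  have "bessel_energy n (u/2) < bessel_energy n u"
  proof (rule DERIV_pos_imp_increasing[where f = "bessel_energy n"])
    show "u/2 < u" using u by simp
    fix y assume "u/2 \<le> y" "y \<le> u"
    hence "2 * y * (bessel_J n y)\<^sup>2 > 0" using u e(2)[of y] by auto
    thus "\<exists>z. (bessel_energy n has_real_derivative z) (at y) \<and> 0 < z" using bessel_energy_deriv[OF n] by blast
  qed
  also have "bessel_energy n u \<le> bessel_energy n x"
    using u(2) by (rule DERIV_nonneg_imp_nondecreasing) (use bessel_energy_deriv[OF n] u(1) in force)
  finally show ?thesis using bessel_energy_nonneg[OF n, of "u/2"] u by simp
qed

text \<open>
  Since the energy is positive, \<open>x J'\<close> has no zero on \<open>(0, n]\<close>: at a zero the energy would be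
  \<open>(x^2 - n^2) J^2 \<le> 0\<close>. As \<open>J n\<close> is positive near \<open>0\<close> and vanishes at \<open>0\<close>, the constant sign of
  \<open>x J'\<close> is positive, and \<open>J n\<close> increases up to \<open>n\<close>.
\<close>
lemma bessel_euler_J_pos:
  assumes n: "n \<ge> 1" and x: "0 < x" "x \<le> real n"
  shows "bessel_euler n x > 0" "bessel_J n x > 0"
proof -
  have nz: "bessel_euler n y \<noteq> 0" if "0 < y" "y \<le> real n" for y
  proof
    assume "bessel_euler n y = 0"
    hence "(y\<^sup>2 - (real n)\<^sup>2) * (bessel_J n y)\<^sup>2 > 0"
      using bessel_energy_pos[OF n that(1)] by (simp add: bessel_energy_def)
    moreover have "y\<^sup>2 \<le> (real n)\<^sup>2" using that by (intro power_mono) auto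
    hence "(y\<^sup>2 - (real n)\<^sup>2) * (bessel_J n y)\<^sup>2 \<le> 0" by (intro mult_nonpos_nonneg) auto
    ultimately show False by simp
  qed
  have contW: "isCont (bessel_euler n) y" for y using bessel_euler_deriv[OF n] by (rule DERIV_isCont)
  obtain e where e: "e > 0" "\<And>x. 0 < x \<Longrightarrow> x < e \<Longrightarrow> bessel_J n x > 0"
    using bessel_J_pos_near_0 by blast
  have W_pos: "bessel_euler n x > 0" if x: "0 < x" "x \<le> real n" for x
  proof (rule ccontr)
    assume "\<not> bessel_euler n x > 0"
    with nz[OF x] have neg: "bessel_euler n x < 0" by simp
    have neg': "bessel_euler n y < 0" if "0 < y" "y \<le> x" for y
    proof (rule ccontr)
      assume "\<not> bessel_euler n y < 0"
      hence "\<exists>z\<ge>y. z \<le> x \<and> bessel_euler n z = 0"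
        using IVT2[of "bessel_euler n" x 0 y] neg that contW by auto
      thus False using nz that x by force
    qed
    define u where "u = min x (e/2)"
    have u: "0 < u" "u \<le> x" "u < e" using x e by (auto simp: u_def)
    have "bessel_J n u \<le> bessel_J n 0"
    proof (rule DERIV_nonpos_imp_nonincreasing[where f = "bessel_J n"])
      show "0 \<le> u" using u by simp
      fix y assume y: "0 \<le> y" "y \<le> u"
      have "(bessel_J (n - 1) y - bessel_J (Suc n) y) / 2 \<le> 0"
      \<comment> \<open>At y = 0 the factor x in x J' hides the sign of J'; it is recovered by continuity.\<close>
      proof (cases "y = 0")
        case True
        show ?thesis
        proof (rule ccontr)
          assume a: "\<not> (bessel_J (n - 1) y - bessel_J (Suc n) y) / 2 \<le> 0"
          have "continuous_on UNIV (\<lambda>y. (bessel_J (n - 1) y - bessel_J (Suc n) y) / 2)"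
            by (intro continuous_intros) auto
          hence "isCont (\<lambda>y. (bessel_J (n - 1) y - bessel_J (Suc n) y) / 2) 0"
            by (simp add: continuous_on_eq_continuous_at)
          hence "((\<lambda>y. (bessel_J (n - 1) y - bessel_J (Suc n) y) / 2) \<longlongrightarrow>
               (bessel_J (n - 1) 0 - bessel_J (Suc n) 0) / 2) (at 0)" by (simp add: isCont_def)
          hence "eventually (\<lambda>y. (bessel_J (n - 1) y - bessel_J (Suc n) y) / 2 > 0) (at 0)"
            by (rule order_tendstoD(1)) (use a True in simp)
          then obtain d where d: "d > 0" "\<And>x. x \<noteq> 0 \<Longrightarrow> \<bar>x\<bar> < d \<Longrightarrow> (bessel_J (n - 1) x - bessel_J (Suc n) x) / 2 > 0"
            unfolding eventually_at by (auto simp: dist_real_def)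
          define v where "v = min u (d/2)"
          have v: "0 < v" "v \<le> u" "v < d" using u d by (auto simp: v_def)
          hence "bessel_euler n v > 0" using d(2)[of v] by (auto simp: bessel_euler_def)
          with neg'[of v] v u show False by simp
        qed
      next
        case False
        with y have "bessel_euler n y < 0" using neg'[of y] u by simp
        thus ?thesis using False y by (simp add: bessel_euler_def mult_less_0_iff)
      qed
      thus "\<exists>z. (bessel_J n has_real_derivative z) (at y) \<and> z \<le> 0" using bessel_J_deriv[OF n] by blast
    qed
    thus False using e(2)[of u] u n by (simp add: bessel_J_at_0)
  qed
  show "bessel_euler n x > 0" by (rule W_pos[OF x])
  show "bessel_J n x > 0"
  proof -
    define u where "u = min x (e/2)"
    have u: "0 < u" "u \<le> x" "u < e" using x e by (auto simp: u_def)
    have "bessel_J n u \<le> bessel_J n x"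
    proof (rule DERIV_nonneg_imp_nondecreasing[OF u(2)])
      fix y assume y: "u \<le> y" "y \<le> x"
      have "bessel_euler n y > 0" using W_pos[of y] y u x by simp
      hence "(bessel_J (n - 1) y - bessel_J (Suc n) y) / 2 \<ge> 0"
        using y u by (simp add: bessel_euler_def zero_less_mult_iff)
      thus "\<exists>z. (bessel_J n has_real_derivative z) (at y) \<and> 0 \<le> z" using bessel_J_deriv[OF n] by blast
    qed
    with e(2)[of u] u show ?thesis by simp
  qed
qed

lemma bessel_J_nonneg: "n \<ge> 1 \<Longrightarrow> 0 \<le> x \<Longrightarrow> x \<le> real n \<Longrightarrow> bessel_J n x \<ge> 0"
  using bessel_euler_J_pos(2)[of n x] by (cases "x = 0") (auto simp: bessel_J_at_0 less_imp_le)

text \<open>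
  Nonnegative energy gives \<open>x J' \<ge> \<surd>(n^2 - x^2) J \<ge> a J\<close> for \<open>x \<le> Z\<close>, with \<open>a = \<surd>(n^2 - Z^2)\<close>.
  Hence \<open>J n(x) / x^a\<close> is nondecreasing up to \<open>Z\<close>, where \<open>J n \<le> 1\<close>.
\<close>
lemma bessel_J_le_powr:
  assumes n: "n \<ge> 1" and y: "0 < y" "y \<le> Z" "Z < real n"
  shows "bessel_J n y \<le> (y / Z) powr (sqrt ((real n)\<^sup>2 - Z\<^sup>2))"
proof -
  define a where "a = sqrt ((real n)\<^sup>2 - Z\<^sup>2)"
  have Z2: "Z\<^sup>2 < (real n)\<^sup>2" using y by (intro power_strict_mono) auto
  have "bessel_J n y * y powr (-a) \<le> bessel_J n Z * Z powr (-a)"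
  proof (rule DERIV_nonneg_imp_nondecreasing[where f = "\<lambda>x. bessel_J n x * x powr (-a)", OF y(2)])
    fix x assume x: "y \<le> x" "x \<le> Z"
    hence x0: "x > 0" "x \<le> real n" using y by auto
    note pos = bessel_euler_J_pos[OF n x0]
    define d where "d = (bessel_J (n - 1) x - bessel_J (Suc n) x) / 2"
    have "((\<lambda>x. bessel_J n x * x powr (-a)) has_real_derivative
        (d * x powr (-a) + (-a * x powr (-a - 1)) * bessel_J n x)) (at x)"
      unfolding d_def using n x0 by (auto intro!: derivative_eq_intros bessel_J_deriv)
    also have "d * x powr (-a) + (-a * x powr (-a - 1)) * bessel_J n x = x powr (-a - 1) * (bessel_euler n x - a * bessel_J n x)"
    proof -
      have px: "x powr (-a) = x powr (-a - 1) * x" using x0 by (simp add: powr_diff)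
      have W: "bessel_euler n x = x * d" by (simp add: bessel_euler_def d_def)
      show ?thesis unfolding px W by (simp only: algebra_simps)
    qed
    finally have D: "((\<lambda>x. bessel_J n x * x powr (-a)) has_real_derivative
        x powr (-a - 1) * (bessel_euler n x - a * bessel_J n x)) (at x)" .
    have x2: "x\<^sup>2 \<le> Z\<^sup>2" using x x0 by (intro power_mono) auto
    have "(a * bessel_J n x)\<^sup>2 = ((real n)\<^sup>2 - Z\<^sup>2) * (bessel_J n x)\<^sup>2"
      using Z2 by (simp add: a_def power_mult_distrib)
    also have "\<dots> \<le> ((real n)\<^sup>2 - x\<^sup>2) * (bessel_J n x)\<^sup>2"
      using x2 by (intro mult_right_mono) auto
    also have "\<dots> \<le> (bessel_euler n x)\<^sup>2"
      using bessel_energy_nonneg[OF n, of x] x0 by (simp add: bessel_energy_def algebra_simps)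
    finally have "a * bessel_J n x \<le> bessel_euler n x"
      by (rule power2_le_imp_le) (use pos in simp)
    hence "x powr (-a - 1) * (bessel_euler n x - a * bessel_J n x) \<ge> 0" by simp
    with D show "\<exists>z. ((\<lambda>x. bessel_J n x * x powr (-a)) has_real_derivative z) (at x) \<and> 0 \<le> z" by blast
  qed
  also have "\<dots> \<le> 1 * Z powr (-a)"
    using abs_bessel_J_le_1[of Z n] y by (intro mult_right_mono) auto
  finally have "bessel_J n y * y powr (-a) * y powr a \<le> Z powr (-a) * y powr a"
    by (intro mult_right_mono) auto
  moreover have "y powr (-a) * y powr a = 1" using y by (simp add: powr_minus)
  moreover have "Z powr (-a) * y powr a = (y / Z) powr a" using y by (simp add: powr_minus powr_divide divide_simps)
  ultimately show ?thesis by (simp add: a_def[symmetric] mult.assoc)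
qed

section \<open>The first moment of a Bessel function\<close>

lemma set_integrable_exp_decay:
  assumes "s > 0"
  shows "set_integrable lborel {0..} (\<lambda>x::real. exp (- s * x))"
proof -
  have "set_integrable lebesgue {0..} (\<lambda>x::real. exp (- s * x))"
    using integrable_on_exp_minus_to_infinity[OF assms, of 0]
    by (intro nonnegative_absolutely_integrable_1) auto
  thus ?thesis unfolding set_integrable_def
    by (subst (asm) integrable_completion) auto
qed

lemma set_integrable_exp_times:
  fixes f :: "real \<Rightarrow> real"
  assumes "s > 0" "continuous_on UNIV f" "\<And>x. x \<ge> 0 \<Longrightarrow> \<bar>f x\<bar> \<le> C"
  shows "set_integrable lborel {0..} (\<lambda>x. exp (- s * x) * f x)"
proof (rule set_integrable_bound)
  show "set_integrable lborel {0..} (\<lambda>x. exp (- s * x) * C)"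
    using set_integrable_exp_decay[OF assms(1)] by (rule set_integrable_mult_left)
  have "f \<in> borel_measurable borel" using assms(2) by (rule borel_measurable_continuous_onI)
  thus "set_borel_measurable lborel {0..} (\<lambda>x. exp (- s * x) * f x)"
    unfolding set_borel_measurable_def by measurable
  show "AE x in lborel. x \<in> {0..} \<longrightarrow> norm (exp (- s * x) * f x) \<le> norm (exp (- s * x) * C)"
    using assms(3) by (auto simp: abs_mult intro!: always_eventually order.trans[OF assms(3)])
qed

lemma integral_FTC_at_top:
  fixes f F :: "real \<Rightarrow> real"
  assumes D: "\<And>x. (F has_real_derivative f x) (at x)"
    and c: "continuous_on UNIV f" and i: "set_integrable lborel {0..} f"
    and l: "(F \<longlongrightarrow> 0) at_top"
  shows "(LBINT x:{0..}. f x) = - F 0"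
proof -
  have "((\<lambda>b. LBINT x:{0..b}. f x) \<longlongrightarrow> (LBINT x:{0..}. f x)) at_top"
    by (rule tendsto_set_lebesgue_integral_at_top) (use i in auto)
  moreover have "eventually (\<lambda>b. (LBINT x:{0..b}. f x) = F b - F 0) at_top"
    using eventually_ge_at_top[of 0]
  proof eventually_elim
    case (elim b)
    show ?case unfolding set_lebesgue_integral_def
      by (rule integral_FTC_atLeastAtMost[OF elim])
         (auto intro!: has_field_derivative_at_within[OF D] continuous_on_subset[OF c]
               simp: has_real_derivative_iff_has_vector_derivative[symmetric])
  qed
  moreover have "((\<lambda>b. F b - F 0) \<longlongrightarrow> 0 - F 0) at_top" by (intro tendsto_intros l)
  ultimately have "((\<lambda>b. F b - F 0) \<longlongrightarrow> (LBINT x:{0..}. f x)) at_top"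
    by (simp add: tendsto_cong)
  with \<open>((\<lambda>b. F b - F 0) \<longlongrightarrow> 0 - F 0) at_top\<close> show ?thesis
    using tendsto_unique[OF trivial_limit_at_top_linorder] by force
qed

definition bessel_laplace :: "real \<Rightarrow> nat \<Rightarrow> real" where
  "bessel_laplace s m = (LBINT x:{0..}. exp (- s * x) * bessel_J m x)"

lemma set_integrable_exp_bessel:
  "s > 0 \<Longrightarrow> set_integrable lborel {0..} (\<lambda>x. exp (- s * x) * bessel_J m x)"
  by (rule set_integrable_exp_times[where C = 1])
     (auto intro!: continuous_intros abs_bessel_J_le_1)

lemma tendsto_exp_bessel:
  assumes "s > 0" shows "((\<lambda>x. exp (- s * x) * bessel_J m x) \<longlongrightarrow> 0) at_top"
proof (rule Lim_null_comparison)
  show "eventually (\<lambda>x. norm (exp (- s * x) * bessel_J m x) \<le> exp (- s * x)) at_top"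
    using eventually_ge_at_top[of 0]
    by eventually_elim (use abs_bessel_J_le_1[of _ m] in \<open>simp add: abs_mult mult_le_cancel_left1\<close>)
  show "((\<lambda>x. exp (- s * x)) \<longlongrightarrow> 0) at_top" using assms by real_asymp
qed

text \<open>
  Integrating the derivative of \<open>exp(-s x) J(m+1)(x)\<close> over the half-line, where
  \<open>2 J(m+1)' = J m - J(m+2)\<close>.
\<close>
lemma bessel_laplace_rec:
  assumes s: "s > 0"
  shows "bessel_laplace s (m + 2) = bessel_laplace s m - 2 * s * bessel_laplace s (Suc m)"
proof -
  let ?e = "\<lambda>m x. exp (- s * x) * bessel_J m x"
  note i = set_integrable_exp_bessel[OF s]
  have "(LBINT x:{0..}. (?e m x - ?e (m + 2) x) / 2 - s * ?e (Suc m) x) = - ?e (Suc m) 0"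
  proof (rule integral_FTC_at_top)
    fix x
    show "(?e (Suc m) has_real_derivative (?e m x - ?e (m + 2) x) / 2 - s * ?e (Suc m) x) (at x)"
      by (rule derivative_eq_intros bessel_J_deriv_Suc refl)+ (simp add: field_simps)
  qed (use i tendsto_exp_bessel[OF s] in \<open>auto intro!: continuous_intros\<close>)
  hence "(bessel_laplace s m - bessel_laplace s (m + 2)) / 2 - s * bessel_laplace s (Suc m) = 0"
    unfolding bessel_laplace_def using i by (simp add: bessel_J_at_0 set_integral_diff)
  thus ?thesis by (simp add: field_simps)
qed

lemma bessel_laplace_init:
  assumes s: "s > 0"
  shows "s * bessel_laplace s 0 + bessel_laplace s 1 = 1"
proof -
  let ?e = "\<lambda>m x. exp (- s * x) * bessel_J m x"
  note i = set_integrable_exp_bessel[OF s]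
  have "(LBINT x:{0..}. - ?e 1 x - s * ?e 0 x) = - ?e 0 0"
  proof (rule integral_FTC_at_top)
    fix x
    show "(?e 0 has_real_derivative - ?e 1 x - s * ?e 0 x) (at x)"
      by (rule derivative_eq_intros bessel_J_deriv_0 refl)+ (simp add: field_simps)
    have "set_integrable lborel {0..} (\<lambda>x. (-1) * ?e 1 x - s * ?e 0 x)"
      using i by (intro set_integral_diff set_integrable_mult_right)
    thus "set_integrable lborel {0..} (\<lambda>x. - ?e 1 x - s * ?e 0 x)" by simp
  qed (use tendsto_exp_bessel[OF s] in \<open>auto intro!: continuous_intros\<close>)
  moreover have "(LBINT x:{0..}. - ?e 1 x - s * ?e 0 x) =
      (LBINT x:{0..}. - ?e 1 x) - (LBINT x:{0..}. s * ?e 0 x)"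
  proof (rule set_integral_diff)
    have "set_integrable lborel {0..} (\<lambda>x. (-1) * ?e 1 x)"
      using i by (intro set_integrable_mult_right)
    thus "set_integrable lborel {0..} (\<lambda>x. - ?e 1 x)" by simp
  qed (use i in auto)
  moreover have "(LBINT x:{0..}. - ?e 1 x) = - bessel_laplace s 1"
    unfolding bessel_laplace_def by (simp add: set_lebesgue_integral_def)
  ultimately show ?thesis
    unfolding bessel_laplace_def using i by (simp add: bessel_J_at_0)
qed

lemma bessel_laplace_bound:
  assumes s: "s > 0"
  shows "\<bar>bessel_laplace s m\<bar> \<le> (LBINT x:{0..}. exp (- s * x))"
proof -
  have "norm (bessel_laplace s m) \<le> (LBINT x:{0..}. norm (exp (- s * x) * bessel_J m x))"
    unfolding bessel_laplace_def set_lebesgue_integral_def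
    by (rule order.trans[OF integral_norm_bound]) (simp add: abs_mult)
  also have "\<dots> \<le> (LBINT x:{0..}. exp (- s * x))"
    using set_integrable_exp_bessel[OF s, of m]
    by (intro set_integral_mono set_integrable_exp_decay[OF s] set_integrable_norm)
       (auto simp: abs_mult mult_le_cancel_left1 intro!: abs_bessel_J_le_1)
  finally show ?thesis by simp
qed

text \<open>
  The Laplace transforms satisfy a linear recurrence whose characteristic roots are \<open>r < 1\<close> and
  \<open>-1/r\<close>. They are bounded in \<open>m\<close>, so the component along the growing root \<open>-1/r\<close> vanishes and the
  sequence is geometric with ratio \<open>r\<close>; the initial value comes from \<open>J 0' = - J 1\<close>.
\<close>
lemma bessel_laplace_eq:
  assumes s: "s > 0"
  defines "r \<equiv> sqrt (1 + s\<^sup>2) - s"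
  shows "bessel_laplace s m = r ^ m / sqrt (1 + s\<^sup>2)" and "0 < r" and "r < 1" and "r * (r + 2 * s) = 1"
proof -
  let ?L = "bessel_laplace s"
  have "sqrt (1 + s\<^sup>2) > sqrt (s\<^sup>2)" by (intro real_sqrt_less_mono) auto
  thus r0: "r > 0" using s by (simp add: r_def)
  have "r * (r + 2 * s) = (sqrt (1 + s\<^sup>2))\<^sup>2 - s\<^sup>2"
    by (simp add: r_def algebra_simps power2_eq_square)
  thus rr: "r * (r + 2 * s) = 1" by simp
  show r1: "r < 1"
  proof (rule ccontr)
    assume "\<not> r < 1"
    hence "1 * 1 < r * (r + 2 * s)" using s by (intro mult_le_less_imp_less) auto
    with rr show False by simp
  qed
  \<comment> \<open>D measures the component along -1/r; it is multiplied by -1/r in each step.\<close>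
  define D where "D m = ?L (Suc m) - r * ?L m" for m
  have Dr: "r * D (Suc m) = - D m" for m
  proof -
    have "r * D (Suc m) = r * (?L (m + 2) - r * ?L (Suc m))" by (simp add: D_def)
    also have "\<dots> = r * ?L m - r * (r + 2 * s) * ?L (Suc m)"
      unfolding bessel_laplace_rec[OF s] by (simp add: algebra_simps)
    finally have "r * D (Suc m) = r * ?L m - r * (r + 2 * s) * ?L (Suc m)" .
    thus ?thesis unfolding rr by (simp add: D_def)
  qed
  have "\<bar>D 0\<bar> = r ^ m * \<bar>D m\<bar>" for m
  proof (induction m)
    case (Suc m)
    have "\<bar>D m\<bar> = r * \<bar>D (Suc m)\<bar>" using Dr[of m] r0 by (metis abs_minus abs_mult abs_of_pos)
    with Suc show ?case by simp
  qed auto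
  moreover define B where "B = (LBINT x:{0..}. exp (- s * x))"
  have "\<bar>D m\<bar> \<le> B + r * B" for m
  proof -
    have "\<bar>D m\<bar> \<le> \<bar>?L (Suc m)\<bar> + \<bar>r * ?L m\<bar>" unfolding D_def by (rule abs_triangle_ineq4)
    also have "\<dots> \<le> B + r * B" unfolding B_def abs_mult
      using r0 by (intro add_mono mult_mono bessel_laplace_bound[OF s]) auto
    finally show ?thesis .
  qed
  ultimately have le: "\<bar>D 0\<bar> \<le> r ^ m * (B + r * B)" for m
    using r0 by (metis mult_left_mono less_imp_le zero_le_power)
  have "(\<lambda>m. r ^ m * (B + r * B)) \<longlonglongrightarrow> 0 * (B + r * B)"
    using r0 r1 by (intro tendsto_intros LIMSEQ_realpow_zero) auto
  hence "\<bar>D 0\<bar> \<le> 0 * (B + r * B)"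
    by (rule Lim_bounded2[where N = 0]) (use le in auto)
  hence D0: "D 0 = 0" by simp
  have Dm: "D m = 0" for m
  proof (induction m)
    case (Suc m) thus ?case using Dr[of m] r0 by simp
  qed (rule D0)
  have Lm: "?L m = r ^ m * ?L 0" for m
  proof (induction m)
    case (Suc m) thus ?case using Dm[of m] by (simp add: D_def)
  qed auto
  have "sqrt (1 + s\<^sup>2) * ?L 0 = 1"
    using bessel_laplace_init[OF s] Lm[of 1] by (simp add: r_def algebra_simps)
  moreover have "sqrt (1 + s\<^sup>2) > 0" by (simp add: add_pos_nonneg)
  ultimately have "?L 0 = 1 / sqrt (1 + s\<^sup>2)" by (simp add: field_simps)
  thus "?L m = r ^ m / sqrt (1 + s\<^sup>2)" unfolding Lm[of m] by simp
qed

text \<open>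
  For \<open>s \<rightarrow> 0\<close> this becomes the integral \<open>1\<close> of \<open>n J n(x)/x\<close> over the half-line; the damping by
  \<open>exp(-s x)\<close> makes all integrals absolutely convergent in the meantime.
\<close>
lemma bessel_laplace_mean:
  assumes s: "s > 0" and n: "n \<ge> 1"
  shows "(LBINT x:{0..}. exp (- s * x) * bessel_mean n x) = (sqrt (1 + s\<^sup>2) - s) ^ n"
proof -
  define r where "r = sqrt (1 + s\<^sup>2) - s"
  note L = bessel_laplace_eq[OF s, folded r_def]
  have q: "sqrt (1 + s\<^sup>2) = r + s" "sqrt (1 + s\<^sup>2) > 0" by (auto simp: r_def add_pos_nonneg)
  obtain m where m: "n = Suc m" using n by (cases n) auto
  have "(LBINT x:{0..}. exp (- s * x) * bessel_mean n x) =
        (LBINT x:{0..}. (exp (- s * x) * bessel_J m x + exp (- s * x) * bessel_J (m + 2) x) / 2)"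
    by (intro set_lebesgue_integral_cong) (auto simp: bessel_mean_def m field_simps)
  also have "\<dots> = (bessel_laplace s m + bessel_laplace s (m + 2)) / 2"
    unfolding bessel_laplace_def using set_integrable_exp_bessel[OF s] by (simp add: set_integral_add)
  also have "\<dots> = r ^ m * (1 + r\<^sup>2) / 2 / (r + s)"
    unfolding L(1) q(1) by (simp add: add_divide_distrib power2_eq_square algebra_simps)
  also have "1 + r\<^sup>2 = 2 * r * (r + s)" using L(4) by (simp add: algebra_simps power2_eq_square)
  also have "r ^ m * (2 * r * (r + s)) / 2 / (r + s) = r ^ n" using q by (simp add: m)
  finally show ?thesis by (simp add: r_def)
qed

lemma DERIV_integral_from_0:
  fixes g :: "real \<Rightarrow> real"
  assumes "continuous_on UNIV g" "x > 0"
  shows "((\<lambda>x. integral {0..x} g) has_real_derivative g x) (at x)"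
proof -
  have "((\<lambda>x. integral {0..x} g) has_real_derivative g x) (at x within {0..x+1})"
    using assms by (intro integral_has_real_derivative continuous_on_subset[OF assms(1)]) auto
  moreover have "at x within {0..x+1} = at x" using assms by (intro at_within_interior) auto
  ultimately show ?thesis by simp
qed

text \<open>
  A mean value inequality with a variable bound on the derivative, for estimates by an explicit
  primitive \<open>v\<close>.
\<close>
lemma abs_diff_le_of_deriv:
  fixes f v :: "real \<Rightarrow> real"
  assumes "a \<le> b"
    and f: "\<And>x. a \<le> x \<Longrightarrow> x \<le> b \<Longrightarrow> (f has_real_derivative f' x) (at x)"
    and v: "\<And>x. a \<le> x \<Longrightarrow> x \<le> b \<Longrightarrow> (v has_real_derivative v' x) (at x)"
    and le: "\<And>x. a \<le> x \<Longrightarrow> x \<le> b \<Longrightarrow> \<bar>f' x\<bar> \<le> v' x"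
  shows "\<bar>f b - f a\<bar> \<le> v b - v a"
proof -
  have "v a - f a \<le> v b - f b"
    by (rule DERIV_nonneg_imp_nondecreasing[where f = "\<lambda>x. v x - f x", OF \<open>a \<le> b\<close>])
       (use f v le in \<open>force intro!: exI derivative_eq_intros\<close>)
  moreover have "v a + f a \<le> v b + f b"
    by (rule DERIV_nonneg_imp_nondecreasing[where f = "\<lambda>x. v x + f x", OF \<open>a \<le> b\<close>])
       (use f v le in \<open>force intro!: exI derivative_eq_intros\<close>)
  ultimately show ?thesis by linarith
qed

lemma continuous_on_bessel_mean [continuous_intros]: "continuous_on A (bessel_mean n)"
  unfolding bessel_mean_def[abs_def] by (intro continuous_intros) auto

text \<open>
  Bessel's equation gives \<open>(x^2 - n^2) M = - n (x J')'\<close> for \<open>M = n J/x\<close>. Dividing by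
  \<open>x^2 - n^2 > 0\<close> and integrating by parts leaves boundary terms and an integral of \<open>x J'\<close> against
  a monotone weight, both controlled by \<open>\<bar>x J'\<bar> \<le> x/\<surd>n\<close>. The bound is uniform in the damping
  \<open>s \<ge> 0\<close>, so that it survives the limit \<open>s \<rightarrow> 0\<close>.
\<close>
lemma bessel_mean_tail:
  assumes n: "n \<ge> 1" and Y: "Y > real n" and T: "T \<ge> Y" and s: "s \<ge> 0"
  shows "\<bar>integral {0..T} (\<lambda>x. exp (- s * x) * bessel_mean n x) -
          integral {0..Y} (\<lambda>x. exp (- s * x) * bessel_mean n x)\<bar> \<le> 4 * sqrt (real n) * Y / (Y\<^sup>2 - (real n)\<^sup>2)"
proof -
  define A where "A x = integral {0..x} (\<lambda>x. exp (- s * x) * bessel_mean n x)" for x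
  define N where "N = real n"
  have N: "N \<ge> 1" "Y > N" using n Y by (auto simp: N_def)
  have pos: "x\<^sup>2 - N\<^sup>2 > 0" if "x \<ge> Y" for x
    using power_strict_mono[of N x 2] that N by simp
  \<comment> \<open>For x beyond Y the weight 1/(x^2 - n^2) is at most c/x^2.\<close>
  define c where "c = Y\<^sup>2 / (Y\<^sup>2 - N\<^sup>2)"
  define g where "g x = exp (- s * x) / (x\<^sup>2 - N\<^sup>2)" for x
  define g' where "g' x = - (exp (- s * x) * (s * (x\<^sup>2 - N\<^sup>2) + 2 * x)) / (x\<^sup>2 - N\<^sup>2)\<^sup>2" for x
  have gd: "(g has_real_derivative g' x) (at x)" if "x \<ge> Y" for x
  proof -
    have 1: "((\<lambda>x. exp (- s * x)) has_real_derivative - s * exp (- s * x)) (at x)"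
      by (auto intro!: derivative_eq_intros)
    have 2: "((\<lambda>x. x\<^sup>2 - N\<^sup>2) has_real_derivative 2 * x) (at x)"
      by (auto intro!: derivative_eq_intros)
    show ?thesis unfolding g_def[abs_def] g'_def
      by (rule DERIV_cong[OF DERIV_divide[OF 1 2]])
         (use pos[OF that] in \<open>simp_all add: power2_eq_square algebra_simps\<close>)
  qed
  have g_le: "0 \<le> g x" "g x \<le> c / x\<^sup>2" "g' x \<le> 0" if x: "x \<ge> Y" for x
  proof -
    show "0 \<le> g x" using pos[OF x] by (simp add: g_def)
    have "g x \<le> 1 / (x\<^sup>2 - N\<^sup>2)" unfolding g_def
      using pos[OF x] x N s by (intro divide_right_mono) auto
    also have "\<dots> \<le> c / x\<^sup>2"
    proof -
      have "N\<^sup>2 * Y\<^sup>2 \<le> N\<^sup>2 * x\<^sup>2" using x N by (intro mult_left_mono power_mono) auto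
      thus ?thesis using pos[OF x] pos[of Y] x N
        by (simp add: c_def divide_simps) (simp add: algebra_simps)
    qed
    finally show "g x \<le> c / x\<^sup>2" .
    show "g' x \<le> 0" using pos[OF x] x N s by (simp add: g'_def divide_nonpos_nonneg)
  qed
  \<comment> \<open>R is the integral after integration by parts; V is a primitive of a bound of its
    derivative, using that the damped weight g has g' nonpositive.\<close>
  define R where "R x = A x + N * (g x * bessel_euler n x)" for x
  define V where "V x = sqrt N * (- (g x * x) - c / x)" for x
  have "\<bar>R T - R Y\<bar> \<le> V T - V Y"
  proof (rule abs_diff_le_of_deriv[OF T])
    fix x assume x: "Y \<le> x" "x \<le> T"
    have x0: "x > 0" using x N by simp
    define W' where "W' = real n * bessel_mean n x - x * bessel_J n x"
    have Ad: "(A has_real_derivative exp (- s * x) * bessel_mean n x) (at x)"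
      unfolding A_def by (rule DERIV_integral_from_0) (auto intro!: continuous_intros x0)
    have "(R has_real_derivative exp (- s * x) * bessel_mean n x + N * (g' x * bessel_euler n x + W' * g x)) (at x)"
      unfolding R_def[abs_def] W'_def
      by (intro DERIV_add Ad DERIV_cmult DERIV_mult gd x bessel_euler_deriv n)
    moreover have "N * W' = - bessel_mean n x * (x\<^sup>2 - N\<^sup>2)"
    proof -
      have "N * W' = N * N * bessel_mean n x - x * (real n * bessel_J n x)"
        by (simp add: W'_def N_def algebra_simps)
      also have "real n * bessel_J n x = x * bessel_mean n x" using bessel_mean_times[OF n] by simp
      finally show ?thesis by (simp add: algebra_simps power2_eq_square)
    qed
    hence "N * (W' * g x) = - exp (- s * x) * bessel_mean n x"
      using pos[OF x(1)] by (simp add: mult.assoc[symmetric] g_def)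
    ultimately show "(R has_real_derivative N * (g' x * bessel_euler n x)) (at x)"
      by (simp add: distrib_left)
    show "(V has_real_derivative sqrt N * (- (g' x * x + g x) + c / x\<^sup>2)) (at x)"
    proof -
      have 1: "((\<lambda>x. c / x) has_real_derivative - (c / x\<^sup>2)) (at x)"
        using x0 by (auto intro!: derivative_eq_intros simp: power2_eq_square)
      show ?thesis unfolding V_def[abs_def]
        by (rule DERIV_cong[OF DERIV_cmult[OF DERIV_diff[OF DERIV_minus[OF DERIV_mult[OF gd[OF x(1)] DERIV_ident]] 1]]])
           (simp add: algebra_simps)
    qed
    have "\<bar>N * (g' x * bessel_euler n x)\<bar> = N * (- g' x) * \<bar>bessel_euler n x\<bar>"
      using N g_le(3)[OF x(1)] by (simp add: abs_mult)
    also have "\<dots> \<le> N * (- g' x) * (x / sqrt N)"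
      using abs_bessel_euler_le[OF n, of x] N x g_le(3)[OF x(1)]
      by (intro mult_left_mono) (auto simp: N_def mult_nonneg_nonpos)
    also have "\<dots> = N / sqrt N * (- g' x * x)" by simp
    also have "\<dots> = sqrt N * (- g' x * x)"
      using N by (subst real_div_sqrt) auto
    also have "\<dots> \<le> sqrt N * (- (g' x * x + g x) + c / x\<^sup>2)"
      using g_le(2)[OF x(1)] N by (intro mult_left_mono) auto
    finally show "\<bar>N * (g' x * bessel_euler n x)\<bar> \<le> sqrt N * (- (g' x * x + g x) + c / x\<^sup>2)" .
  qed
  define b where "b = sqrt N * (c / Y)"
  have gx: "g x * x \<le> c / Y" if x: "x \<ge> Y" for x
  proof -
    have "g x * x \<le> c / x\<^sup>2 * x" using g_le(2)[OF x] x N by (intro mult_right_mono) auto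
    also have "\<dots> = c / x" using x N by (simp add: power2_eq_square)
    also have "\<dots> \<le> c / Y" using x N pos[of Y] by (intro divide_left_mono) (auto simp: c_def)
    finally show ?thesis .
  qed
  have c0: "c \<ge> 0" using pos[of Y] by (simp add: c_def)
  have "g T * T \<ge> 0" "c / T \<ge> 0" using g_le(1)[OF T] c0 T N by auto
  hence "V T \<le> 0" unfolding V_def using N by (intro mult_nonneg_nonpos) auto
  moreover have "- V Y \<le> 2 * b"
  proof -
    have "- V Y = sqrt N * (g Y * Y + c / Y)" by (simp add: V_def algebra_simps)
    also have "\<dots> \<le> sqrt N * (c / Y + c / Y)" using gx[of Y] N by (intro mult_left_mono) auto
    finally show ?thesis by (simp add: b_def algebra_simps)
  qed
  moreover have NgW: "\<bar>N * (g x * bessel_euler n x)\<bar> \<le> b" if x: "x \<ge> Y" for x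
  proof -
    have "\<bar>N * (g x * bessel_euler n x)\<bar> = N * g x * \<bar>bessel_euler n x\<bar>"
      using N g_le(1)[OF x] by (simp add: abs_mult)
    also have "\<dots> \<le> N * g x * (x / sqrt N)"
      using abs_bessel_euler_le[OF n, of x] N x g_le(1)[OF x]
      by (intro mult_left_mono) (auto simp: N_def)
    also have "\<dots> = N / sqrt N * (g x * x)" by simp
    also have "\<dots> = sqrt N * (g x * x)"
      using N by (subst real_div_sqrt) auto
    also have "\<dots> \<le> b" unfolding b_def using gx[OF x] N by (intro mult_left_mono) auto
    finally show ?thesis .
  qed
  ultimately have "\<bar>A T - A Y\<bar> \<le> 4 * b"
    using \<open>\<bar>R T - R Y\<bar> \<le> V T - V Y\<close> NgW[OF T] NgW[of Y] unfolding R_def by linarith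
  also have "4 * b = 4 * sqrt N * Y / (Y\<^sup>2 - N\<^sup>2)"
    using N by (simp add: b_def c_def power2_eq_square)
  finally show ?thesis unfolding A_def N_def .
qed

lemma integral_bessel_H:
  assumes n: "n \<ge> 1" and Y: "Y > real n"
  shows "\<bar>integral {0..Y} (bessel_mean n) - 1\<bar> \<le> 4 * sqrt (real n) * Y / (Y\<^sup>2 - (real n)\<^sup>2)"
proof -
  define \<beta> where "\<beta> = 4 * sqrt (real n) * Y / (Y\<^sup>2 - (real n)\<^sup>2)"
  define A where "A s x = integral {0..x} (\<lambda>x. exp (- s * x) * bessel_mean n x)" for s x :: real
  have Y0: "Y > 0" using Y by simp
  have int: "(\<lambda>x. exp (- s * x) * bessel_mean n x) integrable_on {0..Y}" for s
    by (intro integrable_continuous_interval continuous_intros)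
  have 1: "\<bar>(sqrt (1 + s\<^sup>2) - s) ^ n - A s Y\<bar> \<le> \<beta>" if s: "s > 0" for s
  proof -
    have si: "set_integrable lborel {0..} (\<lambda>x. exp (- s * x) * bessel_mean n x)"
      by (rule set_integrable_exp_times[OF s, where C = 1]) (auto intro!: continuous_intros abs_bessel_mean_le_1)
    have "((\<lambda>T. LBINT x:{0..T}. exp (- s * x) * bessel_mean n x) \<longlongrightarrow> (LBINT x:{0..}. exp (- s * x) * bessel_mean n x)) at_top"
      by (rule tendsto_set_lebesgue_integral_at_top) (use si in auto)
    moreover have "(LBINT x:{0..T}. exp (- s * x) * bessel_mean n x) = A s T" for T
      unfolding A_def by (intro set_borel_integral_eq_integral set_integrable_subset[OF si]) auto
    ultimately have "(A s \<longlongrightarrow> (sqrt (1 + s\<^sup>2) - s) ^ n) at_top"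
      using bessel_laplace_mean[OF s n] by simp
    hence "((\<lambda>T. \<bar>A s T - A s Y\<bar>) \<longlongrightarrow> \<bar>(sqrt (1 + s\<^sup>2) - s) ^ n - A s Y\<bar>) at_top"
      by (intro tendsto_intros)
    moreover have "eventually (\<lambda>T. \<bar>A s T - A s Y\<bar> \<le> \<beta>) at_top"
      using eventually_ge_at_top[of Y]
      by eventually_elim (unfold A_def \<beta>_def, rule bessel_mean_tail[OF n Y], use s in auto)
    ultimately show ?thesis by (rule tendsto_upperbound) simp
  qed
  have 2: "\<bar>A s Y - A 0 Y\<bar> \<le> s * Y * Y" if s: "s > 0" for s
  proof -
    have "A s Y - A 0 Y = integral {0..Y} (\<lambda>x. exp (- s * x) * bessel_mean n x - exp (- 0 * x) * bessel_mean n x)"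
      unfolding A_def by (intro Henstock_Kurzweil_Integration.integral_diff[symmetric] int)
    also have "norm \<dots> \<le> integral {0..Y} (\<lambda>x. s * Y)"
    proof (rule integral_norm_bound_integral)
      show "(\<lambda>x. exp (- s * x) * bessel_mean n x - exp (- 0 * x) * bessel_mean n x) integrable_on {0..Y}"
        by (intro integrable_diff int)
      fix x assume x: "x \<in> {0..Y}"
      have "1 - s * x \<le> exp (- s * x)" using exp_ge_add_one_self[of "- s * x"] by simp
      moreover have "exp (- s * x) \<le> 1" using x s by simp
      ultimately have "\<bar>exp (- s * x) - 1\<bar> \<le> s * x" by linarith
      also have "\<dots> \<le> s * Y" using x s by simp
      finally have "\<bar>exp (- s * x) - 1\<bar> * \<bar>bessel_mean n x\<bar> \<le> s * Y * 1"
        using x s by (intro mult_mono abs_bessel_mean_le_1) auto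
      thus "norm (exp (- s * x) * bessel_mean n x - exp (- 0 * x) * bessel_mean n x) \<le> s * Y"
        by (simp add: abs_mult[symmetric] algebra_simps)
    qed auto
    finally show ?thesis using Y0 by (simp add: mult_ac)
  qed
  have "((\<lambda>s. \<bar>(sqrt (1 + s\<^sup>2) - s) ^ n - A 0 Y\<bar> - s * Y * Y) \<longlongrightarrow>
        \<bar>(sqrt (1 + 0\<^sup>2) - 0) ^ n - A 0 Y\<bar> - 0 * Y * Y) (at_right 0)"
    by (intro tendsto_intros)
  moreover have "eventually (\<lambda>s. \<bar>(sqrt (1 + s\<^sup>2) - s) ^ n - A 0 Y\<bar> - s * Y * Y \<le> \<beta>) (at_right 0)"
  proof -
    have "\<bar>(sqrt (1 + s\<^sup>2) - s) ^ n - A 0 Y\<bar> - s * Y * Y \<le> \<beta>" if "s > 0" for s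
      using 1[OF that] 2[OF that] by linarith
    thus ?thesis by (auto simp: eventually_at_filter)
  qed
  ultimately have "\<bar>(sqrt (1 + 0\<^sup>2) - 0) ^ n - A 0 Y\<bar> - 0 * Y * Y \<le> \<beta>"
    by (rule tendsto_upperbound) simp
  thus ?thesis by (simp add: A_def \<beta>_def abs_minus_commute)
qed

definition bessel_moment :: "nat \<Rightarrow> real \<Rightarrow> real" where
  "bessel_moment n Y = integral {0..Y} (\<lambda>x. x * bessel_J n x)"

text \<open>
  The integrated form of Bessel's equation \<open>(x J')' = n M - x J\<close> with \<open>M = n J/x\<close>.
\<close>
lemma bessel_moment_eq:
  assumes n: "n \<ge> 1" and Y: "Y \<ge> 0"
  shows "bessel_moment n Y = real n * integral {0..Y} (bessel_mean n) - bessel_euler n Y"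
proof -
  have "((\<lambda>x. real n * bessel_mean n x - x * bessel_J n x) has_integral (bessel_euler n Y - bessel_euler n 0)) {0..Y}"
    by (rule fundamental_theorem_of_calculus[OF Y])
       (auto intro!: has_field_derivative_at_within[OF bessel_euler_deriv[OF n]]
             simp: has_real_derivative_iff_has_vector_derivative[symmetric])
  hence "integral {0..Y} (\<lambda>x. real n * bessel_mean n x - x * bessel_J n x) = bessel_euler n Y - bessel_euler n 0"
    by (rule integral_unique)
  moreover have "integral {0..Y} (\<lambda>x. real n * bessel_mean n x - x * bessel_J n x) =
      integral {0..Y} (\<lambda>x. real n * bessel_mean n x) - integral {0..Y} (\<lambda>x. x * bessel_J n x)"
    by (intro Henstock_Kurzweil_Integration.integral_diff integrable_continuous_interval continuous_intros)
  ultimately show ?thesis by (simp add: bessel_moment_def bessel_euler_def)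
qed

text \<open>
  Past the transition at \<open>n\<close> the moment has taken up essentially all its mass \<open>n\<close>: the half-line
  integral of \<open>n J n(x)/x\<close> is \<open>1\<close>, its tail is small, and \<open>\<bar>Y J'(Y)\<bar> \<le> Y/\<surd>n\<close>.
\<close>
lemma bessel_moment_approx:
  assumes n: "n \<ge> 1" and Y: "Y > real n"
  shows "\<bar>bessel_moment n Y - real n\<bar> \<le> real n * (4 * sqrt (real n) * Y / (Y\<^sup>2 - (real n)\<^sup>2)) + Y / sqrt (real n)"
proof -
  have "bessel_moment n Y - real n = real n * (integral {0..Y} (bessel_mean n) - 1) - bessel_euler n Y"
    using bessel_moment_eq[OF n, of Y] Y by (simp add: algebra_simps)
  also have "\<bar>\<dots>\<bar> \<le> \<bar>real n * (integral {0..Y} (bessel_mean n) - 1)\<bar> + \<bar>bessel_euler n Y\<bar>"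
    by (rule abs_triangle_ineq4)
  also have "\<dots> \<le> real n * (4 * sqrt (real n) * Y / (Y\<^sup>2 - (real n)\<^sup>2)) + Y / sqrt (real n)"
    unfolding abs_mult using integral_bessel_H[OF n Y] abs_bessel_euler_le[OF n, of Y] Y
    by (intro add_mono mult_mono) auto
  finally show ?thesis .
qed

lemma bessel_moment_small:
  assumes n: "n \<ge> 1" and Y: "0 < Y" "Y \<le> Z" "Z < real n"
  shows "0 \<le> bessel_moment n Y" "bessel_moment n Y \<le> Y\<^sup>2 * (Y / Z) powr sqrt ((real n)\<^sup>2 - Z\<^sup>2)"
proof -
  define a where "a = sqrt ((real n)\<^sup>2 - Z\<^sup>2)"
  have a: "a \<ge> 0" unfolding a_def using Y by (intro real_sqrt_ge_zero) (simp add: power_mono)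
  have int: "(\<lambda>x. x * bessel_J n x) integrable_on {0..Y}"
    by (intro integrable_continuous_interval continuous_intros)
  show "0 \<le> bessel_moment n Y" unfolding bessel_moment_def
    using Y by (intro integral_nonneg int mult_nonneg_nonneg bessel_J_nonneg n) auto
  have "bessel_moment n Y \<le> integral {0..Y} (\<lambda>x. Y * (Y / Z) powr a)" unfolding bessel_moment_def
  proof (rule integral_le[OF int])
    fix x assume x: "x \<in> {0..Y}"
    show "x * bessel_J n x \<le> Y * (Y / Z) powr a"
    proof (cases "x = 0")
      case False
      have "bessel_J n x \<le> (x / Z) powr a" unfolding a_def using x Y False by (intro bessel_J_le_powr n) auto
      also have "\<dots> \<le> (Y / Z) powr a" using x Y a by (intro powr_mono2 divide_right_mono) auto
      finally show ?thesis using x Y by (intro mult_mono bessel_J_nonneg n) auto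
    qed (use Y in auto)
  qed auto
  thus "bessel_moment n Y \<le> Y\<^sup>2 * (Y / Z) powr a" using Y by (simp add: power2_eq_square mult_ac)
qed

section \<open>Sums of Bessel functions over square roots\<close>

lemma bessel_J_mono:
  assumes n: "n \<ge> 1" and x: "0 \<le> x" "x \<le> y" "y \<le> real n"
  shows "bessel_J n x \<le> bessel_J n y"
proof (cases "x = 0")
  case True
  thus ?thesis using bessel_J_nonneg[OF n, of y] x n by (simp add: bessel_J_at_0)
next
  case False
  show ?thesis
  proof (rule DERIV_nonneg_imp_nondecreasing[where f = "bessel_J n", OF x(2)])
    fix z assume z: "x \<le> z" "z \<le> y"
    hence "bessel_euler n z > 0" using x False by (intro bessel_euler_J_pos n) auto
    hence "(bessel_J (n - 1) z - bessel_J (Suc n) z) / 2 \<ge> 0"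
      using z x False by (simp add: bessel_euler_def zero_less_mult_iff)
    thus "\<exists>D. (bessel_J n has_real_derivative D) (at z) \<and> 0 \<le> D" using bessel_J_deriv[OF n] by blast
  qed
qed

text \<open>
  A nondecreasing function whose increments dominate those of \<open>J n\<close>: up to \<open>n\<close> it is \<open>J n\<close> itself,
  which increases there, and beyond \<open>n\<close> it has slope \<open>1/\<surd>n\<close>, a bound for \<open>\<bar>J'\<bar>\<close>.
\<close>
definition bessel_variation :: "nat \<Rightarrow> real \<Rightarrow> real" where
  "bessel_variation n y = bessel_J n (min y (real n)) + max 0 (y - real n) / sqrt (real n)"

lemma abs_bessel_J_diff_le_variation:
  assumes n: "n \<ge> 1" and a: "0 \<le> a" "a \<le> b"
  shows "\<bar>bessel_J n b - bessel_J n a\<bar> \<le> bessel_variation n b - bessel_variation n a"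
proof -
  have low: "\<bar>bessel_J n y - bessel_J n x\<bar> \<le> bessel_variation n y - bessel_variation n x" if "0 \<le> x" "x \<le> y" "y \<le> real n" for x y
    using bessel_J_mono[OF n that] that by (simp add: bessel_variation_def)
  have high: "\<bar>bessel_J n y - bessel_J n x\<bar> \<le> bessel_variation n y - bessel_variation n x" if xy: "real n \<le> x" "x \<le> y" for x y
  proof -
    have "\<bar>bessel_J n y - bessel_J n x\<bar> \<le> y / sqrt (real n) - x / sqrt (real n)"
    proof (rule abs_diff_le_of_deriv[OF xy(2)])
      fix z assume z: "x \<le> z" "z \<le> y"
      show "(bessel_J n has_real_derivative (bessel_J (n - 1) z - bessel_J (Suc n) z) / 2) (at z)"
        by (rule bessel_J_deriv[OF n])
      show "((\<lambda>y. y / sqrt (real n)) has_real_derivative 1 / sqrt (real n)) (at z)"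
        by (rule DERIV_cdivide[OF DERIV_ident])
      have z0: "z > 0" using z xy n by simp
      have "z * \<bar>(bessel_J (n - 1) z - bessel_J (Suc n) z) / 2\<bar> = \<bar>bessel_euler n z\<bar>"
        using z0 by (simp add: bessel_euler_def abs_mult)
      also have "\<dots> \<le> z * (1 / sqrt (real n))" using abs_bessel_euler_le[OF n, of z] z xy by simp
      finally show "\<bar>(bessel_J (n - 1) z - bessel_J (Suc n) z) / 2\<bar> \<le> 1 / sqrt (real n)"
        using z0 by (rule mult_left_le_imp_le)
    qed
    thus ?thesis using xy by (simp add: bessel_variation_def diff_divide_distrib)
  qed
  show ?thesis
  proof (cases "b \<le> real n")
    case True thus ?thesis using low a by blast
  next
    case b: False
    show ?thesis
    proof (cases "a \<le> real n")
      case True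
      thus ?thesis using low[of a "real n"] high[of "real n" b] a b by linarith
    next
      case False thus ?thesis using high[of a b] a by simp
    qed
  qed
qed

lemma bessel_variation_bounds:
  assumes n: "n \<ge> 1" and y: "0 \<le> y"
  shows "0 \<le> bessel_variation n y" "bessel_variation n y \<le> 1 + y / sqrt (real n)"
proof -
  show "0 \<le> bessel_variation n y" unfolding bessel_variation_def using y n
    by (intro add_nonneg_nonneg bessel_J_nonneg) auto
  have "bessel_J n (min y (real n)) \<le> 1" using abs_bessel_J_le_1[of "min y (real n)" n] y by auto
  moreover have "max 0 (y - real n) / sqrt (real n) \<le> y / sqrt (real n)"
    using y by (intro divide_right_mono) auto
  ultimately show "bessel_variation n y \<le> 1 + y / sqrt (real n)" by (simp add: bessel_variation_def)
qed

text \<open>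
  The substitution \<open>y = 4\<pi> \<surd>t\<close> makes this a primitive of \<open>J n(4\<pi> \<surd>t)\<close>.
\<close>
definition bessel_prim :: "nat \<Rightarrow> real \<Rightarrow> real" where
  "bessel_prim n t = bessel_moment n (4 * pi * sqrt t) / (8 * pi\<^sup>2)"

lemma bessel_prim_deriv:
  assumes t: "t > 0"
  shows "(bessel_prim n has_real_derivative bessel_J n (4 * pi * sqrt t)) (at t)"
proof -
  have 1: "((\<lambda>t. 4 * pi * sqrt t) has_real_derivative 4 * pi * (inverse (sqrt t) / 2)) (at t)"
    by (intro DERIV_cmult DERIV_real_sqrt t)
  have 2: "(bessel_moment n has_real_derivative (4 * pi * sqrt t) * bessel_J n (4 * pi * sqrt t)) (at (4 * pi * sqrt t))"
    unfolding bessel_moment_def[abs_def]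
    by (rule DERIV_integral_from_0) (use t in \<open>auto intro!: continuous_intros\<close>)
  show ?thesis unfolding bessel_prim_def[abs_def]
    by (rule DERIV_cong[OF DERIV_cdivide[OF DERIV_chain2[OF 2 1]]])
       (use t in \<open>simp add: field_simps power2_eq_square\<close>)
qed

lemma bessel_prim_diff_le:
  assumes "0 < a" "a \<le> b"
  shows "\<bar>bessel_prim n b - bessel_prim n a\<bar> \<le> b - a"
  by (rule abs_diff_le_of_deriv[OF assms(2)])
     (use assms in \<open>auto intro!: bessel_prim_deriv derivative_eq_intros abs_bessel_J_le_1\<close>)

text \<open>
  On each unit interval the mean value theorem replaces the integral by a value of the integrand,
  which differs from the value at the right end by at most the variation on that interval.
\<close>
lemma sum_bessel_approx_nat:
  fixes N M :: nat
  assumes n: "n \<ge> 1" and N: "1 \<le> N" "N \<le> M"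
  shows "\<bar>(\<Sum>m\<in>{N<..M}. bessel_J n (4 * pi * sqrt (real m))) - (bessel_prim n (real M) - bessel_prim n (real N))\<bar>
     \<le> bessel_variation n (4 * pi * sqrt (real M)) - bessel_variation n (4 * pi * sqrt (real N))"
  using N(2)
proof (induction M rule: dec_induct)
  case (step M)
  let ?f = "\<lambda>t. bessel_J n (4 * pi * sqrt t)" and ?v = "\<lambda>t. bessel_variation n (4 * pi * sqrt t)"
  have "\<exists>z>real M. z < real (Suc M) \<and> bessel_prim n (real (Suc M)) - bessel_prim n (real M) = (real (Suc M) - real M) * ?f z"
    using step N by (intro MVT2 bessel_prim_deriv) auto
  then obtain z where z: "real M < z" "z < real (Suc M)"
    "bessel_prim n (real (Suc M)) - bessel_prim n (real M) = ?f z" by auto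
  have m: "?v (real M) \<le> ?v z"
    using abs_bessel_J_diff_le_variation[OF n, of "4 * pi * sqrt (real M)" "4 * pi * sqrt z"] z by auto
  have "\<bar>?f (real (Suc M)) - ?f z\<bar> \<le> ?v (real (Suc M)) - ?v z"
    using z by (intro abs_bessel_J_diff_le_variation[OF n]) auto
  hence "\<bar>?f (real (Suc M)) - (bessel_prim n (real (Suc M)) - bessel_prim n (real M))\<bar> \<le> ?v (real (Suc M)) - ?v (real M)"
    unfolding z(3) using m by linarith
  moreover have "{N<..Suc M} = insert (Suc M) {N<..M}" using step by auto
  hence "(\<Sum>m\<in>{N<..Suc M}. ?f (real m)) = ?f (real (Suc M)) + (\<Sum>m\<in>{N<..M}. ?f (real m))"
    by simp
  ultimately show ?case using step.IH by linarith
qed auto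

lemma sum_bessel_approx:
  assumes n: "n \<ge> 1" and a: "1 \<le> a" "a \<le> b"
  shows "\<bar>(\<Sum>m | a < real m \<and> real m \<le> b. bessel_J n (4 * pi * sqrt (real m))) - (bessel_prim n b - bessel_prim n a)\<bar>
     \<le> 3 + 4 * pi * sqrt b / sqrt (real n)"
proof -
  define N where "N = nat \<lfloor>a\<rfloor>"
  define M where "M = nat \<lfloor>b\<rfloor>"
  have N: "1 \<le> N" "real N \<le> a" "a < real N + 1" and M: "real M \<le> b" "b < real M + 1"
    using a unfolding N_def M_def by (auto simp: le_nat_iff le_floor_iff)
  have NM: "N \<le> M" unfolding N_def M_def using a by (intro nat_mono floor_mono)
  have set: "{m. a < real m \<and> real m \<le> b} = {N<..M}"
  proof (intro equalityI subsetI)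
    fix m assume "m \<in> {m. a < real m \<and> real m \<le> b}"
    hence "real N < real m" "real m < real M + 1" using N M by auto
    thus "m \<in> {N<..M}" by auto
  next
    fix m assume "m \<in> {N<..M}"
    hence "real m \<ge> real N + 1" "real m \<le> real M" by auto
    thus "m \<in> {m. a < real m \<and> real m \<le> b}" using N M by auto
  qed
  have "\<bar>(\<Sum>m\<in>{N<..M}. bessel_J n (4 * pi * sqrt (real m))) - (bessel_prim n (real M) - bessel_prim n (real N))\<bar>
     \<le> bessel_variation n (4 * pi * sqrt (real M)) - bessel_variation n (4 * pi * sqrt (real N))"
    by (rule sum_bessel_approx_nat[OF n N(1) NM])
  also have "\<dots> \<le> 1 + 4 * pi * sqrt (real M) / sqrt (real n)"
    using bessel_variation_bounds[OF n, of "4 * pi * sqrt (real M)"] bessel_variation_bounds[OF n, of "4 * pi * sqrt (real N)"]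
    by simp
  also have "\<dots> \<le> 1 + 4 * pi * sqrt b / sqrt (real n)"
    using M by (intro add_left_mono divide_right_mono mult_left_mono) auto
  finally have *: "\<bar>(\<Sum>m\<in>{N<..M}. bessel_J n (4 * pi * sqrt (real m))) - (bessel_prim n (real M) - bessel_prim n (real N))\<bar>
     \<le> 1 + 4 * pi * sqrt b / sqrt (real n)" .
  have "\<bar>bessel_prim n b - bessel_prim n (real M)\<bar> \<le> 1" "\<bar>bessel_prim n a - bessel_prim n (real N)\<bar> \<le> 1"
    using bessel_prim_diff_le[of "real M" b n] bessel_prim_diff_le[of "real N" a n] N M NM by auto
  with * show ?thesis unfolding set by linarith
qed

section \<open>Summation over integers and lattices\<close>

lemma summable_on_times_dominated:
  fixes f :: "'a \<Rightarrow> 'b \<Rightarrow> 'c :: banach"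
  assumes u: "u summable_on A" and v: "v summable_on B"
    and le: "\<And>x y. x \<in> A \<Longrightarrow> y \<in> B \<Longrightarrow> norm (f x y) \<le> u x * (v y :: real)"
    and nn: "\<And>x. x \<in> A \<Longrightarrow> 0 \<le> u x" "\<And>y. y \<in> B \<Longrightarrow> 0 \<le> v y"
  shows "(\<lambda>p. norm (case p of (x, y) \<Rightarrow> f x y)) summable_on A \<times> B"
proof (rule Infinite_Sum.abs_summable_on_comparison_test)
  have "(\<lambda>(x, y). u x * v y) summable_on A \<times> B"
  proof (rule summable_on_SigmaI)
    show "((\<lambda>y. case (x, y) of (x, y) \<Rightarrow> u x * v y) has_sum u x * infsum v B) B" for x
      using has_sum_cmult_right[OF has_sum_infsum[OF v], of "u x"] by simp
    show "(\<lambda>x. u x * infsum v B) summable_on A" by (intro summable_on_cmult_left u)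
  qed (use nn in auto)
  thus "(\<lambda>p. norm (case p of (x, y) \<Rightarrow> u x * v y)) summable_on A \<times> B"
    by (subst summable_on_iff_abs_summable_on_real[symmetric])
  fix p assume "p \<in> A \<times> B"
  thus "norm (case p of (x, y) \<Rightarrow> f x y) \<le> norm (case p of (x, y) \<Rightarrow> u x * v y)"
    using le nn by (auto intro: order.trans[OF le])
qed

text \<open>
  Fubini for infinite sums in the form used throughout: the family is dominated by a product of
  two summable sequences.
\<close>
lemma infsum_swap_dominated:
  fixes f :: "'a \<Rightarrow> 'b \<Rightarrow> 'c :: banach"
  assumes "u summable_on A" and "v summable_on B"
    and "\<And>x y. x \<in> A \<Longrightarrow> y \<in> B \<Longrightarrow> norm (f x y) \<le> u x * (v y :: real)"
    and "\<And>x. x \<in> A \<Longrightarrow> 0 \<le> u x" "\<And>y. y \<in> B \<Longrightarrow> 0 \<le> v y"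
  shows "(\<Sum>\<^sub>\<infinity>x\<in>A. \<Sum>\<^sub>\<infinity>y\<in>B. f x y) = (\<Sum>\<^sub>\<infinity>y\<in>B. \<Sum>\<^sub>\<infinity>x\<in>A. f x y)"
  using abs_summable_summable[OF summable_on_times_dominated[OF assms]] by (rule infsum_swap_banach)

lemma bij_betw_int_halves:
  "inj int" "inj (\<lambda>k. - 1 - int k)" "range int \<inter> range (\<lambda>k. - 1 - int k) = {}"
  "range int \<union> range (\<lambda>k. - 1 - int k) = UNIV"
proof -
  show "range int \<union> range (\<lambda>k. - 1 - int k) = UNIV"
  proof (intro equalityI subsetI UNIV_I)
    fix m :: int
    show "m \<in> range int \<union> range (\<lambda>k. - 1 - int k)"
    proof (cases "m \<ge> 0")
      case True
      hence "m = int (nat m)" by simp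
      thus ?thesis by blast
    next
      case False
      hence "m = - 1 - int (nat (- 1 - m))" by simp
      thus ?thesis by blast
    qed
  qed
qed (auto simp: inj_on_def)

lemma has_sum_int_halves:
  fixes f :: "int \<Rightarrow> 'a :: banach"
  assumes "((\<lambda>k. f (int k)) has_sum a) UNIV" "((\<lambda>k. f (- 1 - int k)) has_sum b) UNIV"
  shows "(f has_sum (a + b)) UNIV"
proof -
  have "(f has_sum a) (range int)"
    using assms(1) by (subst has_sum_reindex[OF bij_betw_int_halves(1)]) (simp add: o_def)
  moreover have "(f has_sum b) (range (\<lambda>k. - 1 - int k))"
    using assms(2) by (subst has_sum_reindex[OF bij_betw_int_halves(2)]) (simp add: o_def)
  ultimately show ?thesis
    using has_sum_Un_disjoint[of f "range int" a "range (\<lambda>k. - 1 - int k)" b] bij_betw_int_halves(3,4) by simp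
qed

lemma summable_on_inverse_square_int: "(\<lambda>m::int. 1 / (1 + (real_of_int m)\<^sup>2)) summable_on UNIV"
proof -
  have s: "summable (\<lambda>k. 1 / (1 + (real k)\<^sup>2))"
  proof (rule summable_comparison_test_bigo)
    show "summable (\<lambda>k. norm (1 / real k ^ 2))" using inverse_power_summable[of 2, where 'a = real] by (simp add: field_simps)
    show "(\<lambda>k. 1 / (1 + (real k)\<^sup>2)) \<in> O(\<lambda>k. 1 / real k ^ 2)" by real_asymp
  qed
  hence 1: "(\<lambda>k. 1 / (1 + (real k)\<^sup>2)) summable_on UNIV"
    by (intro norm_summable_imp_summable_on) simp
  have "summable (\<lambda>k. 1 / (1 + (real (Suc k))\<^sup>2))" using s by (subst summable_Suc_iff)
  hence 2: "(\<lambda>k. 1 / (1 + (real (Suc k))\<^sup>2)) summable_on UNIV"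
    by (intro norm_summable_imp_summable_on) simp
  have "(\<lambda>k. 1 / (1 + (real_of_int (- 1 - int k))\<^sup>2)) = (\<lambda>k. 1 / (1 + (real (Suc k))\<^sup>2))"
    by (simp add: fun_eq_iff power2_eq_square algebra_simps)
  with has_sum_int_halves[of "\<lambda>m. 1 / (1 + (real_of_int m)\<^sup>2)"] 1 2 show ?thesis
    unfolding summable_on_def by fastforce
qed

text \<open>
  \<open>\<bar>c z + d\<bar>^2\<close> is a positive definite quadratic form in \<open>(c, d)\<close>.
\<close>
lemma norm_lattice_lower_bound:
  assumes "Im z > 0"
  obtains \<delta> where "0 < \<delta>" "\<delta> \<le> 1" "\<And>c d :: real. \<delta> * (c\<^sup>2 + d\<^sup>2) \<le> (norm (of_real c * z + of_real d))\<^sup>2"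
proof -
  define x y where "x = Re z" "y = Im z"
  \<comment> \<open>Chosen so that d^2 = ((c x + d) - c x)^2 can be absorbed: d^2 is at most 2 (c x + d)^2 + 2
    x^2 c^2.\<close>
  define M where "M = 2 + (1 + 2 * x\<^sup>2) / y\<^sup>2"
  have y: "y > 0" using assms by (simp add: x_y_def)
  have M: "M \<ge> 2" using y by (simp add: M_def)
  have "1 / M * (c\<^sup>2 + d\<^sup>2) \<le> (norm (of_real c * z + of_real d))\<^sup>2" for c d :: real
  proof -
    define u where "u = c * x + d"
    have n: "(norm (of_real c * z + of_real d))\<^sup>2 = u\<^sup>2 + (c * y)\<^sup>2"
      by (simp add: cmod_power2 u_def x_y_def)
    have "0 \<le> (u + c * x)\<^sup>2" by simp
    hence "c\<^sup>2 + d\<^sup>2 \<le> 2 * u\<^sup>2 + (1 + 2 * x\<^sup>2) * c\<^sup>2"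
      by (simp add: u_def power2_eq_square algebra_simps)
    also have "(1 + 2 * x\<^sup>2) * c\<^sup>2 = (1 + 2 * x\<^sup>2) / y\<^sup>2 * (c * y)\<^sup>2"
      using y by (simp add: power_mult_distrib)
    also have "2 * u\<^sup>2 + (1 + 2 * x\<^sup>2) / y\<^sup>2 * (c * y)\<^sup>2 \<le> M * u\<^sup>2 + M * (c * y)\<^sup>2"
      using M by (intro add_mono mult_right_mono) (auto simp: M_def)
    finally show ?thesis using M unfolding n by (simp add: field_simps)
  qed
  thus ?thesis using M by (intro that[of "1 / M"]) auto
qed

text \<open>
  The product form of the bound makes lattice sums convergent by comparison with products of
  one-dimensional sums; it takes \<open>K \<ge> 4\<close>, since \<open>(c^2 + d^2)^2\<close> is needed to dominate
  \<open>(1 + c^2)(1 + d^2)\<close> up to a constant.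
\<close>
lemma inverse_norm_lattice_bound:
  fixes c d :: int
  assumes \<delta>: "0 < \<delta>" "\<delta> * ((real_of_int c)\<^sup>2 + (real_of_int d)\<^sup>2) \<le> (norm w)\<^sup>2"
    and cd: "(c, d) \<noteq> (0, 0)" and K: "K \<ge> 4"
  shows "1 / norm w ^ K \<le> (4 / sqrt \<delta> ^ K) * (1 / (1 + (real_of_int c)\<^sup>2)) * (1 / (1 + (real_of_int d)\<^sup>2))"
proof -
  define s where "s = (real_of_int c)\<^sup>2 + (real_of_int d)\<^sup>2"
  have "c\<^sup>2 + d\<^sup>2 \<ge> 1"
    using cd by (metis int_one_le_iff_zero_less sum_power2_gt_zero_iff prod.inject)
  hence "real_of_int (c\<^sup>2 + d\<^sup>2) \<ge> real_of_int 1" by (simp only: of_int_le_iff)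
  hence s1: "s \<ge> 1" by (simp add: s_def)
  have "sqrt (\<delta> * s) \<le> sqrt ((norm w)\<^sup>2)" using \<delta> by (intro real_sqrt_le_mono) (simp add: s_def)
  hence w: "sqrt \<delta> * sqrt s \<le> norm w" by (simp add: real_sqrt_mult)
  have "sqrt \<delta> ^ K * s\<^sup>2 = sqrt \<delta> ^ K * sqrt s ^ 4"
    using s1 by (simp add: power4_eq_xxxx power2_eq_square)
  also have "\<dots> \<le> sqrt \<delta> ^ K * sqrt s ^ K"
    using s1 K \<delta> by (intro mult_left_mono power_increasing) auto
  also have "\<dots> \<le> norm w ^ K" unfolding power_mult_distrib[symmetric]
    using w s1 \<delta> by (intro power_mono) auto
  finally have 1: "sqrt \<delta> ^ K * s\<^sup>2 \<le> norm w ^ K" .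
  have "(1 + (real_of_int c)\<^sup>2) * (1 + (real_of_int d)\<^sup>2) \<le> (2 * s) * (2 * s)"
  proof -
    have "1 + C \<le> 2 * s \<and> 1 + D \<le> 2 * s" if "s = C + D" "C \<ge> 0" "D \<ge> 0" for C D :: real
      using that s1 by linarith
    from this[OF s_def] show ?thesis using s1 by (intro mult_mono) auto
  qed
  hence 2: "(1 + (real_of_int c)\<^sup>2) * (1 + (real_of_int d)\<^sup>2) \<le> 4 * s\<^sup>2" by (simp add: power2_eq_square)
  have pos: "sqrt \<delta> ^ K > 0" "s\<^sup>2 > 0" using \<delta> s1 by auto
  have p: "(1 + (real_of_int c)\<^sup>2) * (1 + (real_of_int d)\<^sup>2) > 0" by (simp add: add_pos_nonneg)
  have "1 / norm w ^ K \<le> 1 / (sqrt \<delta> ^ K * s\<^sup>2)"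
    using 1 pos by (intro divide_left_mono) (auto intro!: mult_pos_pos order.strict_trans2[OF _ 1])
  also have "\<dots> = (4 / sqrt \<delta> ^ K) * (1 / (4 * s\<^sup>2))" by simp
  also have "\<dots> \<le> (4 / sqrt \<delta> ^ K) * (1 / ((1 + (real_of_int c)\<^sup>2) * (1 + (real_of_int d)\<^sup>2)))"
    using 2 pos p by (intro mult_left_mono divide_left_mono) auto
  finally show ?thesis by simp
qed

lemma lattice_summable:
  assumes K: "K \<ge> 4" and z: "Im z > 0"
  shows "(\<lambda>(c, d). 1 / norm (of_int c * z + of_int d) ^ K) summable_on (UNIV - {(0, 0)})"
proof -
  obtain \<delta> where \<delta>: "0 < \<delta>" "\<delta> \<le> 1" "\<And>c d :: real. \<delta> * (c\<^sup>2 + d\<^sup>2) \<le> (norm (of_real c * z + of_real d))\<^sup>2"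
    using norm_lattice_lower_bound[OF z] by blast
  let ?u = "\<lambda>c::int. (4 / sqrt \<delta> ^ K) * (1 / (1 + (real_of_int c)\<^sup>2))"
  let ?v = "\<lambda>d::int. 1 / (1 + (real_of_int d)\<^sup>2)"
  let ?f = "\<lambda>c d :: int. if (c, d) = (0, 0) then 0 else 1 / norm (of_int c * z + of_int d) ^ K"
  have "(\<lambda>p. norm (case p of (c, d) \<Rightarrow> ?f c d)) summable_on UNIV \<times> UNIV"
  proof (rule summable_on_times_dominated[where u = ?u and v = ?v])
    show "?u summable_on UNIV" by (intro summable_on_cmult_right summable_on_inverse_square_int)
    show "?v summable_on UNIV" by (rule summable_on_inverse_square_int)
    fix c d :: int
    show "norm (?f c d) \<le> ?u c * ?v d"
    proof (cases "(c, d) = (0, 0)")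
      case False
      have "\<delta> * ((real_of_int c)\<^sup>2 + (real_of_int d)\<^sup>2) \<le> (norm (of_int c * z + of_int d))\<^sup>2"
        using \<delta>(3)[of c d] by simp
      from inverse_norm_lattice_bound[OF \<delta>(1) this False K] False show ?thesis
        by (simp only: if_False real_norm_def abs_divide abs_one power_abs abs_norm_cancel)
    qed (use \<delta> in auto)
  qed (use \<delta> in auto)
  hence "(\<lambda>p. case p of (c, d) \<Rightarrow> ?f c d) summable_on UNIV"
    using abs_summable_summable by fastforce
  hence "(\<lambda>p. case p of (c, d) \<Rightarrow> ?f c d) summable_on (UNIV - {(0, 0)})"
    by (rule summable_on_subset) auto
  thus ?thesis by (rule summable_on_cong[THEN iffD1, rotated]) (auto split: if_splits)
qed

lemma shifted_power_summable:
  assumes K: "K \<ge> 2" and z: "Im z > 0"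
  shows "(\<lambda>m::int. 1 / norm (z + of_int m) ^ K) summable_on UNIV"
proof -
  obtain \<delta> where \<delta>: "0 < \<delta>" "\<delta> \<le> 1" "\<And>c d :: real. \<delta> * (c\<^sup>2 + d\<^sup>2) \<le> (norm (of_real c * z + of_real d))\<^sup>2"
    using norm_lattice_lower_bound[OF z] by blast
  show ?thesis
  proof (rule summable_on_comparison_test)
    show "(\<lambda>m::int. 1 / sqrt \<delta> ^ K * (1 / (1 + (real_of_int m)\<^sup>2))) summable_on UNIV"
      by (intro summable_on_cmult_right summable_on_inverse_square_int)
    fix m :: int
    define s where "s = 1 + (real_of_int m)\<^sup>2"
    have s1: "s \<ge> 1" by (simp add: s_def)
    have "sqrt (\<delta> * s) \<le> sqrt ((norm (z + of_int m))\<^sup>2)"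
      using \<delta>(3)[of 1 m] by (intro real_sqrt_le_mono) (simp add: s_def)
    hence w: "sqrt \<delta> * sqrt s \<le> norm (z + of_int m)" by (simp add: real_sqrt_mult)
    have "sqrt \<delta> ^ K * s = sqrt \<delta> ^ K * sqrt s ^ 2" using s1 by simp
    also have "\<dots> \<le> sqrt \<delta> ^ K * sqrt s ^ K"
      using s1 K \<delta> by (intro mult_left_mono power_increasing) auto
    also have "\<dots> \<le> norm (z + of_int m) ^ K" unfolding power_mult_distrib[symmetric]
      using w s1 \<delta> by (intro power_mono) auto
    finally have 1: "sqrt \<delta> ^ K * s \<le> norm (z + of_int m) ^ K" .
    have "sqrt \<delta> ^ K * s > 0" using s1 \<delta> by auto
    hence "1 / norm (z + of_int m) ^ K \<le> 1 / (sqrt \<delta> ^ K * s)"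
      using 1 by (intro divide_left_mono) (auto intro!: mult_pos_pos order.strict_trans2[OF _ 1])
    thus "1 / norm (z + of_int m) ^ K \<le> 1 / sqrt \<delta> ^ K * (1 / (1 + (real_of_int m)\<^sup>2))"
      by (simp add: s_def)
  qed auto
qed

section \<open>Lipschitz's formula\<close>

lemma power_times_geometric_summable:
  fixes q :: complex
  assumes "norm q < 1"
  shows "summable (\<lambda>n. of_nat n ^ s * q ^ n)"
  using assms
proof (induction s arbitrary: q)
  case 0
  thus ?case by simp
next
  case (Suc s)
  have "summable (\<lambda>n. diffs (\<lambda>n. of_nat n ^ s) n * q ^ n)"
    by (rule termdiff_converges[where K = 1]) (use Suc in auto)
  hence "summable (\<lambda>n. q * (diffs (\<lambda>n. of_nat n ^ s) n * q ^ n))" by (rule summable_mult)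
  hence "summable (\<lambda>n. of_nat (Suc n) ^ Suc s * q ^ Suc n)"
    by (simp add: diffs_def mult_ac)
  thus ?case by (subst (asm) summable_Suc_iff)
qed

lemma power_times_geometric_summable_real:
  fixes r :: real
  assumes "0 \<le> r" "r < 1"
  shows "summable (\<lambda>n. real n ^ s * r ^ n)"
proof -
  have "summable (\<lambda>n. of_nat n ^ s * complex_of_real r ^ n)"
    by (rule power_times_geometric_summable) (use assms in auto)
  hence "summable (\<lambda>n. complex_of_real (real n ^ s * r ^ n))" by simp
  thus ?thesis by (simp only: summable_of_real_iff)
qed

text \<open>
  The series \<open>\<Sum>n. n^s q^n\<close> with \<open>q = e(z)\<close> in Lipschitz's formula. Differentiating in \<open>z\<close> raises
  \<open>s\<close> by one, which drives the induction in \<open>Polygamma_reflection_upper\<close>.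
\<close>
definition power_geo :: "nat \<Rightarrow> complex \<Rightarrow> complex" where
  "power_geo s z = (\<Sum>n. of_nat n ^ s * qexp z ^ n)"

lemma power_geo_deriv:
  assumes z: "Im z > 0"
  shows "(power_geo s has_field_derivative (2 * of_real pi * \<i> * power_geo (Suc s) z)) (at z)"
proof -
  let ?c = "\<lambda>n. of_nat n ^ s :: complex"
  have q: "norm (qexp z) < 1" using z by (rule norm_qexp_less_1)
  have 1: "((\<lambda>q. \<Sum>n. ?c n * q ^ n) has_field_derivative (\<Sum>n. diffs ?c n * qexp z ^ n)) (at (qexp z))"
    by (rule termdiffs_strong'[where K = 1]) (use power_times_geometric_summable q in auto)
  have 2: "(qexp has_field_derivative (2 * of_real pi * \<i> * qexp z)) (at z)"
    unfolding qexp_def[abs_def] by (auto intro!: derivative_eq_intros)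
  have "(\<lambda>n. of_nat n ^ Suc s * qexp z ^ n) sums power_geo (Suc s) z"
    unfolding power_geo_def by (intro summable_sums power_times_geometric_summable q)
  hence "(\<lambda>n. of_nat (Suc n) ^ Suc s * qexp z ^ Suc n) sums power_geo (Suc s) z"
    by (subst sums_Suc_iff) simp
  moreover have sd: "summable (\<lambda>n. diffs ?c n * qexp z ^ n)"
    by (rule termdiff_converges[where K = 1]) (use power_times_geometric_summable q in auto)
  have "(\<lambda>n. qexp z * (diffs ?c n * qexp z ^ n)) sums (qexp z * (\<Sum>n. diffs ?c n * qexp z ^ n))"
    by (intro sums_mult summable_sums sd)
  hence "(\<lambda>n. of_nat (Suc n) ^ Suc s * qexp z ^ Suc n) sums (qexp z * (\<Sum>n. diffs ?c n * qexp z ^ n))"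
    by (simp add: diffs_def mult_ac)
  ultimately have 3: "qexp z * (\<Sum>n. diffs ?c n * qexp z ^ n) = power_geo (Suc s) z"
    using sums_unique2 by blast
  show ?thesis unfolding power_geo_def[of s, abs_def]
    by (rule DERIV_cong[OF DERIV_chain2[OF 1 2]]) (simp add: 3[symmetric] mult_ac)
qed

lemma upper_half_not_nonpos_Ints:
  assumes "Im z > 0" shows "z \<notin> \<int>\<^sub>\<le>\<^sub>0" "1 - z \<notin> \<int>\<^sub>\<le>\<^sub>0"
  using assms by (auto elim!: nonpos_Ints_cases simp: complex_eq_iff)

text \<open>
  Taking logarithmic derivatives in Euler's reflection formula \<open>\<Gamma>(z) \<Gamma>(1-z) = \<pi> / sin(\<pi> z)\<close> gives
  the value \<open>\<pi> cot(\<pi> z)\<close>, which in the upper half-plane is a geometric series in \<open>e(z)\<close>.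
\<close>
lemma Digamma_reflection_upper:
  assumes z: "Im z > 0"
  shows "Digamma (1 - z) - Digamma z = of_real pi * \<i> - 2 * of_real pi * \<i> * power_geo 0 z"
proof -
  define s where "s = sin (of_real pi * z)"
  define c where "c = cos (of_real pi * z)"
  define E where "E = exp (\<i> * (of_real pi * z))"
  have E0: "E \<noteq> 0" by (simp add: E_def)
  have EE: "E * E = qexp z" unfolding E_def qexp_def exp_add[symmetric] by (simp add: algebra_simps)
  have q: "norm (qexp z) < 1" using z by (rule norm_qexp_less_1)
  hence q1: "qexp z \<noteq> 1" by auto
  have inv: "exp (- (\<i> * (of_real pi * z))) = inverse E" by (simp add: E_def exp_minus)
  have s: "s = (E - inverse E) / (2 * \<i>)" unfolding s_def sin_exp_eq inv E_def[symmetric] ..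
  have c: "c = (E + inverse E) / 2" unfolding c_def cos_exp_eq inv E_def[symmetric] ..
  have s0: "s \<noteq> 0"
  proof
    assume "s = 0"
    hence "E * E = 1" unfolding s using E0 by (simp add: field_simps)
    thus False using q1 EE by simp
  qed
  note nz = upper_half_not_nonpos_Ints[OF z]
  have "((\<lambda>z. Gamma z * Gamma (1 - z)) has_field_derivative
      Gamma z * Digamma z * Gamma (1 - z) + (Gamma (1 - z) * Digamma (1 - z) * (-1)) * Gamma z) (at z)"
    by (intro DERIV_mult has_field_derivative_Gamma nz DERIV_chain2[where f = Gamma])
       (auto intro!: derivative_eq_intros nz)
  hence D1: "((\<lambda>z. Gamma z * Gamma (1 - z)) has_field_derivative
      (Gamma z * Gamma (1 - z)) * (Digamma z - Digamma (1 - z))) (at z)"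
    by (simp add: algebra_simps)
  have "((\<lambda>z. of_real pi / sin (of_real pi * z)) has_field_derivative
      - (of_real pi * (of_real pi * c) / s\<^sup>2)) (at z)"
    using s0 unfolding s_def c_def by (auto intro!: derivative_eq_intros simp: power2_eq_square)
  hence "((\<lambda>z. Gamma z * Gamma (1 - z)) has_field_derivative
      - (of_real pi * (of_real pi * c) / s\<^sup>2)) (at z)"
    by (simp add: Gamma_reflection_complex)
  from DERIV_unique[OF D1 this] have "of_real pi / s * (Digamma z - Digamma (1 - z)) = - (of_real pi * (of_real pi * c) / s\<^sup>2)"
    by (simp add: Gamma_reflection_complex s_def)
  also have "- (of_real pi * (of_real pi * c) / s\<^sup>2) = of_real pi / s * (- (of_real pi * c / s))"
    by (simp add: power2_eq_square)
  finally have "Digamma z - Digamma (1 - z) = - (of_real pi * c / s)"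
    by (subst (asm) mult_left_cancel) (use s0 in auto)
  hence "Digamma (1 - z) - Digamma z = of_real pi * c / s" by (metis minus_diff_eq minus_minus)
  also have "\<dots> = of_real pi * \<i> * (E + inverse E) / (E - inverse E)"
  proof -
    have "E - inverse E \<noteq> 0" using s0 unfolding s by auto
    thus ?thesis unfolding s c by (simp add: divide_simps)
  qed
  also have "\<dots> = of_real pi * \<i> * (qexp z + 1) / (qexp z - 1)"
  proof -
    have "(E + inverse E) * E = qexp z + 1" "(E - inverse E) * E = qexp z - 1"
      using E0 EE by (auto simp: algebra_simps)
    moreover have "of_real pi * \<i> * (E + inverse E) / (E - inverse E) =
        of_real pi * \<i> * ((E + inverse E) * E) / ((E - inverse E) * E)" using E0 by simp
    ultimately show ?thesis by simp
  qed
  also have "\<dots> = of_real pi * \<i> - 2 * of_real pi * \<i> * (1 / (1 - qexp z))"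
    using q1 by (simp add: divide_simps) (simp add: algebra_simps)
  also have "1 / (1 - qexp z) = power_geo 0 z"
    using suminf_geometric[OF q] by (simp add: power_geo_def)
  finally show ?thesis .
qed

text \<open>
  Differentiate the reflection formula of the digamma function \<open>n\<close> times; only for \<open>n = 0\<close> is a
  constant left.
\<close>
lemma Polygamma_reflection_upper:
  assumes z: "Im z > 0"
  shows "(-1) ^ Suc n * Polygamma n z + Polygamma n (1 - z) =
    (- 2 * of_real pi * \<i>) ^ Suc n * power_geo n z + (if n = 0 then of_real pi * \<i> else 0)"
  using z
proof (induction n arbitrary: z)
  case 0
  show ?case using Digamma_reflection_upper[OF 0] by simp
next
  case (Suc n)
  define R where "R z = (-1) ^ Suc n * Polygamma n z + Polygamma n (1 - z)" for z :: complex
  define S where "S z = (- 2 * of_real pi * \<i>) ^ Suc n * power_geo n z + (if n = 0 then of_real pi * \<i> else 0)" for z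
  note nz = upper_half_not_nonpos_Ints[OF Suc.prems]
  have "(R has_field_derivative (-1) ^ Suc n * Polygamma (Suc n) z + Polygamma (Suc n) (1 - z) * (-1)) (at z)"
    unfolding R_def[abs_def]
    by (intro DERIV_add DERIV_cmult has_field_derivative_Polygamma nz DERIV_chain2[where f = "Polygamma n"])
       (auto intro!: derivative_eq_intros)
  hence "(S has_field_derivative (-1) ^ Suc n * Polygamma (Suc n) z + Polygamma (Suc n) (1 - z) * (-1)) (at z)"
    by (rule has_field_derivative_transform_within_open[where S = "{z. Im z > 0}"])
       (use Suc open_halfspace_Im_gt[of 0] in \<open>auto simp: R_def S_def\<close>)
  moreover have "(S has_field_derivative (- 2 * of_real pi * \<i>) ^ Suc n * (2 * of_real pi * \<i> * power_geo (Suc n) z) + 0) (at z)"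
    unfolding S_def[abs_def] by (intro DERIV_add DERIV_cmult power_geo_deriv Suc.prems DERIV_const)
  ultimately have "(-1) ^ Suc n * Polygamma (Suc n) z + Polygamma (Suc n) (1 - z) * (-1) =
      (- 2 * of_real pi * \<i>) ^ Suc n * (2 * of_real pi * \<i> * power_geo (Suc n) z) + 0"
    by (rule DERIV_unique)
  from arg_cong[OF this, of uminus] show ?case by (simp add: mult_ac add_ac)
qed

text \<open>
  The sum over \<open>m \<ge> 0\<close> is a polygamma value at \<open>z\<close>, the sum over \<open>m < 0\<close> one at \<open>1 - z\<close>, and the
  reflection formula adds them up.
\<close>
theorem lipschitz_formula:
  assumes s: "s \<ge> 2" and z: "Im z > 0"
  shows "((\<lambda>m::int. 1 / (z + of_int m) ^ s) has_sum
    ((- 2 * of_real pi * \<i>) ^ s / fact (s - 1) * power_geo (s - 1) z)) UNIV"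
proof -
  obtain n where n: "s = Suc n" "n \<ge> 1" using s by (cases s) auto
  have nz0: "z \<noteq> 0" "1 - z \<noteq> 0" using z by (auto simp: complex_eq_iff)
  have abs: "(\<lambda>m::int. 1 / norm (z + of_int m) ^ s) summable_on UNIV" by (rule shifted_power_summable[OF s z])
  have a1: "summable (\<lambda>k. norm (1 / (z + of_nat k) ^ s))"
  proof -
    have "(\<lambda>m::int. 1 / norm (z + of_int m) ^ s) summable_on range int" using abs by (rule summable_on_subset) auto
    hence "(\<lambda>k. 1 / norm (z + of_nat k) ^ s) summable_on UNIV"
      by (subst (asm) summable_on_reindex) (auto simp: o_def)
    thus ?thesis using summable_on_imp_summable by (force simp: norm_divide norm_power)
  qed
  have a2: "summable (\<lambda>k. norm (1 / (z - 1 - of_nat k) ^ s))"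
  proof -
    have "(\<lambda>m::int. 1 / norm (z + of_int m) ^ s) summable_on range (\<lambda>k. - 1 - int k)" using abs by (rule summable_on_subset) auto
    hence "(\<lambda>k. 1 / norm (z - 1 - of_nat k) ^ s) summable_on UNIV"
      by (subst (asm) summable_on_reindex[OF bij_betw_int_halves(2)]) (simp add: o_def algebra_simps)
    thus ?thesis using summable_on_imp_summable by (force simp: norm_divide norm_power)
  qed
  have s1: "(\<lambda>k. 1 / (z + of_nat k) ^ s) sums ((-1) ^ s * Polygamma n z / fact n)"
    using Polygamma_LIMSEQ[OF nz0(1), of n] n by (simp add: inverse_eq_divide)
  have "(\<lambda>k. 1 / (1 - z + of_nat k) ^ s) sums ((-1) ^ s * Polygamma n (1 - z) / fact n)"
    using Polygamma_LIMSEQ[OF nz0(2), of n] n by (simp add: inverse_eq_divide)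
  from sums_mult[OF this, of "(-1) ^ s"]
  have "(\<lambda>k. (-1) ^ s * (1 / (1 - z + of_nat k) ^ s)) sums (((-1) ^ s * (-1) ^ s) * Polygamma n (1 - z) / fact n)"
    by (simp add: mult.assoc)
  also have "(\<lambda>k. (-1) ^ s * (1 / (1 - z + of_nat k) ^ s)) = (\<lambda>k. 1 / (z - 1 - of_nat k) ^ s)"
  proof
    fix k :: nat
    have "(z - 1 - of_nat k) ^ s = (-1) ^ s * (1 - z + of_nat k) ^ s"
      by (simp add: power_mult_distrib[symmetric] algebra_simps)
    thus "(-1) ^ s * (1 / (1 - z + of_nat k) ^ s) = 1 / (z - 1 - of_nat k) ^ s"
      by (cases "even s") auto
  qed
  also have "(-1) ^ s * (-1) ^ s = (1::complex)" by (simp add: power_mult_distrib[symmetric])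
  finally have s2: "(\<lambda>k. 1 / (z - 1 - of_nat k) ^ s) sums (Polygamma n (1 - z) / fact n)" by simp
  have "((\<lambda>m::int. 1 / (z + of_int m) ^ s) has_sum
      ((-1) ^ s * Polygamma n z / fact n + Polygamma n (1 - z) / fact n)) UNIV"
  proof (rule has_sum_int_halves)
    show "((\<lambda>k. 1 / (z + of_int (int k)) ^ s) has_sum (-1) ^ s * Polygamma n z / fact n) UNIV"
      using norm_summable_imp_has_sum[OF a1 s1] by simp
    have eq: "z + of_int (- 1 - int k) = z - 1 - of_nat k" for k by simp
    show "((\<lambda>k. 1 / (z + of_int (- 1 - int k)) ^ s) has_sum Polygamma n (1 - z) / fact n) UNIV"
      unfolding eq by (rule norm_summable_imp_has_sum[OF a2 s2])
  qed
  also have "(-1) ^ s * Polygamma n z / fact n + Polygamma n (1 - z) / fact n =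
      (- 2 * of_real pi * \<i>) ^ s / fact (s - 1) * power_geo (s - 1) z"
  proof -
    have "(-1) ^ s * Polygamma n z / fact n + Polygamma n (1 - z) / fact n =
        ((-1) ^ Suc n * Polygamma n z + Polygamma n (1 - z)) / fact n"
      by (simp only: add_divide_distrib n)
    also have "\<dots> = ((- 2 * of_real pi * \<i>) ^ Suc n * power_geo n z) / fact n"
      unfolding Polygamma_reflection_upper[OF z] using n by simp
    finally show ?thesis using n by simp
  qed
  finally show ?thesis .
qed

section \<open>Residue classes of the Poincare series\<close>

lemma power_le_fact_exp:
  fixes x :: real assumes "x \<ge> 0" shows "x ^ j \<le> fact j * exp x"
proof -
  have s: "(\<lambda>n. x ^ n /\<^sub>R fact n) sums exp x" by (rule exp_converges)
  have "(\<Sum>n\<in>{j}. x ^ n /\<^sub>R fact n) \<le> (\<Sum>n. x ^ n /\<^sub>R fact n)"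
    using assms by (intro sum_le_suminf sums_summable[OF s]) auto
  thus ?thesis using sums_unique[OF s] by (simp add: field_simps)
qed

text \<open>
  The argument of the Bessel-Clifford function grows linearly in \<open>n\<close>, so its value is of size
  \<open>exp(O(\<surd>n))\<close>. The weaker bound \<open>exp(\<epsilon> n)\<close> with a summable factor in \<open>j\<close> suffices against the
  geometric decay of \<open>e(w)^n\<close>, and it holds term by term, as needed to exchange the sums over \<open>j\<close>
  and \<open>n\<close>.
\<close>
lemma bessel_term_bound:
  assumes a: "0 \<le> \<alpha>" "\<alpha> \<le> 1" and e: "\<epsilon> > 0"
  shows "norm ((-1) ^ j / (fact j * fact (j + m)) * (4 * pi\<^sup>2 * \<alpha> * real n) ^ j)
     \<le> (4 * pi\<^sup>2 / \<epsilon>) ^ j / fact j * exp (\<epsilon> * real n)"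
proof -
  have "(4 * pi\<^sup>2 * \<alpha> * real n) ^ j \<le> (4 * pi\<^sup>2 * 1 * real n) ^ j"
    using a by (intro power_mono mult_right_mono mult_left_mono) auto
  also have "\<dots> = (4 * pi\<^sup>2 / \<epsilon>) ^ j * (\<epsilon> * real n) ^ j"
  proof -
    have "4 * pi\<^sup>2 * 1 * real n = (4 * pi\<^sup>2 / \<epsilon>) * (\<epsilon> * real n)" using e by simp
    thus ?thesis by (simp only: power_mult_distrib)
  qed
  also have "\<dots> \<le> (4 * pi\<^sup>2 / \<epsilon>) ^ j * (fact j * exp (\<epsilon> * real n))"
    using e by (intro mult_left_mono power_le_fact_exp) auto
  finally have 1: "(4 * pi\<^sup>2 * \<alpha> * real n) ^ j \<le> (4 * pi\<^sup>2 / \<epsilon>) ^ j * (fact j * exp (\<epsilon> * real n))" .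
  have f: "fact j \<le> (fact (j + m) :: real)" by (rule fact_mono) simp
  have "norm ((-1) ^ j / (fact j * fact (j + m)) * (4 * pi\<^sup>2 * \<alpha> * real n) ^ j) =
      (4 * pi\<^sup>2 * \<alpha> * real n) ^ j / (fact j * fact (j + m))"
    using a by (simp add: abs_mult power_abs)
  also have "\<dots> \<le> (4 * pi\<^sup>2 / \<epsilon>) ^ j * (fact j * exp (\<epsilon> * real n)) / (fact j * fact j)"
    using 1 f a e by (intro frac_le mult_left_mono mult_nonneg_nonneg) auto
  also have "\<dots> = (4 * pi\<^sup>2 / \<epsilon>) ^ j / fact j * exp (\<epsilon> * real n)" by simp
  finally show ?thesis .
qed

lemma bessel_clifford_bound:
  assumes a: "0 \<le> \<alpha>" "\<alpha> \<le> 1" and e: "\<epsilon> > 0"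
  shows "\<bar>bessel_clifford m (4 * pi\<^sup>2 * \<alpha> * real n)\<bar> \<le> exp (4 * pi\<^sup>2 / \<epsilon>) * exp (\<epsilon> * real n)"
proof -
  have s: "(\<lambda>j. (4 * pi\<^sup>2 / \<epsilon>) ^ j /\<^sub>R fact j) sums exp (4 * pi\<^sup>2 / \<epsilon>)" by (rule exp_converges)
  hence s': "(\<lambda>j. (4 * pi\<^sup>2 / \<epsilon>) ^ j / fact j * exp (\<epsilon> * real n)) sums (exp (4 * pi\<^sup>2 / \<epsilon>) * exp (\<epsilon> * real n))"
    by (intro sums_mult2) (simp add: field_simps)
  have "norm (bessel_clifford m (4 * pi\<^sup>2 * \<alpha> * real n)) \<le> (\<Sum>j. (4 * pi\<^sup>2 / \<epsilon>) ^ j / fact j * exp (\<epsilon> * real n))"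
    unfolding bessel_clifford_def by (rule norm_suminf_le[OF bessel_term_bound[OF assms] sums_summable[OF s']])
  thus ?thesis unfolding sums_unique[OF s', symmetric] by simp
qed

text \<open>
  The \<open>n\<close>-th Fourier coefficient of \<open>\<Sum>m. e(-\<alpha>/(w+m)) / (w+m)^K\<close>. For \<open>\<alpha> = 1/c^2\<close> it is a multiple
  of \<open>J(K-1)(4\<pi> \<surd>n / c)\<close>; see \<open>bessel_coeff_eq_bessel_J\<close>.
\<close>
definition bessel_coeff :: "nat \<Rightarrow> real \<Rightarrow> nat \<Rightarrow> complex" where
  "bessel_coeff K \<alpha> n = (- 2 * of_real pi * \<i>) ^ K * of_nat n ^ (K - 1) *
     of_real (bessel_clifford (K - 1) (4 * pi\<^sup>2 * \<alpha> * real n))"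

lemma exists_growth_margin:
  assumes "r < 1" "0 \<le> r"
  obtains \<epsilon> :: real where "\<epsilon> > 0" "exp \<epsilon> * r < 1"
proof (cases "r = 0")
  case False
  define \<epsilon> where "\<epsilon> = - ln r / 2"
  have "\<epsilon> > 0" using assms False by (simp add: \<epsilon>_def)
  moreover have "exp \<epsilon> * r = exp (\<epsilon> + ln r)" using assms False by (simp add: exp_add)
  moreover have "\<epsilon> + ln r < 0" using assms False by (simp add: \<epsilon>_def)
  ultimately show ?thesis by (intro that) auto
qed (use that[of 1] in auto)

lemma norm_bessel_coeff_le:
  assumes a: "0 \<le> \<alpha>" "\<alpha> \<le> 1" and e: "\<epsilon> > 0" and K: "K \<ge> 2"
  shows "norm (bessel_coeff K \<alpha> n * q ^ n) \<le>
    (2 * pi) ^ K * exp (4 * pi\<^sup>2 / \<epsilon>) * (real n ^ (K - 1) * (exp \<epsilon> * norm q) ^ n)"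
proof -
  have "norm (bessel_coeff K \<alpha> n * q ^ n) =
    (2 * pi) ^ K * real n ^ (K - 1) * norm q ^ n * \<bar>bessel_clifford (K - 1) (4 * pi\<^sup>2 * \<alpha> * real n)\<bar>"
    by (simp add: bessel_coeff_def norm_mult norm_power)
  also have "\<dots> \<le> (2 * pi) ^ K * real n ^ (K - 1) * norm q ^ n * (exp (4 * pi\<^sup>2 / \<epsilon>) * exp (\<epsilon> * real n))"
    by (intro mult_left_mono bessel_clifford_bound a e) auto
  also have "exp (\<epsilon> * real n) = exp \<epsilon> ^ n" by (simp add: exp_of_nat_mult[symmetric] mult.commute)
  finally show ?thesis by (simp add: power_mult_distrib mult_ac)
qed

text \<open>
  Expand \<open>e(-\<alpha>/(w+m))\<close> in its exponential series, apply Lipschitz's formula to the sum over \<open>m\<close>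
  for each power \<open>j\<close>, and collect the powers \<open>j\<close> for each frequency \<open>n\<close>: they form a
  Bessel-Clifford series.
\<close>
lemma poincare_inner_sum:
  assumes w: "Im w > 0" and K: "K \<ge> 2" and a: "0 \<le> \<alpha>" "\<alpha> \<le> 1"
  shows "(\<Sum>\<^sub>\<infinity>m::int. qexp (- of_real \<alpha> / (w + of_int m)) / (w + of_int m) ^ K) =
    (\<Sum>\<^sub>\<infinity>n::nat. bessel_coeff K \<alpha> n * qexp w ^ n)"
proof -
  define \<tau> where "\<tau> = - 2 * of_real pi * \<i>"
  define q where "q = qexp w"
  have q: "norm q < 1" using w norm_qexp_less_1 by (simp add: q_def)
  obtain \<epsilon> where e: "\<epsilon> > 0" "exp \<epsilon> * norm q < 1" using exists_growth_margin[OF q] by auto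
  define f where "f m j = (\<tau> * of_real \<alpha>) ^ j / fact j / (w + of_int m) ^ (K + j)" for m :: int and j :: nat
  define g where "g j n = \<tau> ^ K * of_nat n ^ (K - 1) * q ^ n *
      of_real ((-1) ^ j / (fact j * fact (j + (K - 1))) * (4 * pi\<^sup>2 * \<alpha> * real n) ^ j)" for j n :: nat
  \<comment> \<open>The sum over j of X^j / j! dominates the exponential series uniformly in m.\<close>
  define X where "X = 2 * pi * \<alpha> / Im w"
  have X0: "X \<ge> 0" using w a by (simp add: X_def)
  have wm: "norm (w + of_int m) \<ge> Im w" "w + of_int m \<noteq> 0" for m
    using abs_Im_le_cmod[of "w + of_int m"] w by auto
  have expsum: "(\<lambda>j. x ^ j / fact j) sums exp x" for x :: "'a :: {real_normed_field, banach}"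
    using exp_converges[of x] by (simp add: scaleR_conv_of_real divide_inverse mult.commute)
  have sumX: "(\<lambda>j. X ^ j / fact j) summable_on UNIV"
    by (intro norm_summable_imp_summable_on) (use X0 expsum[of X] in \<open>auto simp: sums_iff\<close>)
  have fle: "norm (f m j) \<le> 1 / norm (w + of_int m) ^ K * (X ^ j / fact j)" for m j
  proof -
    have "norm (f m j) = (2 * pi * \<alpha>) ^ j / fact j / norm (w + of_int m) ^ (K + j)"
      using a by (simp add: f_def norm_divide norm_mult norm_power \<tau>_def)
    also have "\<dots> = 1 / norm (w + of_int m) ^ K * ((2 * pi * \<alpha> / norm (w + of_int m)) ^ j / fact j)"
      by (simp add: power_add power_divide)
    also have "\<dots> \<le> 1 / norm (w + of_int m) ^ K * (X ^ j / fact j)"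
      unfolding X_def using wm(1)[of m] w a
      by (intro mult_left_mono divide_right_mono power_mono divide_left_mono mult_pos_pos) auto
    finally show ?thesis .
  qed
  have 1: "(\<Sum>\<^sub>\<infinity>j. f m j) = qexp (- of_real \<alpha> / (w + of_int m)) / (w + of_int m) ^ K" for m
  proof -
    define x where "x = \<tau> * of_real \<alpha> / (w + of_int m)"
    have fx: "f m j = x ^ j / fact j * (1 / (w + of_int m) ^ K)" for j
      by (simp add: f_def x_def power_divide power_add)
    have "(\<lambda>j. f m j) sums (exp x * (1 / (w + of_int m) ^ K))"
      unfolding fx by (intro sums_mult2 expsum)
    moreover have "summable (\<lambda>j. norm (f m j))"
    proof (rule summable_comparison_test')
      show "summable (\<lambda>j. 1 / norm (w + of_int m) ^ K * (X ^ j / fact j))"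
        using expsum[of X] by (intro summable_mult) (simp add: sums_iff)
      show "norm (norm (f m j)) \<le> 1 / norm (w + of_int m) ^ K * (X ^ j / fact j)" for j
        using fle by simp
    qed
    ultimately have "(f m has_sum (exp x * (1 / (w + of_int m) ^ K))) UNIV"
      by (rule norm_summable_imp_has_sum[rotated])
    moreover have "exp x = qexp (- of_real \<alpha> / (w + of_int m))"
      by (simp add: qexp_def x_def \<tau>_def)
    ultimately show ?thesis by (simp add: infsumI)
  qed
  \<comment> \<open>Lipschitz's formula with exponent K + j.\<close>
  have 2: "(\<Sum>\<^sub>\<infinity>m. f m j) = (\<Sum>\<^sub>\<infinity>n. g j n)" for j
  proof -
    have "((\<lambda>m. (\<tau> * of_real \<alpha>) ^ j / fact j * (1 / (w + of_int m) ^ (K + j))) has_sum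
       ((\<tau> * of_real \<alpha>) ^ j / fact j * (\<tau> ^ (K + j) / fact (K + j - 1) * power_geo (K + j - 1) w))) UNIV"
      unfolding \<tau>_def using K w by (intro has_sum_cmult_right lipschitz_formula) auto
    hence "(\<Sum>\<^sub>\<infinity>m. f m j) = (\<tau> * of_real \<alpha>) ^ j / fact j * (\<tau> ^ (K + j) / fact (K + j - 1) * power_geo (K + j - 1) w)"
      by (simp add: infsumI f_def)
    also have "\<dots> = (\<Sum>\<^sub>\<infinity>n. g j n)"
    proof -
      have "((\<lambda>n. of_nat n ^ (K + j - 1) * q ^ n) has_sum power_geo (K + j - 1) w) UNIV"
      proof (rule norm_summable_imp_has_sum)
        show "summable (\<lambda>n. norm (of_nat n ^ (K + j - 1) * q ^ n))"
          using power_times_geometric_summable_real[of "norm q"] q by (simp add: norm_mult norm_power)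
        show "(\<lambda>n. of_nat n ^ (K + j - 1) * q ^ n) sums power_geo (K + j - 1) w"
          unfolding power_geo_def q_def[symmetric] by (intro summable_sums power_times_geometric_summable q)
      qed
      hence "((\<lambda>n. (\<tau> * of_real \<alpha>) ^ j / fact j * (\<tau> ^ (K + j) / fact (K + j - 1)) * (of_nat n ^ (K + j - 1) * q ^ n)) has_sum
          ((\<tau> * of_real \<alpha>) ^ j / fact j * (\<tau> ^ (K + j) / fact (K + j - 1)) * power_geo (K + j - 1) w)) UNIV"
        by (rule has_sum_cmult_right)
      moreover have "(\<tau> * of_real \<alpha>) ^ j / fact j * (\<tau> ^ (K + j) / fact (K + j - 1)) * (of_nat n ^ (K + j - 1) * q ^ n) = g j n" for n
      proof -
        have Kj: "K + j - 1 = j + (K - 1)" using K by simp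
        have tt: "\<tau> * \<tau> = - of_real (4 * pi\<^sup>2)" by (simp add: \<tau>_def power2_eq_square)
        have "\<tau> ^ j * \<tau> ^ j = (-1) ^ j * of_real (4 * pi\<^sup>2) ^ j"
          unfolding power_mult_distrib[symmetric] tt by simp
        hence "(\<tau> * of_real \<alpha>) ^ j * \<tau> ^ (K + j) = \<tau> ^ K * ((-1) ^ j * of_real (4 * pi\<^sup>2) ^ j) * of_real \<alpha> ^ j"
          by (simp add: power_mult_distrib power_add mult_ac)
        hence "(\<tau> * of_real \<alpha>) ^ j / fact j * (\<tau> ^ (K + j) / fact (K + j - 1)) =
            \<tau> ^ K * ((-1) ^ j * of_real (4 * pi\<^sup>2) ^ j) * of_real \<alpha> ^ j / (fact j * fact (j + (K - 1)))"
          unfolding Kj by simp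
        thus ?thesis unfolding Kj g_def by (simp add: power_add power_mult_distrib mult_ac) blast
      qed
      ultimately show ?thesis by (simp add: infsumI mult.assoc)
    qed
    finally show ?thesis .
  qed
  have 3: "(\<Sum>\<^sub>\<infinity>j. g j n) = bessel_coeff K \<alpha> n * q ^ n" for n
  proof -
    let ?t = "\<lambda>j. (-1) ^ j / (fact j * fact (j + (K - 1))) * (4 * pi\<^sup>2 * \<alpha> * real n) ^ j"
    have "(?t has_sum bessel_clifford (K - 1) (4 * pi\<^sup>2 * \<alpha> * real n)) UNIV"
      unfolding bessel_clifford_def
      by (intro norm_summable_imp_has_sum bessel_clifford_summable_abs summable_sums bessel_clifford_summable)
    hence "((\<lambda>j. of_real (?t j)) has_sum complex_of_real (bessel_clifford (K - 1) (4 * pi\<^sup>2 * \<alpha> * real n))) UNIV"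
      by (rule has_sum_of_real)
    from has_sum_cmult_right[OF this, of "\<tau> ^ K * of_nat n ^ (K - 1) * q ^ n"] show ?thesis
      unfolding g_def by (subst infsumI) (auto simp: bessel_coeff_def \<tau>_def mult_ac)
  qed
  have "(\<Sum>\<^sub>\<infinity>m::int. qexp (- of_real \<alpha> / (w + of_int m)) / (w + of_int m) ^ K) = (\<Sum>\<^sub>\<infinity>m::int. \<Sum>\<^sub>\<infinity>j. f m j)"
    by (simp add: 1)
  also have "\<dots> = (\<Sum>\<^sub>\<infinity>j. \<Sum>\<^sub>\<infinity>m::int. f m j)"
    by (rule infsum_swap_dominated[OF shifted_power_summable[OF K w] sumX fle]) (use X0 in auto)
  also have "\<dots> = (\<Sum>\<^sub>\<infinity>j. \<Sum>\<^sub>\<infinity>n. g j n)" by (simp add: 2)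
  also have "\<dots> = (\<Sum>\<^sub>\<infinity>n. \<Sum>\<^sub>\<infinity>j. g j n)"
  proof (rule infsum_swap_dominated[where u = "\<lambda>j. (4 * pi\<^sup>2 / \<epsilon>) ^ j / fact j"
        and v = "\<lambda>n. (2 * pi) ^ K * (real n ^ (K - 1) * (exp \<epsilon> * norm q) ^ n)"])
    show "(\<lambda>j. (4 * pi\<^sup>2 / \<epsilon>) ^ j / fact j) summable_on UNIV"
      by (intro norm_summable_imp_summable_on) (use e expsum[of "4 * pi\<^sup>2 / \<epsilon>"] in \<open>auto simp: sums_iff\<close>)
    have "summable (\<lambda>n. (2 * pi) ^ K * (real n ^ (K - 1) * (exp \<epsilon> * norm q) ^ n))"
      by (intro summable_mult power_times_geometric_summable_real) (use e in auto)
    thus "(\<lambda>n. (2 * pi) ^ K * (real n ^ (K - 1) * (exp \<epsilon> * norm q) ^ n)) summable_on UNIV"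
      by (intro norm_summable_imp_summable_on) (simp add: abs_mult power_abs)
    fix j n
    have "norm (g j n) = (2 * pi) ^ K * real n ^ (K - 1) * norm q ^ n *
        norm ((-1) ^ j / (fact j * fact (j + (K - 1))) * (4 * pi\<^sup>2 * \<alpha> * real n) ^ j)"
    proof -
      have "norm (\<tau> ^ K * of_nat n ^ (K - 1) * q ^ n * complex_of_real t) =
          (2 * pi) ^ K * real n ^ (K - 1) * norm q ^ n * norm t" for t
        by (simp add: \<tau>_def norm_mult norm_power)
      thus ?thesis unfolding g_def .
    qed
    also have "\<dots> \<le> (2 * pi) ^ K * real n ^ (K - 1) * norm q ^ n * ((4 * pi\<^sup>2 / \<epsilon>) ^ j / fact j * exp (\<epsilon> * real n))"
      by (intro mult_left_mono bessel_term_bound a e) auto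
    also have "exp (\<epsilon> * real n) = exp \<epsilon> ^ n" by (simp add: exp_of_nat_mult[symmetric] mult.commute)
    finally show "norm (g j n) \<le> (4 * pi\<^sup>2 / \<epsilon>) ^ j / fact j * ((2 * pi) ^ K * (real n ^ (K - 1) * (exp \<epsilon> * norm q) ^ n))"
      by (simp add: power_mult_distrib mult_ac)
  qed (use e in auto)
  also have "\<dots> = (\<Sum>\<^sub>\<infinity>n::nat. bessel_coeff K \<alpha> n * qexp w ^ n)"
    by (simp add: 3 q_def)
  finally show ?thesis .
qed

section \<open>The Poincare series\<close>

definition coprime_pairs :: "(int \<times> int) set" where
  "coprime_pairs = {(c, d). coprime c d}"

text \<open>
  A choice of first row \<open>(a, b)\<close> that completes the second row \<open>(c, d)\<close> to a matrix of determinant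
  \<open>1\<close>.
\<close>
definition bezout_pair :: "int \<Rightarrow> int \<Rightarrow> int \<times> int" where
  "bezout_pair c d = (SOME p. fst p * d - snd p * c = 1)"

lemma bezout_pair_det:
  assumes "coprime c d"
  shows "fst (bezout_pair c d) * d - snd (bezout_pair c d) * c = 1"
proof -
  obtain u v where "u * c + v * d = gcd c d" using bezout_int by blast
  hence "fst (v, - u) * d - snd (v, - u) * c = 1" using assms by (simp add: algebra_simps)
  thus ?thesis unfolding bezout_pair_def by (rule someI)
qed

text \<open>
  Integer matrices are encoded as tuples \<open>(a, b, c, d)\<close>, read row by row.
\<close>
definition moebius_map :: "int \<times> int \<times> int \<times> int \<Rightarrow> complex \<Rightarrow> complex" where
  "moebius_map = (\<lambda>(a, b, c, d) z. (of_int a * z + of_int b) / (of_int c * z + of_int d))"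

lemma denominator_nonzero:
  assumes "Im z > 0" "(c, d) \<noteq> (0, 0)" shows "of_int c * z + of_int d \<noteq> 0"
proof
  assume 0: "of_int c * z + of_int d = 0"
  hence "Im (of_int c * z + of_int d) = 0" by simp
  hence "c = 0" using assms by simp
  with 0 assms show False by simp
qed

lemma det_1_imp: "a * d - b * c = (1::int) \<Longrightarrow> (c, d) \<noteq> (0, 0)" "a * d - b * c = (1::int) \<Longrightarrow> coprime c d"
proof -
  assume *: "a * d - b * c = (1::int)"
  show "(c, d) \<noteq> (0, 0)" using * by auto
  show "coprime c d"
  proof (rule coprimeI)
    fix e assume "e dvd c" "e dvd d"
    hence "e dvd a * d - b * c" by simp
    thus "is_unit e" using * by simp
  qed
qed

lemma Im_moebius:
  assumes "a * d - b * c = 1"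
  shows "Im ((of_int a * z + of_int b) / (of_int c * z + of_int d)) = Im z / (norm (of_int c * z + of_int d))\<^sup>2"
proof -
  have "real_of_int a * real_of_int d - real_of_int b * real_of_int c = real_of_int (a * d - b * c)" by simp
  hence det: "real_of_int a * real_of_int d = 1 + real_of_int b * real_of_int c" using assms by simp
  have "Im ((of_int a * z + of_int b) / (of_int c * z + of_int d)) =
     (real_of_int a * real_of_int d * Im z - real_of_int b * real_of_int c * Im z) / (norm (of_int c * z + of_int d))\<^sup>2"
    unfolding Im_divide cmod_power2 by (simp add: algebra_simps)
  also have "real_of_int a * real_of_int d * Im z - real_of_int b * real_of_int c * Im z = Im z"
    unfolding det by (simp add: algebra_simps)
  finally show ?thesis .
qed

lemma Im_moebius_pos:
  assumes "a * d - b * c = 1" "Im z > 0"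
  shows "Im ((of_int a * z + of_int b) / (of_int c * z + of_int d)) > 0"
  unfolding Im_moebius[OF assms(1)]
  using assms(2) denominator_nonzero[OF assms(2) det_1_imp(1)[OF assms(1)]] by (intro divide_pos_pos) auto

text \<open>
  The summand depends only on the second row of the matrix, since \<open>e\<close> is invariant under
  translation by integers; see \<open>poincare_term_eq\<close>.
\<close>
definition poincare_term :: "nat \<Rightarrow> int \<times> int \<Rightarrow> complex \<Rightarrow> complex" where
  "poincare_term K = (\<lambda>(c, d) z.
     qexp ((of_int (fst (bezout_pair c d)) * z + of_int (snd (bezout_pair c d))) / (of_int c * z + of_int d)) /
       (of_int c * z + of_int d) ^ K)"

text \<open>
  Two matrices of determinant \<open>1\<close> with the same second row differ by an integral translation from
  the left.
\<close>
lemma same_row_shift: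
  assumes "a * d - b * c = (1::int)" "a' * d - b' * c = 1"
  shows "a' = a + (a * b' - a' * b) * c" "b' = b + (a * b' - a' * b) * d"
proof -
  define t where "t = a * b' - a' * b"
  have bc: "a' * d - 1 = b' * c" "a * d - 1 = b * c" and ad: "1 + b * c = a * d" "1 + b' * c = a' * d"
    using assms by auto
  have "t * c = a * (a' * d - 1) - a' * (a * d - 1)" unfolding bc by (simp add: t_def algebra_simps)
  thus "a' = a + (a * b' - a' * b) * c" by (simp add: t_def algebra_simps)
  have "t * d = b' * (1 + b * c) - b * (1 + b' * c)" unfolding ad by (simp add: t_def algebra_simps)
  thus "b' = b + (a * b' - a' * b) * d" by (simp add: t_def algebra_simps)
qed

lemma same_row_translate:
  assumes "a * d - b * c = (1::int)" "a' * d - b' * c = 1" and z: "Im z > 0"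
  shows "(of_int a' * z + of_int b') / (of_int c * z + of_int d) =
    (of_int a * z + of_int b) / (of_int c * z + of_int d) + of_int (a * b' - a' * b)"
proof -
  define t where "t = a * b' - a' * b"
  note shift = same_row_shift[OF assms(1,2), folded t_def]
  have nz: "of_int c * z + of_int d \<noteq> 0" by (rule denominator_nonzero[OF z det_1_imp(1)[OF assms(1)]])
  have "of_int a' * z + of_int b' = (of_int a * z + of_int b) + of_int t * (of_int c * z + of_int d)"
    unfolding shift by (simp add: algebra_simps)
  thus ?thesis using nz unfolding t_def[symmetric] by (simp add: add_divide_distrib)
qed

lemma poincare_term_eq:
  assumes "a * d - b * c = 1" and z: "Im z > 0"
  shows "poincare_term K (c, d) z =
    qexp ((of_int a * z + of_int b) / (of_int c * z + of_int d)) / (of_int c * z + of_int d) ^ K"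
proof -
  have "coprime c d" using det_1_imp(2)[OF assms(1)] .
  from same_row_translate[OF assms(1) bezout_pair_det[OF this] z] show ?thesis
    unfolding poincare_term_def prod.case by (simp only: qexp_add_of_int)
qed

lemma norm_poincare_term_le:
  assumes "(c, d) \<in> coprime_pairs" and z: "Im z > 0"
  shows "norm (poincare_term K (c, d) z) \<le> 1 / norm (of_int c * z + of_int d) ^ K"
proof -
  have det: "fst (bezout_pair c d) * d - snd (bezout_pair c d) * c = 1"
    using assms bezout_pair_det by (auto simp: coprime_pairs_def)
  have "norm (qexp ((of_int (fst (bezout_pair c d)) * z + of_int (snd (bezout_pair c d))) / (of_int c * z + of_int d))) \<le> 1"
    using norm_qexp_less_1[OF Im_moebius_pos[OF det z]] by simp
  thus ?thesis unfolding poincare_term_def by (simp add: norm_divide norm_power divide_right_mono)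
qed

lemma coprime_pairs_nonzero: "coprime_pairs \<subseteq> UNIV - {(0, 0)}"
  by (auto simp: coprime_pairs_def)

lemma poincare_term_summable:
  assumes K: "K \<ge> 4" and z: "Im z > 0"
  shows "(\<lambda>p. norm (poincare_term K p z)) summable_on coprime_pairs"
proof (rule summable_on_comparison_test)
  show "(\<lambda>(c, d). 1 / norm (of_int c * z + of_int d) ^ K) summable_on coprime_pairs"
    using lattice_summable[OF K z] coprime_pairs_nonzero by (rule summable_on_subset)
  show "norm (poincare_term K p z) \<le> (case p of (c, d) \<Rightarrow> 1 / norm (of_int c * z + of_int d) ^ K)"
    if "p \<in> coprime_pairs" for p
    using norm_poincare_term_le[of "fst p" "snd p" z K] that z by (cases p) auto
qed auto

lemma poincare_term_summable':
  assumes "K \<ge> 4" "Im z > 0"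
  shows "(\<lambda>p. poincare_term K p z) summable_on coprime_pairs"
  using poincare_term_summable[OF assms] by (rule abs_summable_summable)

text \<open>
  Summing over the coprime pairs \<open>(c, d)\<close> counts each coset of the translations in \<open>PSL2(\<int>)\<close>
  twice, whence the factor \<open>1/2\<close>.
\<close>
definition poincare_series :: "nat \<Rightarrow> complex \<Rightarrow> complex" where
  "poincare_series K z = (if Im z > 0 then (\<Sum>\<^sub>\<infinity>p\<in>coprime_pairs. poincare_term K p z) / 2 else 0)"

text \<open>
  The cocycle relation of the denominators \<open>c z + d\<close>: composing with a matrix from the right moves
  the second row and splits off the factor of automorphy.
\<close>
lemma poincare_term_moebius:
  assumes ABCD: "A * D - B * C = 1" and cd: "(c, d) \<in> coprime_pairs" and z: "Im z > 0"
  shows "poincare_term K (c, d) ((of_int A * z + of_int B) / (of_int C * z + of_int D)) =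
     (of_int C * z + of_int D) ^ K * poincare_term K (c * A + d * C, c * B + d * D) z"
proof -
  define a b where "a = fst (bezout_pair c d)" and "b = snd (bezout_pair c d)"
  have det: "a * d - b * c = 1" using cd bezout_pair_det by (auto simp: coprime_pairs_def a_def b_def)
  define w where "w = (of_int A * z + of_int B) / (of_int C * z + of_int D)"
  define J where "J = of_int C * z + of_int D"
  have J: "J \<noteq> 0" unfolding J_def by (rule denominator_nonzero[OF z det_1_imp(1)[OF ABCD]])
  have w: "Im w > 0" unfolding w_def by (rule Im_moebius_pos[OF ABCD z])
  have wJ: "w * J = of_int A * z + of_int B" using J by (simp add: w_def J_def)
  have lin: "(of_int u * w + of_int v) = (of_int (u * A + v * C) * z + of_int (u * B + v * D)) / J" for u v
  proof -
    have "(of_int u * w + of_int v) * J = of_int u * (w * J) + of_int v * J" by (simp add: algebra_simps)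
    also have "\<dots> = of_int (u * A + v * C) * z + of_int (u * B + v * D)"
      unfolding wJ by (simp add: J_def algebra_simps)
    finally show ?thesis using J by (simp add: field_simps)
  qed
  have "(a * A + b * C) * (c * B + d * D) - (a * B + b * D) * (c * A + d * C) = (a * d - b * c) * (A * D - B * C)"
    by (simp add: algebra_simps)
  hence det': "(a * A + b * C) * (c * B + d * D) - (a * B + b * D) * (c * A + d * C) = 1"
    using det ABCD by simp
  have "poincare_term K (c, d) w = qexp ((of_int a * w + of_int b) / (of_int c * w + of_int d)) / (of_int c * w + of_int d) ^ K"
    by (rule poincare_term_eq[OF det w])
  also have "(of_int a * w + of_int b) / (of_int c * w + of_int d) =
      (of_int (a * A + b * C) * z + of_int (a * B + b * D)) / (of_int (c * A + d * C) * z + of_int (c * B + d * D))"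
    unfolding lin using J by simp
  also have "(of_int c * w + of_int d) ^ K = (of_int (c * A + d * C) * z + of_int (c * B + d * D)) ^ K / J ^ K"
    unfolding lin by (simp add: power_divide)
  finally have "poincare_term K (c, d) w = J ^ K * poincare_term K (c * A + d * C, c * B + d * D) z"
    unfolding poincare_term_eq[OF det' z] by simp
  thus ?thesis unfolding w_def J_def .
qed

lemma bij_coprime_pairs:
  assumes "A * D - B * C = (1::int)"
  shows "bij_betw (\<lambda>(c, d). (c * A + d * C, c * B + d * D)) coprime_pairs coprime_pairs"
proof (rule bij_betw_byWitness[where f' = "\<lambda>(c, d). (c * D - d * C, d * A - c * B)"])
  have cop: "coprime (c * A + d * C) (c * B + d * D)" if det: "A * D - B * C = (1::int)" and cd: "coprime c d" for A B C D c d
  proof -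
    obtain a b where ab: "a * d - b * c = 1" using bezout_pair_det[OF cd] by blast
    have "(a * A + b * C) * (c * B + d * D) - (a * B + b * D) * (c * A + d * C) = (a * d - b * c) * (A * D - B * C)"
      by (simp add: algebra_simps)
    thus ?thesis using ab det by (intro det_1_imp(2)[where a = "a * A + b * C" and b = "a * B + b * D"]) simp
  qed
  have AD: "A * D = 1 + B * C" using assms by simp
  show "\<forall>p\<in>coprime_pairs. (\<lambda>(c, d). (c * D - d * C, d * A - c * B)) ((\<lambda>(c, d). (c * A + d * C, c * B + d * D)) p) = p"
  proof (clarsimp)
    fix c d
    have "(c * A + d * C) * D - (c * B + d * D) * C = c * (A * D - B * C)" by (simp add: algebra_simps)
    moreover have "(c * B + d * D) * A - (c * A + d * C) * B = d * (A * D - B * C)" by (simp add: algebra_simps)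
    ultimately show "(c * A + d * C) * D - (c * B + d * D) * C = c \<and> (c * B + d * D) * A - (c * A + d * C) * B = d"
      using assms by simp
  qed
  show "\<forall>p\<in>coprime_pairs. (\<lambda>(c, d). (c * A + d * C, c * B + d * D)) ((\<lambda>(c, d). (c * D - d * C, d * A - c * B)) p) = p"
  proof (clarsimp)
    fix c d
    have "(c * D - d * C) * A + (d * A - c * B) * C = c * (A * D - B * C)" by (simp add: algebra_simps)
    moreover have "(c * D - d * C) * B + (d * A - c * B) * D = d * (A * D - B * C)" by (simp add: algebra_simps)
    ultimately show "(c * D - d * C) * A + (d * A - c * B) * C = c \<and> (c * D - d * C) * B + (d * A - c * B) * D = d"
      using assms by simp
  qed
  show "(\<lambda>(c, d). (c * A + d * C, c * B + d * D)) ` coprime_pairs \<subseteq> coprime_pairs"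
    using cop[OF assms] by (auto simp: coprime_pairs_def)
  show "(\<lambda>(c, d). (c * D - d * C, d * A - c * B)) ` coprime_pairs \<subseteq> coprime_pairs"
  proof -
    have "D * A - (- B) * (- C) = 1" using assms by (simp add: mult.commute)
    from cop[OF this] show ?thesis by (fastforce simp: coprime_pairs_def algebra_simps)
  qed
qed

text \<open>
  Right multiplication permutes the second rows \<open>(c, d)\<close>.
\<close>
lemma poincare_series_modular:
  assumes "a * d - b * c = 1" and z: "Im z > 0"
  shows "poincare_series K ((of_int a * z + of_int b) / (of_int c * z + of_int d)) =
     (of_int c * z + of_int d) ^ K * poincare_series K z"
proof -
  let ?w = "(of_int a * z + of_int b) / (of_int c * z + of_int d)"
  let ?h = "\<lambda>(c', d'). (c' * a + d' * c, c' * b + d' * d)"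
  have "(\<Sum>\<^sub>\<infinity>p\<in>coprime_pairs. poincare_term K p ?w) =
      (\<Sum>\<^sub>\<infinity>p\<in>coprime_pairs. (of_int c * z + of_int d) ^ K * poincare_term K (?h p) z)"
    by (intro infsum_cong) (auto simp: poincare_term_moebius[OF assms(1) _ z])
  also have "\<dots> = (of_int c * z + of_int d) ^ K * (\<Sum>\<^sub>\<infinity>p\<in>coprime_pairs. poincare_term K (?h p) z)"
    by (rule infsum_cmult_right')
  also have "(\<Sum>\<^sub>\<infinity>p\<in>coprime_pairs. poincare_term K (?h p) z) = (\<Sum>\<^sub>\<infinity>p\<in>coprime_pairs. poincare_term K p z)"
    by (rule infsum_reindex_bij_betw[OF bij_coprime_pairs[OF assms(1)]])
  finally show ?thesis using Im_moebius_pos[OF assms] z by (simp add: poincare_series_def)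
qed

text \<open>
  Every coprime pair with \<open>c \<ge> 1\<close> is uniquely \<open>(c, r + c m)\<close> with a reduced residue \<open>r\<close> modulo
  \<open>c\<close>.
\<close>
definition residue_index :: "(int \<times> int) set" where
  "residue_index = Sigma {1..} (\<lambda>c. {r. 0 \<le> r \<and> r < c \<and> coprime c r})"

text \<open>
  The Kloosterman sum \<open>S(1, n; c)\<close>: from \<open>a r - b c = 1\<close> the first entry \<open>a\<close> of the completing row
  is the inverse of \<open>r\<close> modulo \<open>c\<close>.
\<close>
definition kloosterman :: "nat \<Rightarrow> int \<Rightarrow> complex" where
  "kloosterman n c = (\<Sum>r | 0 \<le> r \<and> r < c \<and> coprime c r.
     qexp (of_int (fst (bezout_pair c r) + int n * r) / of_int c))"

lemma poincare_term_uminus: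
  assumes "even K" and cd: "(c, d) \<in> coprime_pairs" and z: "Im z > 0"
  shows "poincare_term K (- c, - d) z = poincare_term K (c, d) z"
proof -
  have det: "fst (bezout_pair c d) * d - snd (bezout_pair c d) * c = 1"
    using cd bezout_pair_det by (auto simp: coprime_pairs_def)
  hence det': "(- fst (bezout_pair c d)) * (- d) - (- snd (bezout_pair c d)) * (- c) = 1" by simp
  have e: "of_int (- x) * z + of_int (- y) = - (of_int x * z + of_int y)" for x y by simp
  show ?thesis
    unfolding poincare_term_eq[OF det z] poincare_term_eq[OF det' z] e using assms(1)
    by (simp only: minus_divide_divide power_minus_even)
qed

lemma coprime_pairs_split:
  "coprime_pairs = ({(0, 1), (0, -1)} \<union> {(c, d). c \<ge> 1 \<and> coprime c d}) \<union> uminus ` {(c, d). c \<ge> 1 \<and> coprime c d}"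
proof (intro equalityI subsetI)
  fix p :: "int \<times> int" assume "p \<in> coprime_pairs"
  then obtain c d where p: "p = (c, d)" "coprime c d" by (auto simp: coprime_pairs_def)
  consider "c = 0" | "c \<ge> 1" | "c \<le> -1" by linarith
  thus "p \<in> ({(0, 1), (0, -1)} \<union> {(c, d). c \<ge> 1 \<and> coprime c d}) \<union> uminus ` {(c, d). c \<ge> 1 \<and> coprime c d}"
  proof cases
    case 1
    hence "d = 1 \<or> d = -1" using p by auto
    thus ?thesis using 1 p by auto
  next
    case 3
    hence "(- c, - d) \<in> {(c, d). c \<ge> 1 \<and> coprime c d}" "p = - (- c, - d)" using p by auto
    thus ?thesis by blast
  qed (use p in auto)
qed (auto simp: coprime_pairs_def)

text \<open>
  For even weight the pairs \<open>(c, d)\<close> and \<open>(-c, -d)\<close> contribute equally, which cancels the factor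
  \<open>1/2\<close>; the pairs \<open>(0, \<plusminus>1)\<close> give the leading term \<open>e(z)\<close>.
\<close>
lemma poincare_series_split:
  assumes K: "K \<ge> 4" "even K" and z: "Im z > 0"
  shows "poincare_series K z = qexp z + (\<Sum>\<^sub>\<infinity>p\<in>{(c, d). c \<ge> 1 \<and> coprime c d}. poincare_term K p z)"
proof -
  let ?A = "{(0, 1), (0, -1)} :: (int \<times> int) set"
  let ?B = "{(c, d). c \<ge> 1 \<and> coprime c d} :: (int \<times> int) set"
  let ?f = "\<lambda>p. poincare_term K p z"
  have sub: "?A \<subseteq> coprime_pairs" "?B \<subseteq> coprime_pairs" "uminus ` ?B \<subseteq> coprime_pairs"
    by (auto simp: coprime_pairs_def)
  note s = summable_on_subset[OF poincare_term_summable'[OF K(1) z]]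
  have "infsum ?f coprime_pairs = infsum ?f (?A \<union> ?B) + infsum ?f (uminus ` ?B)"
    unfolding coprime_pairs_split
    by (intro infsum_Un_disjoint s) (use sub in auto)
  also have "infsum ?f (?A \<union> ?B) = infsum ?f ?A + infsum ?f ?B"
    by (intro infsum_Un_disjoint s) (use sub in auto)
  also have "infsum ?f (uminus ` ?B) = infsum ?f ?B"
  proof -
    have "infsum ?f (uminus ` ?B) = infsum (?f \<circ> uminus) ?B"
      by (rule infsum_reindex) (auto simp: inj_on_def)
    also have "\<dots> = infsum ?f ?B"
      by (intro infsum_cong) (auto simp: poincare_term_uminus[OF K(2) _ z] coprime_pairs_def)
    finally show ?thesis .
  qed
  also have "infsum ?f ?A = 2 * qexp z"
  proof -
    have "poincare_term K (0, 1) z = qexp z"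
      using poincare_term_eq[of 1 1 0 0 z K] z by simp
    moreover have "poincare_term K (0, - 1) z = qexp z"
      using poincare_term_uminus[OF K(2), of 0 1 z] calculation z by (simp add: coprime_pairs_def)
    ultimately show ?thesis by simp
  qed
  finally show ?thesis using z by (simp add: poincare_series_def)
qed

lemma bij_residue_index:
  "bij_betw (\<lambda>((c, r), m). (c, r + c * m)) (residue_index \<times> UNIV) {(c, d). c \<ge> 1 \<and> coprime c (d::int)}"
proof (rule bij_betw_byWitness[where f' = "\<lambda>(c, d). ((c, d mod c), d div c)"])
  have *: "coprime c (r + c * m) \<longleftrightarrow> coprime c r" for c r m :: int
    by (metis coprime_iff_gcd_eq_1 gcd_add_mult mult.commute add.commute)
  show "(\<lambda>((c, r), m). (c, r + c * m)) ` (residue_index \<times> UNIV) \<subseteq> {(c, d). c \<ge> 1 \<and> coprime c d}"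
    by (auto simp: residue_index_def *)
  show "(\<lambda>(c, d). ((c, d mod c), d div c)) ` {(c, d). c \<ge> 1 \<and> coprime c d} \<subseteq> residue_index \<times> UNIV"
    by (auto simp: residue_index_def gcd_red_int[symmetric] coprime_iff_gcd_eq_1 gcd.commute)
qed (auto simp: residue_index_def)

text \<open>
  From \<open>(a z + b)/(c z + d) = a/c - 1/(c (c z + d))\<close> the sum over a residue class becomes
  \<open>poincare_inner_sum\<close> with \<open>\<alpha> = 1/c^2\<close> at the point \<open>w = z + r/c\<close>.
\<close>
lemma poincare_residue_class_sum:
  assumes K: "K \<ge> 2" and z: "Im z > 0" and cr: "(c, r) \<in> residue_index"
  shows "(\<Sum>\<^sub>\<infinity>m. poincare_term K (c, r + c * m) z) =
    (\<Sum>\<^sub>\<infinity>n. qexp (of_int (fst (bezout_pair c r) + int n * r) / of_int c) / of_int c ^ K *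
       bessel_coeff K (1 / (real_of_int c)\<^sup>2) n * qexp z ^ n)"
proof -
  define a b where "a = fst (bezout_pair c r)" and "b = snd (bezout_pair c r)"
  have c: "c \<ge> 1" "coprime c r" using cr by (auto simp: residue_index_def)
  have det: "a * r - b * c = 1" using bezout_pair_det[OF c(2)] by (simp add: a_def b_def)
  define w where "w = z + of_int r / of_int c"
  have w: "Im w > 0" using z by (simp add: w_def Im_divide)
  have c0: "of_int c \<noteq> (0::complex)" using c by simp
  have single: "poincare_term K (c, r + c * m) z =
      qexp (of_int a / of_int c) / of_int c ^ K * (qexp (- of_real (1 / (real_of_int c)\<^sup>2) / (w + of_int m)) / (w + of_int m) ^ K)" for m
  proof -
    have det': "a * (r + c * m) - (b + a * m) * c = 1" using det by (simp add: algebra_simps)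
    have wm: "w + of_int m \<noteq> 0" using w by (auto simp: complex_eq_iff)
    have den: "of_int c * z + of_int (r + c * m) = of_int c * (w + of_int m)"
      using c0 by (simp add: w_def field_simps)
    have "of_int a * z + of_int (b + a * m) = of_int a * (w + of_int m) - 1 / of_int c"
    proof -
      have "complex_of_int (a * r - b * c) = 1" using det by simp
      thus ?thesis using c0 by (simp add: w_def field_simps)
    qed
    hence "(of_int a * z + of_int (b + a * m)) / (of_int c * z + of_int (r + c * m)) =
       of_int a / of_int c + - of_real (1 / (real_of_int c)\<^sup>2) / (w + of_int m)"
    proof -
      have "(A * W - 1 / C) / (C * W) = A / C + - (1 / C\<^sup>2) / W" if "C \<noteq> 0" "W \<noteq> 0" for A C W :: complex
        using that by (simp add: field_simps power2_eq_square)
      from this[OF c0 wm, of "of_int a"] show ?thesis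
        unfolding den \<open>of_int a * z + of_int (b + a * m) = of_int a * (w + of_int m) - 1 / of_int c\<close> by simp
    qed
    thus ?thesis unfolding poincare_term_eq[OF det' z]
      by (simp only: qexp_add den power_mult_distrib times_divide_times_eq)
  qed
  have "(\<Sum>\<^sub>\<infinity>m. poincare_term K (c, r + c * m) z) = qexp (of_int a / of_int c) / of_int c ^ K *
     (\<Sum>\<^sub>\<infinity>m::int. qexp (- of_real (1 / (real_of_int c)\<^sup>2) / (w + of_int m)) / (w + of_int m) ^ K)"
    unfolding single by (rule infsum_cmult_right')
  also have "(\<Sum>\<^sub>\<infinity>m::int. qexp (- of_real (1 / (real_of_int c)\<^sup>2) / (w + of_int m)) / (w + of_int m) ^ K) =
     (\<Sum>\<^sub>\<infinity>n. bessel_coeff K (1 / (real_of_int c)\<^sup>2) n * qexp w ^ n)"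
  proof (rule poincare_inner_sum[OF w K])
    have "(real_of_int c)\<^sup>2 \<ge> 1" using c by (simp add: one_le_power)
    thus "1 / (real_of_int c)\<^sup>2 \<le> 1" by (subst divide_le_eq_1_pos) linarith+
  qed auto
  also have "qexp (of_int a / of_int c) / of_int c ^ K * \<dots> =
     (\<Sum>\<^sub>\<infinity>n. qexp (of_int a / of_int c) / of_int c ^ K * (bessel_coeff K (1 / (real_of_int c)\<^sup>2) n * qexp w ^ n))"
    by (rule infsum_cmult_right'[symmetric])
  also have "\<dots> = (\<Sum>\<^sub>\<infinity>n. qexp (of_int (a + int n * r) / of_int c) / of_int c ^ K *
       bessel_coeff K (1 / (real_of_int c)\<^sup>2) n * qexp z ^ n)"
  proof (rule infsum_cong)
    fix n :: nat
    have "qexp w ^ n = qexp (of_nat n * (of_int r / of_int c)) * qexp z ^ n"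
      by (simp add: w_def qexp_add power_mult_distrib qexp_power) (simp add: qexp_def mult_ac)
    moreover have "qexp (of_int (a + int n * r) / of_int c) = qexp (of_int a / of_int c) * qexp (of_nat n * (of_int r / of_int c))"
      by (simp add: add_divide_distrib qexp_add)
    ultimately show "qexp (of_int a / of_int c) / of_int c ^ K * (bessel_coeff K (1 / (real_of_int c)\<^sup>2) n * qexp w ^ n) =
      qexp (of_int (a + int n * r) / of_int c) / of_int c ^ K * bessel_coeff K (1 / (real_of_int c)\<^sup>2) n * qexp z ^ n"
      by simp
  qed
  finally show ?thesis by (simp add: a_def)
qed

lemma residue_index_summable: "(\<lambda>(c, r). 1 / real_of_int c ^ 3) summable_on residue_index"
  unfolding residue_index_def
proof (rule summable_on_SigmaI)
  let ?R = "\<lambda>c::int. {r. 0 \<le> r \<and> r < c \<and> coprime c r}"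
  have fin: "finite (?R c)" for c by (rule finite_subset[of _ "{0..<c}"]) auto
  have card: "real (card (?R c)) \<le> real_of_int c" if "c \<ge> 1" for c
  proof -
    have "card (?R c) \<le> card {0..<c}" by (rule card_mono) auto
    thus ?thesis using that by simp
  qed
  show "((\<lambda>r. case (c, r) of (c, r) \<Rightarrow> 1 / real_of_int c ^ 3) has_sum (real (card (?R c)) * (1 / real_of_int c ^ 3))) (?R c)" for c
    using has_sum_finite[OF fin[of c], of "\<lambda>_. 1 / real_of_int c ^ 3"] by simp
  show "(\<lambda>c. real (card (?R c)) * (1 / real_of_int c ^ 3)) summable_on {1..}"
  proof (rule summable_on_comparison_test)
    show "(\<lambda>c. 2 * (1 / (1 + (real_of_int c)\<^sup>2))) summable_on {1..}"
      by (intro summable_on_cmult_right summable_on_subset[OF summable_on_inverse_square_int]) auto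
    fix c :: int assume c: "c \<in> {1..}"
    have "real (card (?R c)) * (1 / real_of_int c ^ 3) \<le> real_of_int c * (1 / real_of_int c ^ 3)"
      using card[of c] c by (intro mult_right_mono) auto
    also have "\<dots> = 1 / (real_of_int c)\<^sup>2" using c by (simp add: power3_eq_cube power2_eq_square)
    also have "\<dots> \<le> 2 * (1 / (1 + (real_of_int c)\<^sup>2))"
    proof -
      have "(real_of_int c)\<^sup>2 \<ge> 1" using c by (simp add: one_le_power)
      thus ?thesis by (simp add: divide_simps)
    qed
    finally show "real (card (?R c)) * (1 / real_of_int c ^ 3) \<le> 2 * (1 / (1 + (real_of_int c)\<^sup>2))" .
  qed auto
qed auto

definition poincare_coeff :: "nat \<Rightarrow> nat \<Rightarrow> complex" where
  "poincare_coeff K n = (if n = 1 then 1 else 0) +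
     (\<Sum>\<^sub>\<infinity>(c, r)\<in>residue_index. qexp (of_int (fst (bezout_pair c r) + int n * r) / of_int c) / of_int c ^ K *
       bessel_coeff K (1 / (real_of_int c)\<^sup>2) n)"

lemma norm_qexp_of_int_divide [simp]: "norm (qexp (of_int m / of_int c)) = 1"
proof -
  have "Im (of_int m / of_int c :: complex) = 0" by (simp add: Im_divide)
  thus ?thesis by (simp add: norm_qexp)
qed

text \<open>
  All frequencies are collected by exchanging the sum over \<open>(c, r)\<close> with the sum over \<open>n\<close>; the
  exchange is dominated by \<open>c^(-3)\<close> times a convergent series in \<open>n\<close>.
\<close>
lemma poincare_coeff_sums:
  assumes K: "K \<ge> 4" "even K" and z: "Im z > 0"
  shows "(\<lambda>n. poincare_coeff K n * qexp z ^ n) sums poincare_series K z"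
proof -
  define q where "q = qexp z"
  have q: "norm q < 1" using norm_qexp_less_1[OF z] by (simp add: q_def)
  obtain \<epsilon> where e: "\<epsilon> > 0" "exp \<epsilon> * norm q < 1" using exists_growth_margin[OF q] by auto
  define F where "F = (\<lambda>(c, r) n. qexp (of_int (fst (bezout_pair c r) + int n * r) / of_int c) / of_int c ^ K *
       bessel_coeff K (1 / (real_of_int c)\<^sup>2) n)"
  define v where "v n = (2 * pi) ^ K * exp (4 * pi\<^sup>2 / \<epsilon>) * (real n ^ (K - 1) * (exp \<epsilon> * norm q) ^ n)" for n
  define u where "u = (\<lambda>(c :: int, r :: int). 1 / real_of_int c ^ 3)"
  have vs: "summable v" unfolding v_def
    by (intro summable_mult power_times_geometric_summable_real) (use e in auto)
  have v0: "v n \<ge> 0" for n unfolding v_def by simp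
  have vs': "v summable_on UNIV" using vs v0 by (intro norm_summable_imp_summable_on) simp
  have us: "u summable_on residue_index" unfolding u_def by (rule residue_index_summable)
  have u0: "u p \<ge> 0" if "p \<in> residue_index" for p using that by (auto simp: u_def residue_index_def)
  have le: "norm (F p n * q ^ n) \<le> u p * v n" if p: "p \<in> residue_index" for p n
  proof -
    obtain c r where cr: "p = (c, r)" "c \<ge> 1" using p by (auto simp: residue_index_def)
    have c2: "(real_of_int c)\<^sup>2 \<ge> 1" using cr by (simp add: one_le_power)
    have "norm (F p n * q ^ n) = 1 / real_of_int c ^ K * norm (bessel_coeff K (1 / (real_of_int c)\<^sup>2) n * q ^ n)"
      unfolding F_def cr using cr(2) by (simp add: norm_mult norm_divide norm_power del: of_int_add of_int_mult)
    also have "\<dots> \<le> 1 / real_of_int c ^ 3 * v n"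
      unfolding v_def using K c2 cr e
      by (intro mult_mono norm_bessel_coeff_le divide_left_mono power_increasing) auto
    finally show ?thesis by (simp add: u_def cr)
  qed
  let ?B = "{(c, d). c \<ge> 1 \<and> coprime c d} :: (int \<times> int) set"
  have sumB: "(\<lambda>p. poincare_term K p z) summable_on ?B"
    by (rule summable_on_subset[OF poincare_term_summable'[OF K(1) z]]) (auto simp: coprime_pairs_def)
  have "infsum (\<lambda>p. poincare_term K p z) ?B = infsum (\<lambda>x. poincare_term K ((\<lambda>((c, r), m). (c, r + c * m)) x) z) (residue_index \<times> UNIV)"
    by (rule infsum_reindex_bij_betw[OF bij_residue_index, symmetric])
  also have "\<dots> = (\<Sum>\<^sub>\<infinity>p\<in>residue_index. \<Sum>\<^sub>\<infinity>m. poincare_term K ((\<lambda>((c, r), m). (c, r + c * m)) (p, m)) z)"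
    by (rule infsum_Sigma_banach[symmetric]) (subst summable_on_reindex_bij_betw[OF bij_residue_index], rule sumB)
  also have "\<dots> = (\<Sum>\<^sub>\<infinity>p\<in>residue_index. \<Sum>\<^sub>\<infinity>n. F p n * q ^ n)"
  proof (rule infsum_cong)
    fix p assume p: "p \<in> residue_index"
    obtain c r where cr: "p = (c, r)" by (cases p)
    show "(\<Sum>\<^sub>\<infinity>m. poincare_term K ((\<lambda>((c, r), m). (c, r + c * m)) (p, m)) z) = (\<Sum>\<^sub>\<infinity>n. F p n * q ^ n)"
      using poincare_residue_class_sum[OF _ z p[unfolded cr], of K] K by (simp add: cr F_def q_def)
  qed
  also have "\<dots> = (\<Sum>\<^sub>\<infinity>n. \<Sum>\<^sub>\<infinity>p\<in>residue_index. F p n * q ^ n)"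
    by (rule infsum_swap_dominated[OF us vs' le u0 v0])
  also have "\<dots> = (\<Sum>\<^sub>\<infinity>n. (\<Sum>\<^sub>\<infinity>p\<in>residue_index. F p n) * q ^ n)"
    by (simp add: infsum_cmult_left')
  finally have B: "infsum (\<lambda>p. poincare_term K p z) ?B = (\<Sum>\<^sub>\<infinity>n. (\<Sum>\<^sub>\<infinity>p\<in>residue_index. F p n) * q ^ n)" .
  define U where "U = infsum u residue_index"
  have bound: "norm ((\<Sum>\<^sub>\<infinity>p\<in>residue_index. F p n) * q ^ n) \<le> U * v n" for n
  proof -
    have "norm (\<Sum>\<^sub>\<infinity>p\<in>residue_index. F p n * q ^ n) \<le> (\<Sum>\<^sub>\<infinity>p\<in>residue_index. u p * v n)"
    proof -
      have uv: "(\<lambda>p. u p * v n) summable_on residue_index" by (intro summable_on_cmult_left us)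
      have Fn: "(\<lambda>p. norm (F p n * q ^ n)) summable_on residue_index"
        by (rule summable_on_comparison_test[OF uv le]) auto
      have "norm (\<Sum>\<^sub>\<infinity>p\<in>residue_index. F p n * q ^ n) \<le> (\<Sum>\<^sub>\<infinity>p\<in>residue_index. norm (F p n * q ^ n))"
        by (rule norm_infsum_bound[OF Fn])
      also have "\<dots> \<le> (\<Sum>\<^sub>\<infinity>p\<in>residue_index. u p * v n)"
        by (rule infsum_mono[OF Fn uv le])
      finally show ?thesis .
    qed
    thus ?thesis by (simp add: infsum_cmult_left' U_def)
  qed
  have "summable (\<lambda>n. norm ((\<Sum>\<^sub>\<infinity>p\<in>residue_index. F p n) * q ^ n))"
    by (rule summable_comparison_test'[OF summable_mult[OF vs, of U]]) (use bound in simp)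
  hence "(\<lambda>n. (\<Sum>\<^sub>\<infinity>p\<in>residue_index. F p n) * q ^ n) sums infsum (\<lambda>p. poincare_term K p z) ?B"
    unfolding B by (intro has_sum_imp_sums has_sum_infsum norm_summable_imp_summable_on)
  moreover have "(\<lambda>n. (if n = 1 then 1 else 0) * q ^ n) sums q"
    using sums_single[of 1 "\<lambda>n. q ^ n"] by (simp add: if_distrib[of "\<lambda>x. x * _"] cong: if_cong)
  ultimately have "(\<lambda>n. (if n = 1 then 1 else 0) * q ^ n + (\<Sum>\<^sub>\<infinity>p\<in>residue_index. F p n) * q ^ n) sums
      (q + infsum (\<lambda>p. poincare_term K p z) ?B)" by (rule sums_add[rotated])
  moreover have "poincare_coeff K n * qexp z ^ n = (if n = 1 then 1 else 0) * q ^ n + (\<Sum>\<^sub>\<infinity>p\<in>residue_index. F p n) * q ^ n" for n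
    by (simp add: poincare_coeff_def F_def q_def distrib_right case_prod_unfold)
  ultimately show ?thesis using poincare_series_split[OF K z] by (simp add: q_def)
qed

lemma poincare_coeff_0: "K \<ge> 2 \<Longrightarrow> poincare_coeff K 0 = 0"
  by (simp add: poincare_coeff_def bessel_coeff_def zero_power case_prod_unfold)

theorem poincare_series_cusp_form:
  assumes K: "K \<ge> 4" "even K"
  shows "poincare_series K \<in> cusp_forms (int K)" "fourier_coeff (poincare_series K) = poincare_coeff K"
proof -
  have s: "(\<lambda>n. poincare_coeff K n * exp (2 * of_real pi * \<i> * of_nat n * z)) sums poincare_series K z" if "Im z > 0" for z
    using poincare_coeff_sums[OF K that] by (simp add: qexp_power)
  show "fourier_coeff (poincare_series K) = poincare_coeff K" using s by (rule fourier_coeff_eqI)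
  show "poincare_series K \<in> cusp_forms (int K)"
  proof (rule cusp_formI[OF s])
    show "poincare_coeff K 0 = 0" using K by (simp add: poincare_coeff_0)
    show "poincare_series K z = 0" if "\<not> Im z > 0" for z using that by (simp add: poincare_series_def)
    fix a b c d :: int and z :: complex assume "a * d - b * c = 1" "Im z > 0"
    from poincare_series_modular[OF this, of K]
    show "poincare_series K ((of_int a * z + of_int b) / (of_int c * z + of_int d)) =
       (of_int c * z + of_int d) powi int K * poincare_series K z" by simp
  qed
qed

section \<open>The invariant measure of the upper half-plane\<close>

text \<open>
  A measure-preserving identification of \<open>real ^ 2\<close> with the complex plane; it carries the change
  of variables over from Cartesian spaces, and the Jacobian determinant with it.
\<close>
definition plane :: "real ^ 2 \<Rightarrow> complex" where
  "plane x = Complex (x $ 1) (x $ 2)"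

definition plane_inv :: "complex \<Rightarrow> real ^ 2" where
  "plane_inv z = (\<chi> i. if i = 1 then Re z else Im z)"

lemma plane_inverses [simp]: "plane (plane_inv z) = z" "plane_inv (plane x) = x"
proof -
  have "(2::2) \<noteq> 1" by simp
  thus "plane (plane_inv z) = z" by (simp add: plane_def plane_inv_def complex_eq_iff)
  show "plane_inv (plane x) = x"
    by (simp add: plane_def plane_inv_def vec_eq_iff forall_2)
qed

lemma bounded_linear_plane: "bounded_linear plane"
proof -
  have "linear plane" by (rule linearI) (auto simp: plane_def complex_eq_iff)
  thus ?thesis by (rule linear_conv_bounded_linear[THEN iffD1])
qed

lemma bounded_linear_plane_inv: "bounded_linear plane_inv"
proof -
  have "linear plane_inv" by (rule linearI) (auto simp: plane_inv_def vec_eq_iff)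
  thus ?thesis by (rule linear_conv_bounded_linear[THEN iffD1])
qed

lemma measurable_plane [measurable]: "plane \<in> borel_measurable borel"
  by (intro borel_measurable_continuous_onI linear_continuous_on bounded_linear_plane)

lemma distr_lborel_plane: "distr lborel borel plane = lborel"
proof (rule lborel_eqI[symmetric])
  fix l u :: complex assume le: "\<And>b. b \<in> Basis \<Longrightarrow> l \<bullet> b \<le> u \<bullet> b"
  have le': "Re l \<le> Re u" "Im l \<le> Im u" using le[of 1] le[of \<i>] by (auto simp: Basis_complex_def)
  have "plane -` box l u = box (plane_inv l) (plane_inv u)"
    by (auto simp: plane_def plane_inv_def in_box_complex_iff mem_box_cart forall_2)
  hence "emeasure (distr lborel borel plane) (box l u) = emeasure lborel (box (plane_inv l) (plane_inv u))"
    by (subst emeasure_distr) auto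
  also have "\<dots> = ennreal (\<Prod>b\<in>Basis. (plane_inv u - plane_inv l) \<bullet> b)"
    by (rule emeasure_lborel_box)
       (use le' in \<open>auto simp: Basis_vec_def plane_inv_def inner_axis\<close>)
  also have "(\<Prod>b\<in>Basis. (plane_inv u - plane_inv l) \<bullet> b) = (\<Prod>i\<in>UNIV. (plane_inv u - plane_inv l) $ i)"
  proof -
    have B: "Basis = (\<lambda>i. axis i (1::real)) ` (UNIV :: 2 set)" by (auto simp: Basis_vec_def)
    have "inj (\<lambda>i. axis i (1::real) :: real ^ 2)" by (auto simp: inj_on_def axis_eq_axis)
    thus ?thesis unfolding B by (subst prod.reindex) (auto simp: inner_axis)
  qed
  also have "\<dots> = (\<Prod>b\<in>Basis. (u - l) \<bullet> b)"
    by (simp add: UNIV_2 plane_inv_def Basis_complex_def)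
  finally show "emeasure (distr lborel borel plane) (box l u) = ennreal (\<Prod>b\<in>Basis. (u - l) \<bullet> b)" .
qed simp

lemma nn_integral_lborel_as_absolute_integral:
  fixes w :: "real ^ 2 \<Rightarrow> real"
  assumes w: "w \<in> borel_measurable borel" "\<And>x. w x \<ge> 0" and X: "X \<in> sets borel"
  shows "(\<integral>\<^sup>+x. ennreal (indicator X x * w x) \<partial>lborel) =
     (if w absolutely_integrable_on X then ennreal (integral X w) else \<infinity>)"
proof -
  have m: "(\<lambda>x. indicator X x * w x) \<in> borel_measurable lborel" using w X by measurable
  have iff: "w absolutely_integrable_on X \<longleftrightarrow> integrable lborel (\<lambda>x. indicator X x * w x)"
    unfolding set_integrable_def using m by (subst integrable_completion) auto
  show ?thesis
  proof (cases "integrable lborel (\<lambda>x. indicator X x * w x)")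
    case True
    have "integral\<^sup>L lborel (\<lambda>x. indicator X x * w x) = integral UNIV (\<lambda>x. indicator X x * w x)"
      by (rule integral_lborel[OF True, symmetric])
    also have "\<dots> = integral X w"
      by (subst integral_restrict_UNIV[symmetric]) (auto intro!: arg_cong[where f = "integral UNIV"] simp: indicator_def)
    finally show ?thesis using True iff nn_integral_eq_integral[OF True] w by simp
  next
    case False
    have "(\<integral>\<^sup>+x. ennreal (indicator X x * w x) \<partial>lborel) = \<infinity>"
    proof (rule ccontr)
      assume "\<not> ?thesis"
      hence "(\<integral>\<^sup>+x. ennreal (indicator X x * w x) \<partial>lborel) < \<infinity>" by (simp add: less_top)
      hence "integrable lborel (\<lambda>x. indicator X x * w x)"
        using m w by (intro integrableI_nonneg) auto
      with False show False by simp
    qed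
    thus ?thesis using False iff by simp
  qed
qed

text \<open>
  The real Jacobian of a holomorphic map is the squared modulus of its derivative.
\<close>
lemma det_complex_mult:
  fixes D :: complex
  shows "det (matrix (\<lambda>h. plane_inv (D * plane h))) = (norm D)\<^sup>2"
proof -
  have "(2::2) \<noteq> 1" by simp
  thus ?thesis
    unfolding cmod_power2
    by (simp add: det_2 matrix_def plane_def plane_inv_def axis_def power2_eq_square)
qed

lemma nn_integral_complex_change_of_variables:
  fixes g D :: "complex \<Rightarrow> complex"
  assumes S: "S \<in> sets borel" "g ` S \<in> sets borel"
    and der: "\<And>z. z \<in> S \<Longrightarrow> (g has_field_derivative D z) (at z)"
    and inj: "inj_on g S"
    and u: "u \<in> borel_measurable borel" "\<And>z. u z \<ge> 0"
    and D: "D \<in> borel_measurable borel" and g: "g \<in> borel_measurable borel"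
  shows "(\<integral>\<^sup>+z. ennreal (indicator (g ` S) z * u z) \<partial>lborel) =
     (\<integral>\<^sup>+z. ennreal (indicator S z * ((norm (D z))\<^sup>2 * u (g z))) \<partial>lborel)"
proof -
  note [measurable] = S u(1) D g
  define G where "G x = plane_inv (g (plane x))" for x
  define G' where "G' x h = plane_inv (D (plane x) * plane h)" for x h
  define X where "X = plane -` S"
  have X: "X \<in> sets borel" unfolding X_def using measurable_sets[OF measurable_plane S(1)] by simp
  have GX: "G ` X = plane -` (g ` S)"
  proof (intro equalityI subsetI)
    fix y assume "y \<in> plane -` (g ` S)"
    then obtain z where z: "z \<in> S" "plane y = g z" by auto
    have "y = G (plane_inv z)" by (simp add: G_def z(2)[symmetric])
    moreover have "plane_inv z \<in> X" using z by (simp add: X_def)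
    ultimately show "y \<in> G ` X" by blast
  qed (auto simp: G_def X_def)
  have GXs: "G ` X \<in> sets borel" unfolding GX using measurable_sets[OF measurable_plane S(2)] by simp
  have derG: "(G has_derivative G' x) (at x within X)" if x: "x \<in> X" for x
  proof -
    have "(g has_derivative (\<lambda>h. D (plane x) * h)) (at (plane x))"
      using der[of "plane x"] x by (simp add: X_def has_field_derivative_def)
    moreover have "(plane has_derivative plane) (at x)"
      by (rule bounded_linear_imp_has_derivative[OF bounded_linear_plane])
    ultimately have "(g \<circ> plane has_derivative (\<lambda>h. D (plane x) * h) \<circ> plane) (at x)"
      by (rule diff_chain_at[rotated])
    moreover have "(plane_inv has_derivative plane_inv) (at ((g \<circ> plane) x))"
      by (rule bounded_linear_imp_has_derivative[OF bounded_linear_plane_inv])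
    ultimately have "(plane_inv \<circ> (g \<circ> plane) has_derivative plane_inv \<circ> ((\<lambda>h. D (plane x) * h) \<circ> plane)) (at x)"
      by (rule diff_chain_at)
    thus ?thesis unfolding G_def[abs_def] G'_def[abs_def] o_def by (rule has_derivative_at_withinI)
  qed
  have injG: "inj_on G X"
  proof (rule inj_onI)
    fix x y assume xy: "x \<in> X" "y \<in> X" "G x = G y"
    hence "g (plane x) = g (plane y)" by (metis G_def plane_inverses(1))
    hence "plane x = plane y" using inj xy by (auto simp: X_def inj_on_def)
    thus "x = y" by (metis plane_inverses(2))
  qed
  define U where "U x = u (plane x)" for x
  have U: "U \<in> borel_measurable borel" "\<And>x. U x \<ge> 0" unfolding U_def using u by auto
  define V where "V x = \<bar>det (matrix (G' x))\<bar> * U (G x)" for x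
  have V_eq: "V x = (norm (D (plane x)))\<^sup>2 * u (g (plane x))" for x
    unfolding V_def G'_def[abs_def] det_complex_mult by (simp add: U_def G_def)
  have V: "V \<in> borel_measurable borel" "\<And>x. V x \<ge> 0" unfolding V_eq using u by auto
  \<comment> \<open>The substitution rule with values in real ^ 1; it transfers integrability in both
    directions, so the case of an infinite integral is covered as well.\<close>
  have cov: "V absolutely_integrable_on X \<and> integral X V = b \<longleftrightarrow>
      U absolutely_integrable_on (G ` X) \<and> integral (G ` X) U = b" for b
  proof -
    have "(\<lambda>x. \<bar>det (matrix (G' x))\<bar> *\<^sub>R (vec (U (G x)) :: real ^ 1)) absolutely_integrable_on X \<and>
           integral X (\<lambda>x. \<bar>det (matrix (G' x))\<bar> *\<^sub>R (vec (U (G x)) :: real ^ 1)) = vec b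
     \<longleftrightarrow> (\<lambda>x. vec (U x) :: real ^ 1) absolutely_integrable_on (G ` X) \<and> integral (G ` X) (\<lambda>x. vec (U x) :: real ^ 1) = vec b"
      by (rule has_absolute_integral_change_of_variables[OF _ derG injG])
         (use X in auto)
    thus ?thesis
      unfolding V_def[abs_def] by (simp add: absolutely_integrable_on_1_iff integral_on_1_eq vec_eq_iff)
  qed
  have "(\<integral>\<^sup>+z. ennreal (indicator (g ` S) z * u z) \<partial>lborel) = (\<integral>\<^sup>+x. ennreal (indicator (g ` S) (plane x) * u (plane x)) \<partial>lborel)"
    by (subst distr_lborel_plane[symmetric], subst nn_integral_distr) auto
  also have "\<dots> = (\<integral>\<^sup>+x. ennreal (indicator (G ` X) x * U x) \<partial>lborel)"
    by (simp add: GX U_def indicator_def)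
  also have "\<dots> = (\<integral>\<^sup>+x. ennreal (indicator X x * V x) \<partial>lborel)"
    unfolding nn_integral_lborel_as_absolute_integral[OF U GXs] nn_integral_lborel_as_absolute_integral[OF V X]
    using cov[of "integral X V"] cov[of "integral (G ` X) U"] by (simp split: if_split) blast
  also have "\<dots> = (\<integral>\<^sup>+x. ennreal (indicator S (plane x) * ((norm (D (plane x)))\<^sup>2 * u (g (plane x)))) \<partial>lborel)"
    by (simp add: V_eq X_def indicator_def)
  also have "\<dots> = (\<integral>\<^sup>+z. ennreal (indicator S z * ((norm (D z))\<^sup>2 * u (g z))) \<partial>lborel)"
    by (subst distr_lborel_plane[symmetric], subst nn_integral_distr) auto
  finally show ?thesis .
qed

type_synonym mat2 = "int \<times> int \<times> int \<times> int"

definition modular_group :: "mat2 set" where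
  "modular_group = {(a, b, c, d). a * d - b * c = 1}"

definition mat_inv :: "mat2 \<Rightarrow> mat2" where
  "mat_inv = (\<lambda>(a, b, c, d). (d, - b, - c, a))"

definition mat_mult :: "mat2 \<Rightarrow> mat2 \<Rightarrow> mat2" where
  "mat_mult = (\<lambda>(a, b, c, d) (a', b', c', d'). (a * a' + b * c', a * b' + b * d', c * a' + d * c', c * b' + d * d'))"

lemma mat_inv_in [simp]: "g \<in> modular_group \<Longrightarrow> mat_inv g \<in> modular_group"
  by (auto simp: modular_group_def mat_inv_def algebra_simps)

lemma mat_inv_inv [simp]: "mat_inv (mat_inv g) = g"
  by (cases g) (simp add: mat_inv_def)

lemma mat_mult_in: "g \<in> modular_group \<Longrightarrow> h \<in> modular_group \<Longrightarrow> mat_mult g h \<in> modular_group"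
proof -
  assume "g \<in> modular_group" "h \<in> modular_group"
  then obtain a b c d a' b' c' d' where gh: "g = (a, b, c, d)" "h = (a', b', c', d')" "a * d - b * c = 1" "a' * d' - b' * c' = 1"
    by (auto simp: modular_group_def)
  have "(a * a' + b * c') * (c * b' + d * d') - (a * b' + b * d') * (c * a' + d * c') = (a * d - b * c) * (a' * d' - b' * c')"
    by (simp add: algebra_simps)
  thus ?thesis using gh by (simp add: modular_group_def mat_mult_def)
qed

lemma moebius_Im_pos [simp]: "g \<in> modular_group \<Longrightarrow> Im z > 0 \<Longrightarrow> Im (moebius_map g z) > 0"
  using Im_moebius_pos by (auto simp: modular_group_def moebius_map_def)

lemma moebius_mult:
  assumes g: "g \<in> modular_group" and h: "h \<in> modular_group" and z: "Im z > 0"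
  shows "moebius_map (mat_mult g h) z = moebius_map g (moebius_map h z)"
proof -
  obtain a b c d a' b' c' d' where gh: "g = (a, b, c, d)" "h = (a', b', c', d')" "a * d - b * c = 1" "a' * d' - b' * c' = 1"
    using g h by (auto simp: modular_group_def)
  define J where "J = of_int c' * z + of_int d'"
  have J: "J \<noteq> 0" unfolding J_def by (rule denominator_nonzero[OF z det_1_imp(1)[OF gh(4)]])
  define w where "w = moebius_map h z"
  have wJ: "w * J = of_int a' * z + of_int b'" using J by (simp add: w_def J_def moebius_map_def gh)
  have lin: "of_int (p * a' + q * c') * z + of_int (p * b' + q * d') = (of_int p * w + of_int q) * J" for p q
  proof -
    have "(of_int p * w + of_int q) * J = of_int p * (w * J) + of_int q * J" by (simp add: algebra_simps)
    also have "\<dots> = of_int (p * a' + q * c') * z + of_int (p * b' + q * d')"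
      unfolding wJ by (simp add: J_def algebra_simps)
    finally show ?thesis by simp
  qed
  have "moebius_map (mat_mult g h) z = (of_int a * w + of_int b) * J / ((of_int c * w + of_int d) * J)"
    unfolding lin[symmetric] by (simp add: gh mat_mult_def moebius_map_def)
  also have "\<dots> = moebius_map g w" using J by (simp add: moebius_map_def gh)
  finally show ?thesis by (simp add: w_def)
qed

lemma moebius_one [simp]: "moebius_map (1, 0, 0, 1) z = z" "moebius_map (-1, 0, 0, -1) z = z"
  by (auto simp: moebius_map_def)

lemma mat_mult_inv: "g \<in> modular_group \<Longrightarrow> mat_mult (mat_inv g) g = (1, 0, 0, 1)"
  "g \<in> modular_group \<Longrightarrow> mat_mult g (mat_inv g) = (1, 0, 0, 1)"
  by (auto simp: modular_group_def mat_mult_def mat_inv_def algebra_simps)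

lemma moebius_inv [simp]:
  assumes "g \<in> modular_group" "Im z > 0"
  shows "moebius_map (mat_inv g) (moebius_map g z) = z" "moebius_map g (moebius_map (mat_inv g) z) = z"
  using moebius_mult[OF mat_inv_in[OF assms(1)] assms(1,2)] moebius_mult[OF assms(1) mat_inv_in[OF assms(1)] assms(2)]
  by (simp_all add: mat_mult_inv assms)

lemma measurable_moebius [measurable]: "moebius_map g \<in> borel_measurable borel"
  by (cases g) (simp add: moebius_map_def)

definition hyp_measure :: "complex measure" where
  "hyp_measure = density lborel (\<lambda>z. ennreal (indicator {z. Im z > 0} z / (Im z)\<^sup>2))"

lemma sets_hyp_measure [simp, measurable_cong]: "sets hyp_measure = sets borel"
  and space_hyp_measure [simp]: "space hyp_measure = UNIV"
  by (auto simp: hyp_measure_def)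

lemma measurable_upper_half [measurable]: "{z. Im z > 0} \<in> sets borel"
  using open_halfspace_Im_gt[of 0] by (auto simp: )

lemma moebius_deriv:
  assumes g: "g = (a, b, c, d)" "a * d - b * c = 1" and z: "Im z > 0"
  shows "(moebius_map g has_field_derivative 1 / (of_int c * z + of_int d)\<^sup>2) (at z)"
proof -
  have nz: "of_int c * z + of_int d \<noteq> 0" by (rule denominator_nonzero[OF z det_1_imp(1)[OF g(2)]])
  have "of_int (a * d - b * c) = (1 :: complex)" using g by simp
  hence det: "of_int a * of_int d - of_int b * of_int c = (1 :: complex)" by simp
  have "((\<lambda>z. (of_int a * z + of_int b) / (of_int c * z + of_int d)) has_field_derivative
     (of_int a * (of_int c * z + of_int d) - (of_int a * z + of_int b) * of_int c) /
       ((of_int c * z + of_int d) * (of_int c * z + of_int d))) (at z)"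
    using nz by (auto intro!: derivative_eq_intros)
  moreover have "of_int a * (of_int c * z + of_int d) - (of_int a * z + of_int b) * of_int c =
      of_int a * of_int d - of_int b * of_int c" by (simp add: algebra_simps)
  ultimately show ?thesis unfolding g moebius_map_def det by (simp add: power2_eq_square det)
qed

lemma hyp_measure_nn_integral:
  assumes [measurable]: "f \<in> borel_measurable borel"
  shows "(\<integral>\<^sup>+z. f z \<partial>hyp_measure) = (\<integral>\<^sup>+z. ennreal (indicator {z. Im z > 0} z / (Im z)\<^sup>2) * f z \<partial>lborel)"
  unfolding hyp_measure_def by (subst nn_integral_density) auto

text \<open>
  The derivative of a Moebius transformation is \<open>(c z + d)^(-2)\<close>, and \<open>Im\<close> is multiplied by
  \<open>\<bar>c z + d\<bar>^(-2)\<close>; the two factors cancel in \<open>dx dy / y^2\<close>.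
\<close>
lemma hyp_measure_invariant:
  assumes g: "g \<in> modular_group"
  shows "distr hyp_measure borel (moebius_map g) = hyp_measure"
proof (rule measure_eqI)
  let ?H = "{z. Im z > 0}"
  obtain a b c d where abcd: "g = (a, b, c, d)" "a * d - b * c = 1" using g by (auto simp: modular_group_def)
  fix A assume "A \<in> sets (distr hyp_measure borel (moebius_map g))"
  hence A [measurable]: "A \<in> sets borel" by simp
  have img: "moebius_map g ` ?H = ?H"
  proof (intro equalityI subsetI)
    fix z assume "z \<in> ?H"
    hence "z = moebius_map g (moebius_map (mat_inv g) z)" "moebius_map (mat_inv g) z \<in> ?H" using g by auto
    thus "z \<in> moebius_map g ` ?H" by blast
  qed (use g in auto)
  have inj: "inj_on (moebius_map g) ?H"
    by (rule inj_on_inverseI[where g = "moebius_map (mat_inv g)"]) (use g in auto)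
  let ?u = "\<lambda>z. indicator A z / (Im z)\<^sup>2 :: real"
  let ?D = "\<lambda>z. 1 / (of_int c * z + of_int d)\<^sup>2 :: complex"
  have "emeasure hyp_measure A = (\<integral>\<^sup>+z. ennreal (indicator (moebius_map g ` ?H) z * ?u z) \<partial>lborel)"
    unfolding img hyp_measure_def
    by (subst emeasure_density) (auto intro!: nn_integral_cong simp: indicator_def)
  also have "\<dots> = (\<integral>\<^sup>+z. ennreal (indicator ?H z * ((norm (?D z))\<^sup>2 * ?u (moebius_map g z))) \<partial>lborel)"
    by (rule nn_integral_complex_change_of_variables[OF _ _ _ inj])
       (use img moebius_deriv[OF abcd] in \<open>auto\<close>)
  also have "\<dots> = (\<integral>\<^sup>+z. ennreal (indicator ?H z / (Im z)\<^sup>2) * indicator A (moebius_map g z) \<partial>lborel)"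
  proof (rule nn_integral_cong)
    fix z
    show "ennreal (indicator ?H z * ((norm (?D z))\<^sup>2 * ?u (moebius_map g z))) =
        ennreal (indicator ?H z / (Im z)\<^sup>2) * indicator A (moebius_map g z)"
    proof (cases "Im z > 0")
      case True
      have nz: "norm (of_int c * z + of_int d) > 0" using denominator_nonzero[OF True det_1_imp(1)[OF abcd(2)]] by simp
      have "Im (moebius_map g z) = Im z / (norm (of_int c * z + of_int d))\<^sup>2"
        unfolding abcd moebius_map_def using Im_moebius[OF abcd(2)] by simp
      hence "(norm (?D z))\<^sup>2 * (1 / (Im (moebius_map g z))\<^sup>2) = 1 / (Im z)\<^sup>2"
        using nz True by (simp add: norm_divide norm_power power_divide)
      hence "(norm (?D z))\<^sup>2 * ?u (moebius_map g z) = 1 / (Im z)\<^sup>2 * indicator A (moebius_map g z)"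
        by (simp add: indicator_def)
      thus ?thesis using True by (auto simp: indicator_def)
    qed auto
  qed
  also have "\<dots> = (\<integral>\<^sup>+z. indicator A (moebius_map g z) \<partial>hyp_measure)"
    by (rule hyp_measure_nn_integral[symmetric]) measurable
  also have "\<dots> = emeasure (distr hyp_measure borel (moebius_map g)) A"
    by (subst nn_integral_indicator[symmetric], simp, subst nn_integral_distr) auto
  finally show "emeasure (distr hyp_measure borel (moebius_map g)) A = emeasure hyp_measure A" by simp
qed simp

section \<open>The fundamental domain\<close>

text \<open>
  On the open fundamental domain each orbit is met at most once; the boundary is a null set.
\<close>
definition interior_domain :: "complex set" where
  "interior_domain = {z. Im z > 0 \<and> \<bar>Re z\<bar> < 1 / 2 \<and> cmod z > 1}"

lemma interior_domain_subset: "interior_domain \<subseteq> fundamental_domain"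
  by (auto simp: interior_domain_def fundamental_domain_def)

lemma measurable_fundamental_domain [measurable]: "fundamental_domain \<in> sets borel"
  unfolding fundamental_domain_def by measurable

lemma measurable_interior_domain [measurable]: "interior_domain \<in> sets borel"
  unfolding interior_domain_def by measurable

text \<open>
  With \<open>\<bar>Re z\<bar> \<le> 1/2\<close> and \<open>\<bar>z\<bar> \<ge> 1\<close> the form \<open>\<bar>c z + d\<bar>^2\<close> dominates \<open>c^2 - \<bar>c d\<bar> + d^2\<close>, which is
  at least \<open>1\<close> on nonzero integral vectors.
\<close>
lemma norm_denominator_lower_bound:
  assumes "z \<in> fundamental_domain"
  shows "(real_of_int c)\<^sup>2 - \<bar>real_of_int c * real_of_int d\<bar> + (real_of_int d)\<^sup>2 + (real_of_int c)\<^sup>2 * ((cmod z)\<^sup>2 - 1) \<le> (norm (of_int c * z + of_int d))\<^sup>2"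
proof -
  have z: "\<bar>Re z\<bar> \<le> 1 / 2" using assms by (auto simp: fundamental_domain_def)
  have "(norm (of_int c * z + of_int d))\<^sup>2 = (real_of_int c)\<^sup>2 * (cmod z)\<^sup>2 + 2 * (real_of_int c * real_of_int d) * Re z + (real_of_int d)\<^sup>2"
    unfolding cmod_power2 by (simp add: power2_eq_square algebra_simps)
  moreover have "- \<bar>real_of_int c * real_of_int d\<bar> \<le> 2 * (real_of_int c * real_of_int d) * Re z"
  proof -
    have "\<bar>2 * (real_of_int c * real_of_int d) * Re z\<bar> = 2 * \<bar>real_of_int c * real_of_int d\<bar> * \<bar>Re z\<bar>"
      by (simp add: abs_mult)
    also have "\<dots> \<le> 2 * \<bar>real_of_int c * real_of_int d\<bar> * (1 / 2)" using z by (intro mult_left_mono) auto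
    finally show ?thesis by linarith
  qed
  ultimately show ?thesis by (simp add: algebra_simps)
qed

lemma norm_denominator_half:
  assumes "z \<in> fundamental_domain"
  shows "1 / 2 * ((real_of_int c)\<^sup>2 + (real_of_int d)\<^sup>2) \<le> (norm (of_int c * z + of_int d))\<^sup>2"
proof -
  have "cmod z \<ge> 1" using assms by (auto simp: fundamental_domain_def)
  hence "(cmod z)\<^sup>2 - 1 \<ge> 0" by (simp add: one_le_power)
  hence 1: "(real_of_int c)\<^sup>2 * ((cmod z)\<^sup>2 - 1) \<ge> 0" by (intro mult_nonneg_nonneg) auto
  have "0 \<le> (\<bar>real_of_int c\<bar> - \<bar>real_of_int d\<bar>)\<^sup>2" by simp
  hence "2 * \<bar>real_of_int c * real_of_int d\<bar> \<le> (real_of_int c)\<^sup>2 + (real_of_int d)\<^sup>2"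
    by (simp add: power2_diff abs_mult)
  have "1 / 2 * (C + D) \<le> N" if "C - A + D + E \<le> N" "0 \<le> E" "2 * A \<le> C + D" for A C D E N :: real
    using that by (simp add: field_simps)
  from this[OF norm_denominator_lower_bound[OF assms] 1 \<open>2 * \<bar>real_of_int c * real_of_int d\<bar> \<le> _\<close>]
  show ?thesis .
qed

lemma norm_denominator_gt_1:
  assumes z: "z \<in> interior_domain" and c: "c \<noteq> 0"
  shows "(norm (of_int c * z + of_int d))\<^sup>2 > 1"
proof -
  have zF: "z \<in> fundamental_domain" using z interior_domain_subset by blast
  have "cmod z > 1" using z by (auto simp: interior_domain_def)
  hence "(cmod z)\<^sup>2 > 1" by (simp add: one_less_power)
  hence 1: "(real_of_int c)\<^sup>2 * ((cmod z)\<^sup>2 - 1) > 0" using c by (intro mult_pos_pos) auto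
  have "c\<^sup>2 - \<bar>c * d\<bar> + d\<^sup>2 \<ge> 1"
  proof -
    have "2 * (c\<^sup>2 - \<bar>c * d\<bar> + d\<^sup>2) = c\<^sup>2 + d\<^sup>2 + (\<bar>c\<bar> - \<bar>d\<bar>)\<^sup>2"
      by (simp add: power2_diff abs_mult)
    moreover have "c\<^sup>2 > 0" using c by simp
    moreover have "d\<^sup>2 \<ge> 0" "(\<bar>c\<bar> - \<bar>d\<bar>)\<^sup>2 \<ge> 0" by auto
    moreover have "1 \<le> X" if "2 * X = C + D + E" "0 < C" "0 \<le> D" "0 \<le> E" for X C D E :: int
      using that by linarith
    ultimately show ?thesis by blast
  qed
  hence "real_of_int (c\<^sup>2 - \<bar>c * d\<bar> + d\<^sup>2) \<ge> 1" by (simp only: of_int_1_le_iff)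
  hence "(real_of_int c)\<^sup>2 - \<bar>real_of_int c * real_of_int d\<bar> + (real_of_int d)\<^sup>2 \<ge> 1" by simp
  moreover have "N > 1" if "S \<ge> 1" "E > 0" "S + E \<le> N" for N S E :: real using that by linarith
  ultimately show ?thesis using 1 norm_denominator_lower_bound[OF zF, of c d] by blast
qed

lemma Im_moebius_map:
  assumes "(a, b, c, d) \<in> modular_group"
  shows "Im (moebius_map (a, b, c, d) z) = Im z / (norm (of_int c * z + of_int d))\<^sup>2"
  using assms Im_moebius[of a d b c z] by (simp add: modular_group_def moebius_map_def)

text \<open>
  If \<open>c \<noteq> 0\<close>, then \<open>g\<close> strictly decreases \<open>Im\<close> on the open domain, and so does its inverse, which
  is absurd; so \<open>g\<close> is a translation up to sign, and the width of the domain leaves only the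
  trivial one.
\<close>
lemma interior_domain_unique:
  assumes g: "g \<in> modular_group" and z: "z \<in> interior_domain" and gz: "moebius_map g z \<in> interior_domain"
  shows "g = (1, 0, 0, 1) \<or> g = (-1, 0, 0, -1)"
proof -
  obtain a b c d where abcd: "g = (a, b, c, d)" "a * d - b * c = 1" using g by (auto simp: modular_group_def)
  have decr: "Im (moebius_map (a, b, c, d) z) < Im z" if "(a, b, c, d) \<in> modular_group" "z \<in> interior_domain" "c \<noteq> 0" for a b c d z
  proof -
    have "Im z > 0" using that by (auto simp: interior_domain_def)
    moreover have "(norm (of_int c * z + of_int d))\<^sup>2 > 1" by (rule norm_denominator_gt_1[OF that(2,3)])
    ultimately have "Im z / (norm (of_int c * z + of_int d))\<^sup>2 < Im z / 1"
      by (intro divide_strict_left_mono) auto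
    thus ?thesis using Im_moebius_map[OF that(1)] by simp
  qed
  have z0: "Im z > 0" using z by (auto simp: interior_domain_def)
  have c: "c = 0"
  proof (rule ccontr)
    assume c: "c \<noteq> 0"
    have "Im (moebius_map g z) < Im z" unfolding abcd by (rule decr) (use g z c abcd in auto)
    moreover have "Im (moebius_map (mat_inv g) (moebius_map g z)) < Im (moebius_map g z)"
      unfolding abcd(1) mat_inv_def prod.case
      by (rule decr) (use gz c abcd in \<open>auto simp: modular_group_def algebra_simps\<close>)
    ultimately show False using g z0 by simp
  qed
  hence "a * d = 1" using abcd by simp
  hence ad: "(a = 1 \<and> d = 1) \<or> (a = -1 \<and> d = -1)" by (simp add: zmult_eq_1_iff)
  have "moebius_map g z = z + of_int (a * b)"
    using ad c by (auto simp: abcd moebius_map_def)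
  hence "\<bar>Re z + real_of_int (a * b)\<bar> < 1 / 2" "\<bar>Re z\<bar> < 1 / 2" using gz z by (auto simp: interior_domain_def)
  hence "\<bar>real_of_int (a * b)\<bar> < 1" by linarith
  hence "a * b = 0" by linarith
  thus ?thesis using ad c abcd by auto
qed

lemma moebius_translate:
  assumes det: "a * d - b * c = 1" and z: "Im z > 0"
  shows "moebius_map (a + n * c, b + n * d, c, d) z = moebius_map (a, b, c, d) z + of_int n"
proof -
  have nz: "of_int c * z + of_int d \<noteq> 0" by (rule denominator_nonzero[OF z det_1_imp(1)[OF det]])
  have num: "of_int (a + n * c) * z + of_int (b + n * d) = (of_int a * z + of_int b) + of_int n * (of_int c * z + of_int d)"
    by (simp add: algebra_simps)
  have frac: "(x + y * w) / w = x / w + y" if "w \<noteq> 0" for x y w :: complex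
    using that by (simp add: add_divide_distrib)
  show ?thesis unfolding moebius_map_def prod.case num by (rule frac[OF nz])
qed

text \<open>
  Among the second rows \<open>(c, d)\<close> choose one with \<open>\<bar>c z + d\<bar>\<close> minimal, that is, a point of the
  orbit with maximal \<open>Im\<close>, and translate it into the strip \<open>\<bar>Re\<bar> \<le> 1/2\<close>. The inversion cannot
  increase \<open>Im\<close> further, which says that the point has modulus at least \<open>1\<close>.
\<close>
lemma reduction_to_domain:
  assumes z: "Im z > 0"
  shows "\<exists>g\<in>modular_group. moebius_map g z \<in> fundamental_domain"
proof -
  obtain \<delta> where \<delta>: "0 < \<delta>" "\<delta> \<le> 1" "\<And>c d :: real. \<delta> * (c\<^sup>2 + d\<^sup>2) \<le> (norm (of_real c * z + of_real d))\<^sup>2"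
    using norm_lattice_lower_bound[OF z] by blast
  define N where "N = (\<lambda>(c, d). (norm (of_int c * z + of_int d))\<^sup>2)"
  \<comment> \<open>Only finitely many rows have modulus at most 1, and (0, 1) is one of them.\<close>
  define T where "T = {p \<in> coprime_pairs. N p \<le> 1}"
  have "finite T"
  proof (rule finite_subset)
    define B where "B = \<lceil>1 / \<delta>\<rceil>"
    show "T \<subseteq> {-B..B} \<times> {-B..B}"
    proof
      fix p assume "p \<in> T"
      obtain c d where p1: "p = (c, d)" by (cases p)
      have p2: "(norm (of_int c * z + of_int d))\<^sup>2 \<le> 1"
        using \<open>p \<in> T\<close> by (simp add: T_def N_def p1)
      have "\<delta> * ((real_of_int c)\<^sup>2 + (real_of_int d)\<^sup>2) \<le> 1" using \<delta>(3)[of c d] p2 by simp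
      hence "real_of_int (c\<^sup>2 + d\<^sup>2) \<le> 1 / \<delta>" using \<delta>(1) by (simp add: pos_le_divide_eq mult.commute)
      also have "\<dots> \<le> real_of_int B" unfolding B_def by (rule le_of_int_ceiling)
      finally have le: "c\<^sup>2 + d\<^sup>2 \<le> B" by (simp only: of_int_le_iff)
      have sq: "\<bar>c\<bar> \<le> c\<^sup>2" for c :: int
      proof (cases "c = 0")
        case False
        hence "\<bar>c\<bar> \<le> \<bar>c\<bar>\<^sup>2" by (intro self_le_power) auto
        thus ?thesis by simp
      qed simp
      have "c\<^sup>2 \<le> c\<^sup>2 + d\<^sup>2" "d\<^sup>2 \<le> c\<^sup>2 + d\<^sup>2" by simp_all
      hence "\<bar>c\<bar> \<le> B" "\<bar>d\<bar> \<le> B" using sq[of c] sq[of d] le by (meson order.trans)+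
      thus "p \<in> {-B..B} \<times> {-B..B}" unfolding p1 by (auto simp: abs_le_iff)
    qed
  qed auto
  moreover have T1: "(0, 1) \<in> T" by (simp add: T_def N_def coprime_pairs_def)
  ultimately obtain p where p: "p \<in> T" "\<And>q. q \<in> T \<Longrightarrow> N p \<le> N q"
    by (metis arg_min_if_finite(1) arg_min_least empty_iff)
  have pmin: "N p \<le> N q" if "q \<in> coprime_pairs" for q
  proof (cases "N q \<le> 1")
    case True thus ?thesis using p(2)[of q] that by (simp add: T_def)
  next
    case False thus ?thesis using p(1) by (simp add: T_def)
  qed
  obtain c d where cd: "p = (c, d)" by (cases p)
  have cop: "coprime c d" using p(1) by (simp add: T_def coprime_pairs_def cd)
  obtain a b where ab: "a * d - b * c = 1" using bezout_pair_det[OF cop] by blast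
  define w0 where "w0 = moebius_map (a, b, c, d) z"
  define n where "n = - round (Re w0)"
  define g where "g = (a + n * c, b + n * d, c, d)"
  have g: "g \<in> modular_group" using ab by (simp add: g_def modular_group_def algebra_simps)
  have nz: "of_int c * z + of_int d \<noteq> 0" by (rule denominator_nonzero[OF z det_1_imp(1)[OF ab]])
  define w where "w = moebius_map g z"
  have w: "w = w0 + of_int n"
    unfolding w_def w0_def g_def by (rule moebius_translate[OF ab z])
  have Imw: "Im w > 0" unfolding w_def using g z by simp
  have Rew: "\<bar>Re w\<bar> \<le> 1 / 2"
    using of_int_round_abs_le[of "Re w0"] by (simp add: w n_def abs_minus_commute)
  define s :: mat2 where "s = (0, -1, 1, 0)"
  have s: "s \<in> modular_group" by (simp add: s_def modular_group_def)
  have sg: "mat_mult s g = (- c, - d, a + n * c, b + n * d)" by (simp add: s_def g_def mat_mult_def)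
  have sg_in: "mat_mult s g \<in> modular_group" by (rule mat_mult_in[OF s g])
  hence "coprime (a + n * c) (b + n * d)"
    unfolding sg by (intro det_1_imp(2)[of "-c" _ "-d"]) (simp add: modular_group_def)
  hence "N p \<le> N (a + n * c, b + n * d)" by (intro pmin) (simp add: coprime_pairs_def)
  moreover have "N p > 0" using nz by (simp add: N_def cd)
  ultimately have "Im z / N (a + n * c, b + n * d) \<le> Im z / N p"
    using z by (intro divide_left_mono mult_pos_pos) auto
  moreover have "Im (moebius_map (mat_mult s g) z) = Im z / N (a + n * c, b + n * d)"
    using Im_moebius_map[OF sg_in[unfolded sg]] unfolding sg by (simp add: N_def)
  moreover have "Im w = Im z / N p"
    using Im_moebius_map[OF g[unfolded g_def]] unfolding w_def g_def by (simp add: N_def cd)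
  moreover have "Im (moebius_map (mat_mult s g) z) = Im w / (norm w)\<^sup>2"
    using moebius_mult[OF s g z] Im_moebius_map[of 0 "-1" 1 0 w] s unfolding s_def w_def by simp
  ultimately have le: "Im w / (norm w)\<^sup>2 \<le> Im w" by metis
  have w0': "norm w > 0" using Imw by auto
  have "(norm w)\<^sup>2 > 0" using w0' by simp
  hence "Im w * 1 \<le> Im w * (norm w)\<^sup>2" using le by (simp only: pos_divide_le_eq mult_1_right)
  hence "(norm w)\<^sup>2 \<ge> 1" using Imw by (simp only: mult_le_cancel_left_pos)
  hence "norm w \<ge> 1" using w0' power2_le_imp_le[of 1 "norm w"] by simp
  hence "w \<in> fundamental_domain" using Imw Rew by (simp add: fundamental_domain_def)
  thus ?thesis using g by (auto simp: w_def)
qed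

lemma boundary_null: "fundamental_domain - interior_domain \<in> null_sets lborel"
proof -
  have "fundamental_domain - interior_domain \<subseteq> ({z. 1 \<bullet> z = 1 / 2} \<union> {z. 1 \<bullet> z = - 1 / 2}) \<union> sphere 0 1"
    by (auto simp: fundamental_domain_def interior_domain_def abs_if split: if_splits)
  moreover have "negligible (({z::complex. 1 \<bullet> z = 1 / 2} \<union> {z. 1 \<bullet> z = - 1 / 2}) \<union> sphere 0 1)"
    by (intro negligible_Un negligible_hyperplane negligible_sphere) auto
  ultimately have "negligible (fundamental_domain - interior_domain)" by (rule negligible_subset[rotated])
  hence "fundamental_domain - interior_domain \<in> null_sets lebesgue" by (simp add: negligible_iff_null_sets)
  thus ?thesis by (subst (asm) null_sets_completion_iff) auto
qed

lemma AE_hyp_measure_iff: "(AE z in hyp_measure. P z) \<longleftrightarrow> (AE z in lborel. Im z > 0 \<longrightarrow> P z)"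
  unfolding hyp_measure_def
  by (subst AE_density) (auto intro!: AE_cong simp: indicator_def ennreal_zero_less_divide)

lemma AE_hyp_measure_Im: "AE z in hyp_measure. Im z > 0"
  unfolding AE_hyp_measure_iff by simp

lemma AE_translate_in_interior:
  "AE z in hyp_measure. \<exists>g\<in>modular_group. moebius_map g z \<in> interior_domain"
proof -
  let ?X = "fundamental_domain - interior_domain"
  have "AE z in hyp_measure. moebius_map g z \<notin> ?X" if g: "g \<in> modular_group" for g
  proof -
    have "AE z in lborel. z \<notin> ?X" by (rule AE_not_in[OF boundary_null])
    hence "AE z in hyp_measure. z \<notin> ?X" unfolding AE_hyp_measure_iff by auto
    hence "AE z in distr hyp_measure borel (moebius_map g). z \<notin> ?X" unfolding hyp_measure_invariant[OF g] .
    thus ?thesis by (subst (asm) AE_distr_iff) auto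
  qed
  hence "AE z in hyp_measure. \<forall>g\<in>modular_group. moebius_map g z \<notin> ?X"
    by (subst AE_ball_countable) auto
  with AE_hyp_measure_Im show ?thesis
    by eventually_elim (use reduction_to_domain in blast)
qed

definition mat_neg :: "mat2 \<Rightarrow> mat2" where
  "mat_neg = (\<lambda>(a, b, c, d). (- a, - b, - c, - d))"

lemma moebius_neg [simp]: "moebius_map (mat_neg g) z = moebius_map g z"
proof (cases g)
  case (fields a b c d)
  have "of_int (- x) * z + of_int (- y) = - (of_int x * z + of_int y)" for x y by simp
  thus ?thesis unfolding fields mat_neg_def moebius_map_def prod.case by (simp only: minus_divide_divide)
qed

lemma mat_neg_in [simp]: "g \<in> modular_group \<Longrightarrow> mat_neg g \<in> modular_group"
  by (auto simp: modular_group_def mat_neg_def)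

lemma mat_neg_inv: "mat_inv (mat_neg g) = mat_neg (mat_inv g)"
  by (cases g) (simp add: mat_inv_def mat_neg_def)

lemma mat_neg_neq: "g \<in> modular_group \<Longrightarrow> mat_neg g \<noteq> g"
  by (auto simp: modular_group_def mat_neg_def)

lemma mat_mult_assoc: "mat_mult (mat_mult x y) z = mat_mult x (mat_mult y z)"
  by (cases x; cases y; cases z) (simp add: mat_mult_def algebra_simps)

lemma mat_mult_one [simp]: "mat_mult (1, 0, 0, 1) g = g" "mat_mult g (1, 0, 0, 1) = g" "mat_mult g (-1, 0, 0, -1) = mat_neg g"
  by (cases g; simp add: mat_mult_def mat_neg_def)+

text \<open>
  The two matrices differ by the sign, which acts trivially.
\<close>
lemma two_translates:
  assumes z: "Im z > 0" and g0: "g0 \<in> modular_group" "moebius_map g0 z \<in> interior_domain"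
  shows "{g \<in> modular_group. moebius_map (mat_inv g) z \<in> interior_domain} = {mat_inv g0, mat_neg (mat_inv g0)}"
proof (intro equalityI subsetI)
  fix g assume "g \<in> {g \<in> modular_group. moebius_map (mat_inv g) z \<in> interior_domain}"
  hence g: "g \<in> modular_group" "moebius_map (mat_inv g) z \<in> interior_domain" by auto
  let ?h = "mat_mult (mat_inv g) (mat_inv g0)"
  have "moebius_map ?h (moebius_map g0 z) = moebius_map (mat_inv g) z"
    using g g0 z by (subst moebius_mult) auto
  hence "?h = (1, 0, 0, 1) \<or> ?h = (-1, 0, 0, -1)"
    using g g0 by (intro interior_domain_unique[OF _ g0(2)]) (auto intro: mat_mult_in)
  moreover have "mat_inv g0 = mat_mult g ?h"
    using g by (simp add: mat_mult_assoc[symmetric] mat_mult_inv)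
  moreover have "mat_neg (mat_neg g) = g" by (cases g) (simp add: mat_neg_def)
  ultimately show "g \<in> {mat_inv g0, mat_neg (mat_inv g0)}" by auto
qed (use g0 in \<open>auto simp: mat_neg_inv\<close>)

lemma count_translates:
  assumes z: "Im z > 0" and g0: "g0 \<in> modular_group" "moebius_map g0 z \<in> interior_domain"
  shows "(\<integral>\<^sup>+g. indicator interior_domain (moebius_map (mat_inv g) z) \<partial>count_space modular_group) = 2"
proof -
  let ?A = "{g \<in> modular_group. moebius_map (mat_inv g) z \<in> interior_domain}"
  have "(\<integral>\<^sup>+g. indicator interior_domain (moebius_map (mat_inv g) z) \<partial>count_space modular_group) =
      (\<integral>\<^sup>+g. indicator ?A g \<partial>count_space modular_group)"
    by (intro nn_integral_cong) (auto simp: indicator_def)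
  also have "\<dots> = emeasure (count_space modular_group) ?A" by (rule nn_integral_indicator) auto
  also have "\<dots> = 2"
    unfolding two_translates[OF assms] using g0 mat_neg_neq[of "mat_inv g0"]
    by (subst emeasure_count_space) auto
  finally show ?thesis .
qed

definition domain_measure :: "complex measure" where
  "domain_measure = density hyp_measure (indicator interior_domain)"

lemma sets_domain_measure [simp, measurable_cong]: "sets domain_measure = sets borel"
  and space_domain_measure [simp]: "space domain_measure = UNIV"
  by (auto simp: domain_measure_def)

lemma sigma_finite_hyp_measure: "sigma_finite_measure hyp_measure"
  unfolding hyp_measure_def
  by (subst sigma_finite_measure.sigma_finite_iff_density_finite[OF sigma_finite_lborel]) auto

lemma sigma_finite_domain_measure: "sigma_finite_measure domain_measure"
  unfolding domain_measure_def
  by (subst sigma_finite_measure.sigma_finite_iff_density_finite[OF sigma_finite_hyp_measure]) (auto simp: indicator_def)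

lemma sigma_finite_modular_count: "sigma_finite_measure (count_space modular_group)"
  by (rule sigma_finite_measure_count_space_countable) simp

lemma measurable_action [measurable]:
  "(\<lambda>(g, z). moebius_map g z) \<in> borel_measurable (count_space modular_group \<Otimes>\<^sub>M domain_measure)"
  by (rule measurable_pair_measure_countable1) auto

text \<open>
  Unfolding as an identity of measures: the translates of the fundamental domain under the modular
  group cover the upper half-plane exactly twice, up to a null set, because \<open>\<plusminus>g\<close> act alike.
\<close>
lemma unfolding_measure:
  "distr (count_space modular_group \<Otimes>\<^sub>M domain_measure) borel (\<lambda>(g, z). moebius_map g z) = density hyp_measure (\<lambda>_. 2)"
proof (rule measure_eqI)
  interpret hm: sigma_finite_measure hyp_measure by (rule sigma_finite_hyp_measure)
  interpret dm: sigma_finite_measure domain_measure by (rule sigma_finite_domain_measure)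
  interpret cm: sigma_finite_measure "count_space modular_group" by (rule sigma_finite_modular_count)
  interpret P: pair_sigma_finite "count_space modular_group" hyp_measure ..
  fix A assume "A \<in> sets (distr (count_space modular_group \<Otimes>\<^sub>M domain_measure) borel (\<lambda>(g, z). moebius_map g z))"
  hence A [measurable]: "A \<in> sets borel" by simp
  have "emeasure (distr (count_space modular_group \<Otimes>\<^sub>M domain_measure) borel (\<lambda>(g, z). moebius_map g z)) A =
    (\<integral>\<^sup>+p. indicator A ((\<lambda>(g, z). moebius_map g z) p) \<partial>(count_space modular_group \<Otimes>\<^sub>M domain_measure))"
    by (subst nn_integral_indicator[symmetric], simp, subst nn_integral_distr) auto
  also have "\<dots> = (\<integral>\<^sup>+g. \<integral>\<^sup>+z. indicator A (moebius_map g z) \<partial>domain_measure \<partial>count_space modular_group)"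
    by (subst dm.nn_integral_fst[symmetric]) auto
  also have "\<dots> = (\<integral>\<^sup>+g. \<integral>\<^sup>+z. indicator interior_domain (moebius_map (mat_inv g) z) * indicator A z \<partial>hyp_measure \<partial>count_space modular_group)"
  proof (rule nn_integral_cong)
    fix g assume "g \<in> space (count_space modular_group)"
    hence g: "g \<in> modular_group" by simp
    have "(\<integral>\<^sup>+z. indicator interior_domain (moebius_map (mat_inv g) z) * indicator A z \<partial>hyp_measure) =
        (\<integral>\<^sup>+z. indicator interior_domain (moebius_map (mat_inv g) z) * indicator A z \<partial>distr hyp_measure borel (moebius_map g))"
      unfolding hyp_measure_invariant[OF g] ..
    also have "\<dots> = (\<integral>\<^sup>+z. indicator interior_domain (moebius_map (mat_inv g) (moebius_map g z)) * indicator A (moebius_map g z) \<partial>hyp_measure)"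
      by (subst nn_integral_distr) auto
    also have "\<dots> = (\<integral>\<^sup>+z. indicator interior_domain z * indicator A (moebius_map g z) \<partial>hyp_measure)"
      by (rule nn_integral_cong_AE) (use AE_hyp_measure_Im in eventually_elim, use g in simp)
    also have "\<dots> = (\<integral>\<^sup>+z. indicator A (moebius_map g z) \<partial>domain_measure)"
      unfolding domain_measure_def by (subst nn_integral_density) auto
    finally show "(\<integral>\<^sup>+z. indicator A (moebius_map g z) \<partial>domain_measure) =
      (\<integral>\<^sup>+z. indicator interior_domain (moebius_map (mat_inv g) z) * indicator A z \<partial>hyp_measure)" ..
  qed
  also have "\<dots> = (\<integral>\<^sup>+z. \<integral>\<^sup>+g. indicator interior_domain (moebius_map (mat_inv g) z) * indicator A z \<partial>count_space modular_group \<partial>hyp_measure)"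
  proof -
    have "(\<lambda>(g, z). indicator interior_domain (moebius_map (mat_inv g) z) * indicator A z :: ennreal)
        \<in> borel_measurable (count_space modular_group \<Otimes>\<^sub>M hyp_measure)"
      by (rule measurable_pair_measure_countable1) auto
    from P.Fubini'[OF this] show ?thesis by simp
  qed
  also have "\<dots> = (\<integral>\<^sup>+z. 2 * indicator A z \<partial>hyp_measure)"
  proof (rule nn_integral_cong_AE)
    show "AE z in hyp_measure. (\<integral>\<^sup>+g. indicator interior_domain (moebius_map (mat_inv g) z) * indicator A z \<partial>count_space modular_group) = 2 * indicator A z"
      using AE_hyp_measure_Im AE_translate_in_interior
      by eventually_elim (auto simp: nn_integral_multc count_translates)
  qed
  also have "\<dots> = emeasure (density hyp_measure (\<lambda>_. 2)) A"
    by (subst emeasure_density) auto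
  finally show "emeasure (distr (count_space modular_group \<Otimes>\<^sub>M domain_measure) borel (\<lambda>(g, z). moebius_map g z)) A =
    emeasure (density hyp_measure (\<lambda>_. 2)) A" .
qed simp

section \<open>Unfolding\<close>

definition unit_strip :: "complex set" where
  "unit_strip = {z. 0 \<le> Re z \<and> Re z < 1}"

lemma measurable_unit_strip [measurable]: "unit_strip \<in> sets borel"
  unfolding unit_strip_def by measurable

definition row_matrix :: "int \<times> int \<Rightarrow> mat2" where
  "row_matrix = (\<lambda>(c, d). (fst (bezout_pair c d), snd (bezout_pair c d), c, d))"

text \<open>
  The matrix with second row \<open>(c, d)\<close> that moves \<open>z\<close> into the strip \<open>0 \<le> Re < 1\<close>; the translation
  is forced, so these are exactly the matrices that move \<open>z\<close> into the strip.
\<close>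
definition strip_matrix :: "complex \<Rightarrow> int \<times> int \<Rightarrow> mat2" where
  "strip_matrix z = (\<lambda>(c, d). let n = - \<lfloor>Re (moebius_map (row_matrix (c, d)) z)\<rfloor>
     in (fst (bezout_pair c d) + n * c, snd (bezout_pair c d) + n * d, c, d))"

lemma row_matrix_in: "p \<in> coprime_pairs \<Longrightarrow> row_matrix p \<in> modular_group"
  using bezout_pair_det by (auto simp: row_matrix_def coprime_pairs_def modular_group_def)

lemma strip_matrix_props:
  assumes p: "p \<in> coprime_pairs" and z: "Im z > 0"
  shows "strip_matrix z p \<in> modular_group"
    and "moebius_map (strip_matrix z p) z = moebius_map (row_matrix p) z + of_int (- \<lfloor>Re (moebius_map (row_matrix p) z)\<rfloor>)"
    and "moebius_map (strip_matrix z p) z \<in> unit_strip"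
proof -
  obtain c d where cd: "p = (c, d)" by (cases p)
  define a b where "a = fst (bezout_pair c d)" and "b = snd (bezout_pair c d)"
  have det: "a * d - b * c = 1" using p bezout_pair_det by (auto simp: coprime_pairs_def a_def b_def cd)
  define n where "n = - \<lfloor>Re (moebius_map (row_matrix p) z)\<rfloor>"
  have sm: "strip_matrix z p = (a + n * c, b + n * d, c, d)"
    by (simp add: strip_matrix_def cd a_def b_def n_def Let_def)
  have rm: "row_matrix p = (a, b, c, d)" by (simp add: row_matrix_def cd a_def b_def)
  show "strip_matrix z p \<in> modular_group" using det by (simp add: sm modular_group_def algebra_simps)
  have *: "moebius_map (strip_matrix z p) z = moebius_map (row_matrix p) z + of_int n"
    unfolding sm rm by (rule moebius_translate[OF det z])
  show "moebius_map (strip_matrix z p) z = moebius_map (row_matrix p) z + of_int (- \<lfloor>Re (moebius_map (row_matrix p) z)\<rfloor>)"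
    unfolding * n_def ..
  show "moebius_map (strip_matrix z p) z \<in> unit_strip"
    unfolding * unit_strip_def n_def by (simp, linarith)
qed

lemma strip_matrix_inj: "inj_on (strip_matrix z) A"
  by (auto simp: inj_on_def strip_matrix_def Let_def)

lemma strip_matrix_surj:
  assumes g: "g \<in> modular_group" and z: "Im z > 0" and s: "moebius_map g z \<in> unit_strip"
  shows "g \<in> strip_matrix z ` coprime_pairs"
proof -
  obtain a' b' c d where abcd: "g = (a', b', c, d)" "a' * d - b' * c = 1" using g by (auto simp: modular_group_def)
  have p: "(c, d) \<in> coprime_pairs" using det_1_imp(2)[OF abcd(2)] by (simp add: coprime_pairs_def)
  define a b where "a = fst (bezout_pair c d)" and "b = snd (bezout_pair c d)"
  have det: "a * d - b * c = 1" using p bezout_pair_det by (auto simp: coprime_pairs_def a_def b_def)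
  define t where "t = a * b' - a' * b"
  have "moebius_map g z = moebius_map (row_matrix (c, d)) z + of_int t"
    using same_row_translate[OF det abcd(2) z]
    by (simp add: abcd moebius_map_def row_matrix_def a_def b_def t_def)
  hence "0 \<le> Re (moebius_map (row_matrix (c, d)) z) + of_int t" "Re (moebius_map (row_matrix (c, d)) z) + of_int t < 1"
    using s by (auto simp: unit_strip_def)
  hence t: "t = - \<lfloor>Re (moebius_map (row_matrix (c, d)) z)\<rfloor>" by linarith
  have shift: "a' = a + t * c" "b' = b + t * d"
    using same_row_shift[OF det abcd(2)] by (simp_all add: t_def)
  have "g = strip_matrix z (c, d)"
    unfolding strip_matrix_def prod.case Let_def t[symmetric] abcd shift by (simp add: a_def b_def)
  thus ?thesis using p by blast
qed

text \<open>
  A sum over cosets of the translations is rewritten as a sum over the whole group, restricted to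
  the matrices that map \<open>z\<close> into the unit strip.
\<close>
lemma row_sum_to_group_sum:
  fixes \<Phi> :: "complex \<Rightarrow> 'a :: banach"
  assumes z: "Im z > 0" and per: "\<forall>w m. Im w > 0 \<longrightarrow> \<Phi> (w + of_int m) = \<Phi> w"
    and sm: "(\<lambda>p. norm (\<Phi> (moebius_map (row_matrix p) z))) summable_on coprime_pairs"
  shows "(\<lambda>g. norm (indicator unit_strip (moebius_map g z) *\<^sub>R \<Phi> (moebius_map g z))) summable_on modular_group"
    and "(\<Sum>\<^sub>\<infinity>g\<in>modular_group. indicator unit_strip (moebius_map g z) *\<^sub>R \<Phi> (moebius_map g z)) =
      (\<Sum>\<^sub>\<infinity>p\<in>coprime_pairs. \<Phi> (moebius_map (row_matrix p) z))"
    and "(\<Sum>\<^sub>\<infinity>g\<in>modular_group. norm (indicator unit_strip (moebius_map g z) *\<^sub>R \<Phi> (moebius_map g z))) =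
      (\<Sum>\<^sub>\<infinity>p\<in>coprime_pairs. norm (\<Phi> (moebius_map (row_matrix p) z)))"
proof -
  let ?u = "\<lambda>g. indicator unit_strip (moebius_map g z) *\<^sub>R \<Phi> (moebius_map g z)"
  let ?B = "strip_matrix z ` coprime_pairs"
  have sub: "?B \<subseteq> modular_group" using strip_matrix_props(1)[OF _ z] by auto
  have zero: "?u g = 0" if "g \<in> modular_group - ?B" for g
  proof -
    have "moebius_map g z \<notin> unit_strip" using strip_matrix_surj[of g z] that z by auto
    thus ?thesis by simp
  qed
  have val: "?u (strip_matrix z p) = \<Phi> (moebius_map (row_matrix p) z)" if "p \<in> coprime_pairs" for p
  proof -
    have "\<Phi> (moebius_map (strip_matrix z p) z) = \<Phi> (moebius_map (row_matrix p) z)"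
      unfolding strip_matrix_props(2)[OF that z] using row_matrix_in[OF that] z by (intro per[rule_format]) simp
    thus ?thesis using strip_matrix_props(3)[OF that z] by simp
  qed
  have "(\<lambda>g. norm (?u g)) summable_on ?B"
    unfolding summable_on_reindex[OF strip_matrix_inj] o_def
    using sm by (rule summable_on_cong[THEN iffD1, rotated]) (simp only: val)
  thus "(\<lambda>g. norm (?u g)) summable_on modular_group"
    by (rule summable_on_cong_neutral[THEN iffD1, rotated -1]) (use sub zero in auto)
  have "infsum ?u modular_group = infsum ?u ?B"
    by (rule infsum_cong_neutral) (use sub zero in auto)
  also have "\<dots> = infsum (?u \<circ> strip_matrix z) coprime_pairs"
    by (rule infsum_reindex[OF strip_matrix_inj])
  also have "\<dots> = (\<Sum>\<^sub>\<infinity>p\<in>coprime_pairs. \<Phi> (moebius_map (row_matrix p) z))"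
    by (rule infsum_cong) (use val in simp)
  finally show "infsum ?u modular_group = (\<Sum>\<^sub>\<infinity>p\<in>coprime_pairs. \<Phi> (moebius_map (row_matrix p) z))" .
  have "infsum (\<lambda>g. norm (?u g)) modular_group = infsum (\<lambda>g. norm (?u g)) ?B"
    by (rule infsum_cong_neutral) (use sub zero in auto)
  also have "\<dots> = infsum ((\<lambda>g. norm (?u g)) \<circ> strip_matrix z) coprime_pairs"
    by (rule infsum_reindex[OF strip_matrix_inj])
  also have "\<dots> = (\<Sum>\<^sub>\<infinity>p\<in>coprime_pairs. norm (\<Phi> (moebius_map (row_matrix p) z)))"
    by (rule infsum_cong) (simp only: o_def val)
  finally show "infsum (\<lambda>g. norm (?u g)) modular_group = (\<Sum>\<^sub>\<infinity>p\<in>coprime_pairs. norm (\<Phi> (moebius_map (row_matrix p) z)))" .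
qed

lemma integral_count_space_infsum:
  fixes u :: "'b \<Rightarrow> 'a :: {banach, second_countable_topology}"
  assumes "(\<lambda>x. norm (u x)) summable_on A"
  shows "integrable (count_space A) u" and "(\<integral>x. u x \<partial>count_space A) = infsum u A"
    and "(\<integral>\<^sup>+x. norm (u x) \<partial>count_space A) = ennreal (infsum (\<lambda>x. norm (u x)) A)"
proof -
  have a: "Infinite_Set_Sum.abs_summable_on u A" using assms by (simp add: abs_summable_equivalent)
  thus i: "integrable (count_space A) u" by (simp add: Infinite_Set_Sum.abs_summable_on_def)
  show "(\<integral>x. u x \<partial>count_space A) = infsum u A"
    using infsetsum_infsum[OF a] by (simp add: infsetsum_def)
  have a': "Infinite_Set_Sum.abs_summable_on (\<lambda>x. norm (u x)) A" using assms by (simp add: abs_summable_equivalent[symmetric])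
  have "(\<integral>\<^sup>+x. norm (u x) \<partial>count_space A) = ennreal (\<integral>x. norm (u x) \<partial>count_space A)"
    using i by (intro nn_integral_eq_integral integrable_norm) auto
  also have "(\<integral>x. norm (u x) \<partial>count_space A) = infsum (\<lambda>x. norm (u x)) A"
    using infsetsum_infsum[OF a'] by (simp add: infsetsum_def)
  finally show "(\<integral>\<^sup>+x. norm (u x) \<partial>count_space A) = ennreal (infsum (\<lambda>x. norm (u x)) A)" .
qed

text \<open>
  The sum over the group and the integral over the fundamental domain combine to the integral over
  two copies of the half-plane by \<open>unfolding_measure\<close>, and the indicator of the strip restricts it
  to the unit strip. The majorant \<open>B\<close> supplies the absolute convergence for Fubini's theorem.
\<close>
theorem unfolding_integral:
  fixes \<Phi> :: "complex \<Rightarrow> complex"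
  assumes [measurable]: "\<Phi> \<in> borel_measurable borel"
    and per: "\<And>w m. Im w > 0 \<Longrightarrow> \<Phi> (w + of_int m) = \<Phi> w"
    and sm: "\<And>z. z \<in> interior_domain \<Longrightarrow> (\<lambda>p. norm (\<Phi> (moebius_map (row_matrix p) z))) summable_on coprime_pairs"
    and bd: "\<And>z. z \<in> interior_domain \<Longrightarrow> (\<Sum>\<^sub>\<infinity>p\<in>coprime_pairs. norm (\<Phi> (moebius_map (row_matrix p) z))) \<le> B z"
    and Q: "Q \<in> borel_measurable borel"
      "\<And>z. z \<in> interior_domain \<Longrightarrow> (\<Sum>\<^sub>\<infinity>p\<in>coprime_pairs. \<Phi> (moebius_map (row_matrix p) z)) = Q z"
    and B: "(\<integral>\<^sup>+z. ennreal (B z) \<partial>domain_measure) < \<infinity>"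
  shows "integrable hyp_measure (\<lambda>z. indicator unit_strip z *\<^sub>R \<Phi> z)"
    and "(\<integral>z. Q z \<partial>domain_measure) =
       2 * (\<integral>z. indicator unit_strip z *\<^sub>R \<Phi> z \<partial>hyp_measure)"
proof -
  have per': "\<forall>w m. Im w > 0 \<longrightarrow> \<Phi> (w + of_int m) = \<Phi> w" using per by blast
  interpret dm: sigma_finite_measure domain_measure by (rule sigma_finite_domain_measure)
  interpret cm: sigma_finite_measure "count_space modular_group" by (rule sigma_finite_modular_count)
  interpret P: pair_sigma_finite "count_space modular_group" domain_measure ..
  let ?h = "\<lambda>z. indicator unit_strip z *\<^sub>R \<Phi> z"
  let ?f = "\<lambda>(g, z). ?h (moebius_map g z)"
  let ?PM = "count_space modular_group \<Otimes>\<^sub>M domain_measure"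
  have fm [measurable]: "?f \<in> borel_measurable ?PM"
    by (rule measurable_pair_measure_countable1) auto
  have AEd: "AE z in domain_measure. z \<in> interior_domain"
    unfolding domain_measure_def by (subst AE_density) (auto simp: indicator_def)
  have imz: "Im z > 0" if "z \<in> interior_domain" for z using that by (auto simp: interior_domain_def)
  have int: "integrable ?PM ?f"
  proof (rule integrableI_bounded)
    have "(\<integral>\<^sup>+x. ennreal (norm (?f x)) \<partial>?PM) = (\<integral>\<^sup>+z. \<integral>\<^sup>+g. ennreal (norm (?f (g, z))) \<partial>count_space modular_group \<partial>domain_measure)"
      by (rule P.nn_integral_snd[symmetric]) measurable
    also have "\<dots> \<le> (\<integral>\<^sup>+z. ennreal (B z) \<partial>domain_measure)"
    proof (rule nn_integral_mono_AE)
      show "AE z in domain_measure. (\<integral>\<^sup>+g. ennreal (norm (?f (g, z))) \<partial>count_space modular_group) \<le> ennreal (B z)"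
        using AEd
      proof eventually_elim
        case (elim z)
        note r = row_sum_to_group_sum[OF imz[OF elim] per' sm[OF elim]]
        have "(\<integral>\<^sup>+g. ennreal (norm (?h (moebius_map g z))) \<partial>count_space modular_group) =
            ennreal (\<Sum>\<^sub>\<infinity>p\<in>coprime_pairs. norm (\<Phi> (moebius_map (row_matrix p) z)))"
          using integral_count_space_infsum(3)[OF r(1)] unfolding r(3) .
        also have "\<dots> \<le> ennreal (B z)" by (rule ennreal_leI[OF bd[OF elim]])
        finally show ?case by simp
      qed
    qed
    also note B
    finally show "(\<integral>\<^sup>+x. ennreal (norm (?f x)) \<partial>?PM) < \<infinity>" .
  qed (rule fm)
  have "?f = (\<lambda>p. ?h ((\<lambda>(g, z). moebius_map g z) p))" by (simp add: case_prod_unfold)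
  hence dist: "integrable (density hyp_measure (\<lambda>_. 2)) ?h" "(\<integral>z. ?h z \<partial>density hyp_measure (\<lambda>_. 2)) = (\<integral>p. ?f p \<partial>?PM)"
    unfolding unfolding_measure[symmetric] using int
    by (auto simp: integrable_distr_eq integral_distr)
  have two: "density hyp_measure (\<lambda>_. 2) = density hyp_measure (\<lambda>_. ennreal 2)" by simp
  show hi: "integrable hyp_measure ?h"
  proof -
    have "integrable hyp_measure (\<lambda>z. 2 *\<^sub>R ?h z)"
      using dist(1) unfolding two by (subst (asm) integrable_density) auto
    hence "integrable hyp_measure (\<lambda>z. (1/2::real) *\<^sub>R (2 *\<^sub>R ?h z))" by (rule integrable_scaleR_right)
    thus ?thesis by simp
  qed
  have "(\<integral>z. ?h z \<partial>density hyp_measure (\<lambda>_. 2)) = (\<integral>z. 2 *\<^sub>R ?h z \<partial>hyp_measure)"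
    unfolding two by (subst integral_density) auto
  also have "\<dots> = 2 * (\<integral>z. ?h z \<partial>hyp_measure)" by (simp add: scaleR_conv_of_real)
  finally have "2 * (\<integral>z. ?h z \<partial>hyp_measure) = (\<integral>p. ?f p \<partial>?PM)" using dist(2) by simp
  also have "\<dots> = (\<integral>z. \<integral>g. ?h (moebius_map g z) \<partial>count_space modular_group \<partial>domain_measure)"
    by (rule P.integral_snd[OF int, symmetric])
  also have "\<dots> = (\<integral>z. Q z \<partial>domain_measure)"
  proof (rule integral_cong_AE)
    show eq: "AE z in domain_measure. (\<integral>g. ?h (moebius_map g z) \<partial>count_space modular_group) = Q z"
      using AEd
    proof eventually_elim
      case (elim z)
      note r = row_sum_to_group_sum[OF imz[OF elim] per' sm[OF elim]]
      show ?case using integral_count_space_infsum(2)[OF r(1)] unfolding r(2) Q(2)[OF elim] .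
    qed
    show "(\<lambda>z. \<integral>g. ?h (moebius_map g z) \<partial>count_space modular_group) \<in> borel_measurable domain_measure"
      using borel_measurable_integrable[OF P.integrable_snd[OF int]] .
    show "Q \<in> borel_measurable domain_measure" using Q(1) by simp
  qed
  finally show "(\<integral>z. Q z \<partial>domain_measure) = 2 * (\<integral>z. ?h z \<partial>hyp_measure)" ..
qed

section \<open>Integrals over the domain and over the strip\<close>

lemma measurable_Complex [measurable]: "(\<lambda>(x, y). Complex x y) \<in> borel_measurable (lborel \<Otimes>\<^sub>M lborel)"
proof -
  have "(\<lambda>(x, y). of_real x + \<i> * of_real y) \<in> borel_measurable (lborel \<Otimes>\<^sub>M lborel)" by measurable
  thus ?thesis by (simp add: complex_eq[symmetric] Complex_eq)
qed

lemma lborel_complex_prod: "distr (lborel \<Otimes>\<^sub>M lborel) borel (\<lambda>(x, y). Complex x y) = lborel"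
proof (rule lborel_eqI[symmetric])
  fix l u :: complex assume le: "\<And>b. b \<in> Basis \<Longrightarrow> l \<bullet> b \<le> u \<bullet> b"
  have le': "Re l \<le> Re u" "Im l \<le> Im u" using le[of 1] le[of \<i>] by (auto simp: Basis_complex_def)
  have "(\<lambda>(x, y). Complex x y) -` box l u = {Re l<..<Re u} \<times> {Im l<..<Im u}"
    by (auto simp: in_box_complex_iff)
  hence "emeasure (distr (lborel \<Otimes>\<^sub>M lborel) borel (\<lambda>(x, y). Complex x y)) (box l u) =
      emeasure (lborel \<Otimes>\<^sub>M lborel) ({Re l<..<Re u} \<times> {Im l<..<Im u})"
    by (subst emeasure_distr) (auto simp: space_pair_measure)
  also have "\<dots> = ennreal (Re u - Re l) * ennreal (Im u - Im l)"
    using le' by (subst lborel.emeasure_pair_measure_Times) auto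
  also have "\<dots> = ennreal (\<Prod>b\<in>Basis. (u - l) \<bullet> b)"
    using le' by (simp add: Basis_complex_def ennreal_mult')
  finally show "emeasure (distr (lborel \<Otimes>\<^sub>M lborel) borel (\<lambda>(x, y). Complex x y)) (box l u) = ennreal (\<Prod>b\<in>Basis. (u - l) \<bullet> b)" .
qed simp

lemma nn_integral_exp_decay: "(\<integral>\<^sup>+y. ennreal (indicator {0..} y * exp (- y)) \<partial>lborel) = 1"
proof -
  have "(\<integral>\<^sup>+y. ennreal (exp (- y)) * indicator {0..} y \<partial>lborel) = ennreal (0 - (- exp (- 0)))"
  proof (rule nn_integral_FTC_atLeast)
    show "((\<lambda>y::real. - exp (- y)) \<longlongrightarrow> 0) at_top" by real_asymp
  qed (auto intro!: derivative_eq_intros)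
  moreover have "(\<integral>\<^sup>+y. ennreal (indicator {0..} y * exp (- y)) \<partial>lborel) =
      (\<integral>\<^sup>+y. ennreal (exp (- y)) * indicator {0..} y \<partial>lborel)"
    by (intro nn_integral_cong) (auto simp: indicator_def)
  ultimately show ?thesis by simp
qed

text \<open>
  The majorant for all integrals over the fundamental domain.
\<close>
lemma integrable_strip_decay:
  "integrable lborel (\<lambda>z. indicator {z. \<bar>Re z\<bar> \<le> 1 / 2 \<and> Im z \<ge> 0} z * exp (- Im z) :: real)"
proof (rule integrableI_bounded)
  let ?f = "\<lambda>z. indicator {z. \<bar>Re z\<bar> \<le> 1 / 2 \<and> Im z \<ge> 0} z * exp (- Im z) :: real"
  show m: "?f \<in> borel_measurable lborel" by measurable
  have "(\<integral>\<^sup>+z. ennreal (norm (?f z)) \<partial>lborel) = (\<integral>\<^sup>+p. ennreal (norm (?f ((\<lambda>(x, y). Complex x y) p))) \<partial>(lborel \<Otimes>\<^sub>M lborel))"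
    by (subst lborel_complex_prod[symmetric], subst nn_integral_distr) auto
  also have "\<dots> = (\<integral>\<^sup>+x. \<integral>\<^sup>+y. ennreal (norm (?f (Complex x y))) \<partial>lborel \<partial>lborel)"
    by (subst lborel.nn_integral_fst[symmetric]) auto
  also have "\<dots> = (\<integral>\<^sup>+x. indicator {-1/2..1/2} x * (\<integral>\<^sup>+y. ennreal (indicator {0..} y * exp (- y)) \<partial>lborel) \<partial>(lborel :: real measure))"
  proof (rule nn_integral_cong)
    fix x :: real
    have "(\<integral>\<^sup>+y. ennreal (norm (?f (Complex x y))) \<partial>lborel) = (\<integral>\<^sup>+y. indicator {-1/2..1/2} x * ennreal (indicator {0..} y * exp (- y)) \<partial>lborel)"
      by (intro nn_integral_cong) (auto simp: indicator_def)
    also have "\<dots> = indicator {-1/2..1/2} x * (\<integral>\<^sup>+y. ennreal (indicator {0..} y * exp (- y)) \<partial>lborel)"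
      by (rule nn_integral_cmult) measurable
    finally show "(\<integral>\<^sup>+y. ennreal (norm (?f (Complex x y))) \<partial>lborel) =
       indicator {-1/2..1/2} x * (\<integral>\<^sup>+y. ennreal (indicator {0..} y * exp (- y)) \<partial>lborel)" .
  qed
  also have "\<dots> < \<infinity>" unfolding nn_integral_exp_decay by simp
  finally show "(\<integral>\<^sup>+z. ennreal (norm (?f z)) \<partial>lborel) < \<infinity>" .
qed

lemma measurable_cnj [measurable]: "cnj \<in> borel_measurable borel"
  by (intro borel_measurable_continuous_onI continuous_intros)

lemma measurable_qexp [measurable]: "qexp \<in> borel_measurable borel"
  by (intro borel_measurable_continuous_onI holomorphic_on_imp_continuous_on holomorphic_on_qexp)

lemma cusp_form_measurable :
  assumes "f \<in> cusp_forms k" shows "f \<in> borel_measurable borel"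
proof -
  have "continuous_on {z. Im z > 0} f"
    using assms by (auto simp: cusp_forms_def intro: holomorphic_on_imp_continuous_on)
  hence "(\<lambda>z. indicator {z. Im z > 0} z *\<^sub>R f z) \<in> borel_measurable borel"
    by (rule borel_measurable_continuous_on_indicator[OF measurable_upper_half])
  also have "(\<lambda>z. indicator {z. Im z > 0} z *\<^sub>R f z) = f"
    using assms by (auto simp: fun_eq_iff indicator_def cusp_forms_def)
  finally show ?thesis .
qed

lemma Im_ge_half: "z \<in> fundamental_domain \<Longrightarrow> Im z \<ge> 1 / 2"
proof (rule ccontr)
  assume z: "z \<in> fundamental_domain" and "\<not> Im z \<ge> 1 / 2"
  hence i: "0 < Im z" "Im z < 1 / 2" "\<bar>Re z\<bar> \<le> 1 / 2" "cmod z \<ge> 1" by (auto simp: fundamental_domain_def)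
  have "(Re z)\<^sup>2 \<le> (1/2)\<^sup>2" using i by (simp add: abs_le_square_iff[symmetric])
  moreover have "(Im z)\<^sup>2 \<le> (1/2)\<^sup>2" using i by (intro power_mono) auto
  moreover have "1 \<le> (cmod z)\<^sup>2" using i by (simp add: one_le_power)
  ultimately show False unfolding cmod_power2 by (simp add: power2_eq_square)
qed

lemma cusp_form_domain_bound:
  assumes f: "f \<in> cusp_forms k"
  obtains C where "C \<ge> 0" "\<And>z. z \<in> fundamental_domain \<Longrightarrow> norm (f z) * Im z ^ m \<le> C * exp (- Im z)"
proof -
  obtain C where C: "C \<ge> 0" "\<And>z. Im z \<ge> 1/2 \<Longrightarrow> norm (f z) \<le> C * exp (- 2 * pi * Im z)"
    using cusp_form_decay[OF f, of "1/2"] by auto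
  show ?thesis
  proof (rule that[of "C * fact m"])
    show "C * fact m \<ge> 0" using C by simp
    fix z assume z: "z \<in> fundamental_domain"
    have y: "Im z > 0" using Im_ge_half[OF z] by simp
    have "norm (f z) * Im z ^ m \<le> C * exp (- 2 * pi * Im z) * (fact m * exp (Im z))"
      using C(2)[OF Im_ge_half[OF z]] C(1) y by (intro mult_mono power_le_fact_exp) auto
    also have "\<dots> = C * fact m * exp (Im z - 2 * pi * Im z)" by (simp add: exp_diff exp_minus field_simps)
    also have "\<dots> \<le> C * fact m * exp (- Im z)"
    proof -
      have "2 * Im z \<le> 2 * pi * Im z" using y pi_gt3 by (intro mult_right_mono) auto
      thus ?thesis using C by (intro mult_left_mono) auto
    qed
    finally show "norm (f z) * Im z ^ m \<le> C * fact m * exp (- Im z)" .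
  qed
qed

lemma petersson_integrable:
  assumes f: "f \<in> cusp_forms k" and g: "g \<in> cusp_forms k'"
  shows "set_integrable lborel fundamental_domain (\<lambda>z. f z * cnj (g z) * of_real (Im z ^ m))"
proof -
  note [measurable] = cusp_form_measurable[OF f] cusp_form_measurable[OF g]
  obtain C where C: "C \<ge> 0" "\<And>z. z \<in> fundamental_domain \<Longrightarrow> norm (f z) * Im z ^ m \<le> C * exp (- Im z)"
    using cusp_form_domain_bound[OF f, of m] by blast
  obtain D where D: "D \<ge> 0" "\<And>z. z \<in> fundamental_domain \<Longrightarrow> norm (g z) * Im z ^ 0 \<le> D * exp (- Im z)"
    using cusp_form_domain_bound[OF g, of 0] by blast
  show ?thesis unfolding set_integrable_def
  proof (rule Bochner_Integration.integrable_bound)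
    show "integrable lborel (\<lambda>z. (C * D) * (indicator {z. \<bar>Re z\<bar> \<le> 1 / 2 \<and> Im z \<ge> 0} z * exp (- Im z)))"
      by (intro integrable_mult_right integrable_strip_decay)
    show "(\<lambda>z. indicator fundamental_domain z *\<^sub>R (f z * cnj (g z) * of_real (Im z ^ m))) \<in> borel_measurable lborel"
      by measurable
    have "norm (indicator fundamental_domain z *\<^sub>R (f z * cnj (g z) * of_real (Im z ^ m))) \<le>
        norm ((C * D) * (indicator {z. \<bar>Re z\<bar> \<le> 1 / 2 \<and> Im z \<ge> 0} z * exp (- Im z)))" for z
    proof (cases "z \<in> fundamental_domain")
      case True
      have y: "Im z > 0" using Im_ge_half[OF True] by simp
      have g1: "norm (g z) \<le> D"
      proof -
        have "norm (g z) \<le> D * exp (- Im z)" using D(2)[OF True] by simp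
        also have "\<dots> \<le> D * 1" using D(1) y by (intro mult_left_mono) auto
        finally show ?thesis by simp
      qed
      have S: "z \<in> {z. \<bar>Re z\<bar> \<le> 1 / 2 \<and> Im z \<ge> 0}" using True y by (simp add: fundamental_domain_def)
      have "norm (indicator fundamental_domain z *\<^sub>R (f z * cnj (g z) * of_real (Im z ^ m))) = (norm (f z) * Im z ^ m) * norm (g z)"
        using y True by (simp add: norm_mult norm_power)
      also have "\<dots> \<le> (C * exp (- Im z)) * D"
        by (rule mult_mono[OF C(2)[OF True] g1]) (use C y in auto)
      also have "\<dots> = norm ((C * D) * (indicator {z. \<bar>Re z\<bar> \<le> 1 / 2 \<and> Im z \<ge> 0} z * exp (- Im z)))"
        unfolding indicator_eq_1_iff[THEN iffD2, OF S] using C D by (simp add: abs_mult)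
      finally show ?thesis .
    qed simp
    thus "AE z in lborel. norm (indicator fundamental_domain z *\<^sub>R (f z * cnj (g z) * of_real (Im z ^ m))) \<le>
        norm ((C * D) * (indicator {z. \<bar>Re z\<bar> \<le> 1 / 2 \<and> Im z \<ge> 0} z * exp (- Im z)))" by simp
  qed
qed

lemma petersson_inner_nat:
  assumes "K \<ge> 2"
  shows "petersson_inner (int K) f g = (LINT z:fundamental_domain|lborel. f z * cnj (g z) * of_real (Im z ^ (K - 2)))"
proof -
  have e: "int K - 2 = int (K - 2)" using assms by simp
  show ?thesis unfolding petersson_inner_def e power_int_of_nat ..
qed

lemma integral_exp_frequency:
  "(LBINT x:{0..1}. exp (2 * of_real pi * \<i> * of_int m * of_real x)) = (if m = 0 then 1 else 0)"
proof (cases "m = 0")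
  case True
  thus ?thesis by (simp add: set_lebesgue_integral_def)
next
  case False
  define c where "c = 2 * of_real pi * \<i> * of_int m"
  have c: "c \<noteq> 0" using False by (simp add: c_def)
  have "(LBINT x:{0..1}. exp (c * of_real x)) = exp (c * of_real 1) / c - exp (c * of_real 0) / c"
    unfolding set_lebesgue_integral_def
  proof (rule integral_FTC_atLeastAtMost)
    fix x :: real
    have "((\<lambda>w. exp (c * w) / c) has_field_derivative exp (c * of_real x)) (at (of_real x))"
      using c by (auto intro!: derivative_eq_intros)
    thus "((\<lambda>x. exp (c * of_real x) / c) has_vector_derivative exp (c * of_real x)) (at x within {0..1})"
      by (intro has_vector_derivative_real_field has_vector_derivative_at_within)
  qed (auto intro!: continuous_intros)
  moreover have "exp c = 1" using exp_integer_2pi[of "of_int m"] by (simp add: c_def mult_ac)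
  ultimately show ?thesis using False by (simp add: c_def)
qed

text \<open>
  Orthogonality of the exponentials on horizontal segments picks out the first coefficient; the
  factor \<open>exp(-4\<pi> y)\<close> is \<open>\<bar>e(z)\<bar>^2\<close>.
\<close>
lemma fourier_coeff_1_integral:
  assumes f: "f \<in> cusp_forms k" and y: "y > 0"
  shows "(\<integral>x. indicator {0..<1} x *\<^sub>R (f (Complex x y) * cnj (qexp (Complex x y))) \<partial>lborel) =
     fourier_coeff f 1 * of_real (exp (- 4 * pi * y))"
proof -
  let ?a = "fourier_coeff f"
  define r where "r = exp (- 2 * pi * y)"
  have r: "0 \<le> r" "r < 1" using y by (auto simp: r_def)
  define A where "A n = ?a n * of_real (r ^ n * r)" for n
  define E where "E m x = exp (2 * of_real pi * \<i> * of_int m * of_real x)" for m x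
  \<comment> \<open>The closed interval serves the primitive of an exponential; its right end point is a null
    set.\<close>
  define t where "t n x = indicator {0..1} x *\<^sub>R (A n * E (int n - 1) x)" for n and x :: real
  have E1: "norm (E m x) = 1" for m x by (simp add: E_def)
  have sA: "summable (\<lambda>n. norm (A n))"
  proof -
    have "summable (\<lambda>n. norm (?a n) * r ^ n * r)"
      by (intro summable_mult2 cusp_form_fourier_abs_summable[OF f r])
    thus ?thesis using r by (simp add: A_def norm_mult norm_power mult_ac)
  qed
  have q: "qexp (Complex x y) = of_real r * E 1 x" for x
  proof -
    show ?thesis unfolding qexp_def E_def r_def exp_of_real[symmetric] exp_add[symmetric]
      by (rule arg_cong[where f = exp]) (simp add: Complex_eq algebra_simps)
  qed
  have Epow: "E 1 x ^ n * cnj (E 1 x) = E (int n - 1) x" for n x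
  proof -
    have "cnj (E 1 x) = E (-1) x" by (simp add: E_def exp_cnj)
    moreover have "E 1 x ^ n = E (int n) x" unfolding E_def exp_of_nat_mult[symmetric] by (simp add: mult_ac)
    moreover have "E (int n) x * E (-1) x = E (int n - 1) x"
      unfolding E_def exp_add[symmetric] by (simp add: algebra_simps)
    ultimately show ?thesis by simp
  qed
  have sums: "(\<lambda>n. t n x) sums (indicator {0..1} x *\<^sub>R (f (Complex x y) * cnj (qexp (Complex x y))))" for x
  proof -
    have "(\<lambda>n. ?a n * qexp (Complex x y) ^ n) sums f (Complex x y)"
      using cusp_form_fourier(1)[OF f, of "Complex x y"] y by (simp add: qexp_power)
    hence "(\<lambda>n. indicator {0..1} x *\<^sub>R (?a n * qexp (Complex x y) ^ n * cnj (qexp (Complex x y)))) sums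
       (indicator {0..1} x *\<^sub>R (f (Complex x y) * cnj (qexp (Complex x y))))"
      by (intro sums_scaleR_right sums_mult2)
    moreover have "?a n * qexp (Complex x y) ^ n * cnj (qexp (Complex x y)) = A n * E (int n - 1) x" for n
      unfolding q A_def Epow[symmetric] by (simp add: power_mult_distrib mult_ac)
    ultimately show ?thesis unfolding t_def by simp
  qed
  have tint: "integrable lborel (t n)" for n
  proof -
    have "continuous_on {0..1} (\<lambda>x. A n * E (int n - 1) x)" unfolding E_def by (intro continuous_intros)
    from borel_integrable_atLeastAtMost'[OF this] show ?thesis unfolding t_def[abs_def] set_integrable_def .
  qed
  have normt: "norm (t n x) = indicator {0..1} x *\<^sub>R norm (A n)" for n x
    unfolding t_def norm_scaleR norm_mult E1 by (simp add: indicator_def)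
  have "(\<integral>x. (\<Sum>n. t n x) \<partial>lborel) = (\<Sum>n. \<integral>x. t n x \<partial>lborel)"
  proof (rule integral_suminf[OF tint])
    show "AE x in lborel. summable (\<lambda>n. norm (t n x))"
      unfolding normt using sA by (auto intro!: summable_mult)
    show "summable (\<lambda>n. \<integral>x. norm (t n x) \<partial>lborel)"
      unfolding normt using sA by simp
  qed
  also have "\<dots> = (\<Sum>n. if n = 1 then A 1 else 0)"
  proof (rule suminf_cong)
    fix n
    have "(\<integral>x. t n x \<partial>lborel) = A n * (LBINT x:{0..1}. E (int n - 1) x)"
      unfolding t_def set_lebesgue_integral_def
      by (subst integral_mult_right_zero[symmetric]) (auto intro!: Bochner_Integration.integral_cong)
    thus "(\<integral>x. t n x \<partial>lborel) = (if n = 1 then A 1 else 0)"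
      unfolding E_def integral_exp_frequency by auto
  qed
  also have "(\<Sum>n. if n = 1 then A 1 else 0) = A 1"
    using sums_single[of 1 "\<lambda>_. A 1"] by (simp add: sums_iff)
  finally have "(\<integral>x. (\<Sum>n. t n x) \<partial>lborel) = A 1" .
  moreover have "(\<Sum>n. t n x) = indicator {0..1} x *\<^sub>R (f (Complex x y) * cnj (qexp (Complex x y)))" for x
    using sums[of x] by (simp add: sums_iff)
  ultimately have main: "(\<integral>x. indicator {0..1} x *\<^sub>R (f (Complex x y) * cnj (qexp (Complex x y))) \<partial>lborel) = A 1" by simp
  have meas [measurable]: "(\<lambda>x. f (Complex x y) * cnj (qexp (Complex x y))) \<in> borel_measurable borel"
  proof -
    note [measurable] = cusp_form_measurable[OF f]
    have [measurable]: "(\<lambda>x. Complex x y) \<in> borel_measurable borel"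
      unfolding Complex_eq by measurable
    show ?thesis by measurable
  qed
  have "(\<integral>x. indicator {0..<1} x *\<^sub>R (f (Complex x y) * cnj (qexp (Complex x y))) \<partial>lborel) =
     (\<integral>x. indicator {0..1} x *\<^sub>R (f (Complex x y) * cnj (qexp (Complex x y))) \<partial>lborel)"
  proof (rule integral_cong_AE)
    show "AE x in lborel. indicator {0..<1} x *\<^sub>R (f (Complex x y) * cnj (qexp (Complex x y))) =
        indicator {0..1} x *\<^sub>R (f (Complex x y) * cnj (qexp (Complex x y)))"
      using AE_lborel_singleton[of "1::real"] by eventually_elim (auto simp: indicator_def)
  qed measurable
  also have "\<dots> = ?a 1 * of_real (exp (- 4 * pi * y))"
  proof -
    have "r ^ 1 * r = exp (- 4 * pi * y)" unfolding r_def power_one_right exp_add[symmetric] by simp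
    thus ?thesis unfolding main A_def by simp
  qed
  finally show ?thesis .
qed

lemma Gamma_laplace_integral:
  assumes c: "c > 0"
  shows "(\<integral>y. indicator {0<..} y * (y ^ m * exp (- c * y)) \<partial>lborel) = Gamma (real m + 1) / c ^ Suc m"
proof -
  have G: "(\<integral>u. indicator {0<..} u * (u ^ m * exp (- u)) \<partial>lborel) = Gamma (real m + 1)"
  proof -
    have "ennreal (Gamma (real m + 1)) = (\<integral>\<^sup>+u. ennreal (indicator {0..} u * u powr (real m + 1 - 1) / exp u) \<partial>lborel)"
      by (rule Gamma_conv_nn_integral_real) simp
    also have "\<dots> = (\<integral>\<^sup>+u. ennreal (indicator {0<..} u * (u ^ m * exp (- u))) \<partial>lborel)"
    proof (rule nn_integral_cong_AE)
      show "AE u in lborel. ennreal (indicator {0..} u * u powr (real m + 1 - 1) / exp u) = ennreal (indicator {0<..} u * (u ^ m * exp (- u)))"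
        using AE_lborel_singleton[of "0::real"]
        by eventually_elim (auto simp: indicator_def powr_realpow exp_minus field_simps)
    qed
    finally have "(\<integral>\<^sup>+u. ennreal (indicator {0<..} u * (u ^ m * exp (- u))) \<partial>lborel) = ennreal (Gamma (real m + 1))" ..
    thus ?thesis
      by (subst integral_eq_nn_integral) (auto simp: indicator_def intro!: Gamma_real_nonneg less_imp_le[OF Gamma_real_pos])
  qed
  have "(\<integral>y. indicator {0<..} y * (y ^ m * exp (- c * y)) \<partial>lborel) =
      \<bar>1 / c\<bar> *\<^sub>R (\<integral>u. indicator {0<..} (0 + (1 / c) * u) * ((0 + (1 / c) * u) ^ m * exp (- c * (0 + (1 / c) * u))) \<partial>lborel)"
    by (rule lborel_integral_real_affine) (use c in simp)
  also have "(\<lambda>u. indicator {0<..} (0 + (1 / c) * u) * ((0 + (1 / c) * u) ^ m * exp (- c * (0 + (1 / c) * u)))) =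
     (\<lambda>u. (1 / c ^ m) * (indicator {0<..} u * (u ^ m * exp (- u))))"
    using c by (auto simp: fun_eq_iff indicator_def power_divide zero_less_divide_iff)
  also have "(\<integral>u. (1 / c ^ m) * (indicator {0<..} u * (u ^ m * exp (- u))) \<partial>lborel) = (1 / c ^ m) * Gamma (real m + 1)"
    by (subst integral_mult_right_zero) (simp add: G)
  finally show ?thesis using c by (simp add: field_simps)
qed

section \<open>The Petersson product with the Poincare series\<close>

text \<open>
  \<open>f(z) conj(e(z)) Im(z)^K\<close> at the transformed point: the factors of automorphy of \<open>f\<close> and \<open>Im^K\<close>
  leave \<open>conj (c z + d)^(-K)\<close>, which makes up the summand of the Poincare series.
\<close>
lemma unfolded_term:
  assumes f: "f \<in> cusp_forms (int K)" and p: "p \<in> coprime_pairs" and z: "Im z > 0"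
  shows "f (moebius_map (row_matrix p) z) * cnj (qexp (moebius_map (row_matrix p) z)) *
           of_real (Im (moebius_map (row_matrix p) z) ^ K) =
     f z * of_real (Im z ^ K) * cnj (poincare_term K p z)"
proof -
  obtain c d where cd: "p = (c, d)" by (cases p)
  define a b where "a = fst (bezout_pair c d)" and "b = snd (bezout_pair c d)"
  have det: "a * d - b * c = 1" using p bezout_pair_det by (auto simp: coprime_pairs_def a_def b_def cd)
  define J where "J = of_int c * z + of_int d"
  have J: "J \<noteq> 0" unfolding J_def by (rule denominator_nonzero[OF z det_1_imp(1)[OF det]])
  define w where "w = moebius_map (row_matrix p) z"
  have w: "w = (of_int a * z + of_int b) / J"
    by (simp add: w_def row_matrix_def cd a_def b_def J_def moebius_map_def)
  have mod: "\<forall>a b c d :: int. a * d - b * c = 1 \<longrightarrow> (\<forall>z\<in>upper_half_plane.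
       f ((of_int a * z + of_int b) / (of_int c * z + of_int d)) = (of_int c * z + of_int d) powi int K * f z)"
    using f by (simp add: cusp_forms_def)
  have fw: "f w = J ^ K * f z"
    using mod[rule_format, OF det, of z] z unfolding w J_def by simp
  have Im: "Im w = Im z / (norm J)\<^sup>2" unfolding w J_def by (rule Im_moebius[OF det])
  have "complex_of_real (Im w ^ K) = of_real (Im z ^ K) / (J * cnj J) ^ K"
    unfolding Im complex_norm_square[symmetric] by (simp add: power_divide)
  moreover have "poincare_term K p z = qexp w / J ^ K"
    unfolding cd poincare_term_eq[OF det z] w J_def ..
  ultimately show ?thesis unfolding w_def[symmetric] fw
    using J by (simp add: power_mult_distrib)
qed

text \<open>
  On the fundamental domain the lower bound of \<open>norm_denominator_half\<close> is uniform in \<open>z\<close>, so the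
  absolute Poincare series is bounded there.
\<close>
lemma poincare_majorant:
  assumes K: "K \<ge> 4"
  obtains C where "\<And>z. z \<in> fundamental_domain \<Longrightarrow> (\<Sum>\<^sub>\<infinity>p\<in>coprime_pairs. norm (poincare_term K p z)) \<le> C" "C \<ge> 0"
proof -
  define m where "m = (\<lambda>(c::int, d::int). (4 / sqrt (1 / 2) ^ K) * (1 / (1 + (real_of_int c)\<^sup>2)) * (1 / (1 + (real_of_int d)\<^sup>2)))"
  have u: "(\<lambda>c. (4 / sqrt (1 / 2) ^ K) * (1 / (1 + (real_of_int c)\<^sup>2))) summable_on UNIV"
    by (intro summable_on_cmult_right summable_on_inverse_square_int)
  have "(\<lambda>p. norm (case p of (c, d) \<Rightarrow> m (c, d))) summable_on UNIV \<times> UNIV"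
    unfolding m_def prod.case
    by (rule summable_on_times_dominated[where u = "\<lambda>c. (4 / sqrt (1 / 2) ^ K) * (1 / (1 + (real_of_int c)\<^sup>2))"
          and v = "\<lambda>d. 1 / (1 + (real_of_int d)\<^sup>2)"])
       (rule u summable_on_inverse_square_int | simp add: abs_mult)+
  hence "m summable_on UNIV" using abs_summable_summable[of m UNIV] by (simp add: case_prod_unfold)
  hence ms: "m summable_on coprime_pairs" by (rule summable_on_subset) auto
  have m0: "m p \<ge> 0" for p by (cases p) (simp add: m_def)
  show ?thesis
  proof (rule that[of "infsum m coprime_pairs"])
    show "infsum m coprime_pairs \<ge> 0" by (rule infsum_nonneg) (rule m0)
    fix z assume z: "z \<in> fundamental_domain"
    hence Im: "Im z > 0" by (auto simp: fundamental_domain_def)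
    have le: "norm (poincare_term K p z) \<le> m p" if p: "p \<in> coprime_pairs" for p
    proof -
      obtain c d where cd: "p = (c, d)" by (cases p)
      have "(c, d) \<noteq> (0, 0)" using p coprime_pairs_nonzero cd by auto
      have "norm (poincare_term K p z) \<le> 1 / norm (of_int c * z + of_int d) ^ K"
        using norm_poincare_term_le[OF p[unfolded cd] Im] unfolding cd .
      also have "\<dots> \<le> m p" unfolding m_def cd prod.case
        by (rule inverse_norm_lattice_bound[OF _ norm_denominator_half[OF z] \<open>(c, d) \<noteq> (0, 0)\<close> K]) simp
      finally show ?thesis .
    qed
    show "(\<Sum>\<^sub>\<infinity>p\<in>coprime_pairs. norm (poincare_term K p z)) \<le> infsum m coprime_pairs"
      by (rule infsum_mono[OF poincare_term_summable[OF K Im] ms le])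
  qed
qed

text \<open>
  Unfolding turns the product over the fundamental domain into the integral of
  \<open>f(z) conj(e(z)) y^(K-2)\<close> over the strip \<open>0 \<le> x < 1\<close>, \<open>y > 0\<close>. The integral over \<open>x\<close> extracts
  the first coefficient, the one over \<open>y\<close> is a Gamma integral.
\<close>
theorem petersson_inner_poincare:
  assumes K: "K \<ge> 4" "even K" and f: "f \<in> cusp_forms (int K)"
  shows "petersson_inner (int K) f (poincare_series K) =
    fourier_coeff f 1 * of_real (Gamma (real K - 1) / (4 * pi) ^ (K - 1))"
proof -
  let ?P = "poincare_series K"
  have K2: "K \<ge> 2" using K by simp
  have P: "?P \<in> cusp_forms (int K)" by (rule poincare_series_cusp_form(1)[OF K])
  note [measurable] = cusp_form_measurable[OF f] cusp_form_measurable[OF P]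
  define \<Phi> where "\<Phi> z = f z * cnj (qexp z) * of_real (Im z ^ K)" for z
  have \<Phi>m [measurable]: "\<Phi> \<in> borel_measurable borel" unfolding \<Phi>_def by measurable
  \<comment> \<open>The sum over all coprime pairs is twice the Poincare series.\<close>
  define Q where "Q z = f z * of_real (Im z ^ K) * (2 * cnj (?P z))" for z
  have Qm [measurable]: "Q \<in> borel_measurable borel" unfolding Q_def by measurable
  obtain C0 where C0: "\<And>z. z \<in> fundamental_domain \<Longrightarrow> (\<Sum>\<^sub>\<infinity>p\<in>coprime_pairs. norm (poincare_term K p z)) \<le> C0" "C0 \<ge> 0"
    using poincare_majorant[OF K(1)] by blast
  obtain C where C: "C \<ge> 0" "\<And>z. z \<in> fundamental_domain \<Longrightarrow> norm (f z) * Im z ^ (K - 2) \<le> C * exp (- Im z)"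
    using cusp_form_domain_bound[OF f, of "K - 2"] by blast
  define B where "B z = norm (f z) * Im z ^ K * C0" for z
  have intd: "z \<in> fundamental_domain" "Im z > 0" if "z \<in> interior_domain" for z
    using that interior_domain_subset by (auto simp: interior_domain_def)
  have single: "\<Phi> (moebius_map (row_matrix p) z) = f z * of_real (Im z ^ K) * cnj (poincare_term K p z)"
    if "p \<in> coprime_pairs" "Im z > 0" for p z
    unfolding \<Phi>_def by (rule unfolded_term[OF f that])
  have normterm: "norm (\<Phi> (moebius_map (row_matrix p) z)) = norm (f z) * Im z ^ K * norm (poincare_term K p z)"
    if "p \<in> coprime_pairs" "Im z > 0" for p z
    unfolding single[OF that] using that by (simp add: norm_mult norm_power)
  have sumQ: "(\<Sum>\<^sub>\<infinity>p\<in>coprime_pairs. \<Phi> (moebius_map (row_matrix p) z)) = Q z" if z: "z \<in> interior_domain" for z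
  proof -
    have "(\<Sum>\<^sub>\<infinity>p\<in>coprime_pairs. \<Phi> (moebius_map (row_matrix p) z)) =
        (\<Sum>\<^sub>\<infinity>p\<in>coprime_pairs. f z * of_real (Im z ^ K) * cnj (poincare_term K p z))"
      by (rule infsum_cong) (use single intd[OF z] in simp)
    also have "\<dots> = f z * of_real (Im z ^ K) * cnj (\<Sum>\<^sub>\<infinity>p\<in>coprime_pairs. poincare_term K p z)"
      by (simp add: infsum_cmult_right')
    finally show ?thesis using intd[OF z] by (simp add: Q_def poincare_series_def)
  qed
  have sumN: "(\<lambda>p. norm (\<Phi> (moebius_map (row_matrix p) z))) summable_on coprime_pairs" if z: "z \<in> interior_domain" for z
  proof -
    have "(\<lambda>p. norm (f z) * Im z ^ K * norm (poincare_term K p z)) summable_on coprime_pairs"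
      by (intro summable_on_cmult_right poincare_term_summable K intd z)
    thus ?thesis by (rule summable_on_cong[THEN iffD1, rotated]) (use normterm intd[OF z] in simp)
  qed
  have bd: "(\<Sum>\<^sub>\<infinity>p\<in>coprime_pairs. norm (\<Phi> (moebius_map (row_matrix p) z))) \<le> B z" if z: "z \<in> interior_domain" for z
  proof -
    have "(\<Sum>\<^sub>\<infinity>p\<in>coprime_pairs. norm (\<Phi> (moebius_map (row_matrix p) z))) =
        (\<Sum>\<^sub>\<infinity>p\<in>coprime_pairs. norm (f z) * Im z ^ K * norm (poincare_term K p z))"
      by (rule infsum_cong) (use normterm intd[OF z] in simp)
    also have "\<dots> = norm (f z) * Im z ^ K * (\<Sum>\<^sub>\<infinity>p\<in>coprime_pairs. norm (poincare_term K p z))"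
      by (rule infsum_cmult_right')
    also have "\<dots> \<le> B z" unfolding B_def
      by (intro mult_left_mono C0 intd z) (use intd[OF z] in auto)
    finally show ?thesis .
  qed
  have Im2: "1 / (Im z)\<^sup>2 * Im z ^ K = Im z ^ (K - 2)" if "Im z > 0" for z
    using that K by (simp add: power_diff)
  have Bm: "B \<in> borel_measurable borel" unfolding B_def by measurable
  have Bfin: "(\<integral>\<^sup>+z. ennreal (B z) \<partial>domain_measure) < \<infinity>"
  proof -
    let ?S = "{z. \<bar>Re z\<bar> \<le> 1 / 2 \<and> Im z \<ge> 0}"
    have "(\<integral>\<^sup>+z. ennreal (B z) \<partial>domain_measure) = (\<integral>\<^sup>+z. indicator interior_domain z * ennreal (B z) \<partial>hyp_measure)"
      unfolding domain_measure_def using Bm by (subst nn_integral_density) auto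
    also have "\<dots> = (\<integral>\<^sup>+z. ennreal (indicator {z. Im z > 0} z / (Im z)\<^sup>2) * (indicator interior_domain z * ennreal (B z)) \<partial>lborel)"
      using Bm by (subst hyp_measure_nn_integral) auto
    also have "\<dots> \<le> (\<integral>\<^sup>+z. ennreal (norm ((C0 * C) * (indicator ?S z * exp (- Im z)))) \<partial>lborel)"
    proof (rule nn_integral_mono)
      fix z
      show "ennreal (indicator {z. Im z > 0} z / (Im z)\<^sup>2) * (indicator interior_domain z * ennreal (B z)) \<le>
          ennreal (norm ((C0 * C) * (indicator ?S z * exp (- Im z))))"
      proof (cases "z \<in> interior_domain")
        case True
        note z = intd[OF True]
        have S: "z \<in> ?S" using z by (simp add: fundamental_domain_def)
        have "ennreal (indicator {z. Im z > 0} z / (Im z)\<^sup>2) * (indicator interior_domain z * ennreal (B z)) =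
            ennreal (1 / (Im z)\<^sup>2 * B z)"
        proof -
          have Bz: "B z \<ge> 0" using z C0(2) by (simp add: B_def)
          show ?thesis unfolding ennreal_mult''[OF Bz] using True z by simp
        qed
        also have "1 / (Im z)\<^sup>2 * B z = C0 * (norm (f z) * (1 / (Im z)\<^sup>2 * Im z ^ K))" by (simp add: B_def)
        also have "\<dots> \<le> C0 * (C * exp (- Im z))"
          unfolding Im2[OF z(2)] using C0(2) C(2)[OF z(1)] by (intro mult_left_mono) auto
        also have "C0 * (C * exp (- Im z)) = norm ((C0 * C) * (indicator ?S z * exp (- Im z)))"
          unfolding indicator_eq_1_iff[THEN iffD2, OF S] using C0(2) C(1) by (simp add: abs_mult)
        finally show ?thesis by (simp add: ennreal_leI)
      qed simp
    qed
    also have "\<dots> < \<infinity>"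
      using integrable_mult_right[OF integrable_strip_decay, of "C0 * C"] unfolding integrable_iff_bounded by blast
    finally show ?thesis .
  qed
  have per: "\<Phi> (w + of_int m) = \<Phi> w" if "Im w > 0" for w m
    using cusp_form_translate[OF f that, of m] by (simp add: \<Phi>_def)
  have unf: "integrable hyp_measure (\<lambda>z. indicator unit_strip z *\<^sub>R \<Phi> z)"
      "(\<integral>z. Q z \<partial>domain_measure) = 2 * (\<integral>z. indicator unit_strip z *\<^sub>R \<Phi> z \<partial>hyp_measure)"
    by (rule unfolding_integral[OF \<Phi>m per sumN bd Qm sumQ Bfin]; assumption)+
  have hyp_int: "(\<integral>z. h z \<partial>hyp_measure) = (\<integral>z. (indicator {z. Im z > 0} z / (Im z)\<^sup>2) *\<^sub>R h z \<partial>lborel)"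
    if [measurable]: "h \<in> borel_measurable borel" for h :: "complex \<Rightarrow> complex"
    unfolding hyp_measure_def by (subst integral_density) auto
  have LHS: "(\<integral>z. Q z \<partial>domain_measure) = 2 * petersson_inner (int K) f ?P"
  proof -
    have dm: "domain_measure = density hyp_measure (\<lambda>z. ennreal (indicator interior_domain z))"
      unfolding domain_measure_def by (simp add: ennreal_indicator)
    have "(\<integral>z. Q z \<partial>domain_measure) = (\<integral>z. indicator interior_domain z *\<^sub>R Q z \<partial>hyp_measure)"
      unfolding dm by (subst integral_density) auto
    also have "\<dots> = (\<integral>z. (indicator {z. Im z > 0} z / (Im z)\<^sup>2) *\<^sub>R (indicator interior_domain z *\<^sub>R Q z) \<partial>lborel)"
      by (rule hyp_int) measurable
    also have "\<dots> = (\<integral>z. 2 * (indicator fundamental_domain z *\<^sub>R (f z * cnj (?P z) * of_real (Im z ^ (K - 2)))) \<partial>lborel)"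
    proof (rule integral_cong_AE)
      show "AE z in lborel. (indicator {z. Im z > 0} z / (Im z)\<^sup>2) *\<^sub>R (indicator interior_domain z *\<^sub>R Q z) =
          2 * (indicator fundamental_domain z *\<^sub>R (f z * cnj (?P z) * of_real (Im z ^ (K - 2))))"
        using AE_not_in[OF boundary_null]
      proof eventually_elim
        case (elim z)
        show ?case
        proof (cases "z \<in> interior_domain")
          case True
          note z = intd[OF True]
          have "complex_of_real (1 / (Im z)\<^sup>2) * of_real (Im z ^ K) = of_real (Im z ^ (K - 2))"
            unfolding of_real_mult[symmetric] Im2[OF z(2)] ..
          thus ?thesis using True z by (simp add: Q_def scaleR_conv_of_real mult_ac)
        next
          case False
          hence "z \<notin> fundamental_domain" using elim by blast
          thus ?thesis using False by simp
        qed
      qed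
    qed measurable
    also have "\<dots> = 2 * petersson_inner (int K) f ?P"
      unfolding petersson_inner_nat[OF K2] set_lebesgue_integral_def
      by (rule integral_mult_right_zero)
    finally show ?thesis .
  qed
  define G where "G z = (indicator {z. Im z > 0} z / (Im z)\<^sup>2) *\<^sub>R (indicator unit_strip z *\<^sub>R \<Phi> z)" for z
  have Gm [measurable]: "G \<in> borel_measurable borel" unfolding G_def by measurable
  have Gint: "integrable lborel G"
    using unf(1) unfolding hyp_measure_def G_def by (subst (asm) integrable_density) auto
  have Gxy: "G (Complex x y) = of_real (indicator {0<..} y * y ^ (K - 2)) *
      (indicator {0..<1} x *\<^sub>R (f (Complex x y) * cnj (qexp (Complex x y))))" for x y
  proof (cases "y > 0")
    case True
    have "complex_of_real (1 / y\<^sup>2) * of_real (y ^ K) = of_real (y ^ (K - 2))"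
      unfolding of_real_mult[symmetric] using Im2[of "Complex x y"] True by simp
    hence e: "complex_of_real y ^ (K - 2) = of_real y ^ K / (of_real y)\<^sup>2" by simp
    show ?thesis using True by (simp add: G_def \<Phi>_def scaleR_conv_of_real unit_strip_def indicator_def e)
  qed (simp add: G_def)
  have "(\<integral>z. indicator unit_strip z *\<^sub>R \<Phi> z \<partial>hyp_measure) = (\<integral>z. G z \<partial>lborel)"
    unfolding G_def by (rule hyp_int) measurable
  also have "\<dots> = (\<integral>p. G ((\<lambda>(x, y). Complex x y) p) \<partial>(lborel \<Otimes>\<^sub>M lborel))"
    by (subst lborel_complex_prod[symmetric], subst integral_distr) auto
  also have "\<dots> = (\<integral>y. \<integral>x. G (Complex x y) \<partial>lborel \<partial>lborel)"
  proof -
    have "integrable (lborel \<Otimes>\<^sub>M lborel) (\<lambda>p. G ((\<lambda>(x, y). Complex x y) p))"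
      using Gint unfolding lborel_complex_prod[symmetric] by (subst (asm) integrable_distr_eq) auto
    hence "integrable (lborel \<Otimes>\<^sub>M lborel) (\<lambda>(x, y). G (Complex x y))" by (simp add: case_prod_unfold)
    from lborel_pair.integral_snd[OF this] show ?thesis by (simp add: case_prod_unfold)
  qed
  also have "\<dots> = (\<integral>y. fourier_coeff f 1 * of_real (indicator {0<..} y * (y ^ (K - 2) * exp (- (4 * pi) * y))) \<partial>lborel)"
  proof (rule Bochner_Integration.integral_cong[OF refl])
    fix y :: real
    show "(\<integral>x. G (Complex x y) \<partial>lborel) = fourier_coeff f 1 * of_real (indicator {0<..} y * (y ^ (K - 2) * exp (- (4 * pi) * y)))"
    proof (cases "y > 0")
      case True
      have "(\<integral>x. G (Complex x y) \<partial>lborel) = of_real (indicator {0<..} y * y ^ (K - 2)) *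
          (\<integral>x. indicator {0..<1} x *\<^sub>R (f (Complex x y) * cnj (qexp (Complex x y))) \<partial>lborel)"
        unfolding Gxy by (rule integral_mult_right_zero)
      thus ?thesis unfolding fourier_coeff_1_integral[OF f True] using True by simp
    qed (simp add: Gxy)
  qed
  also have "\<dots> = fourier_coeff f 1 * of_real (\<integral>y. indicator {0<..} y * (y ^ (K - 2) * exp (- (4 * pi) * y)) \<partial>lborel)"
    by (simp only: integral_mult_right_zero integral_complex_of_real)
  also have "(\<integral>y. indicator {0<..} y * (y ^ (K - 2) * exp (- (4 * pi) * y)) \<partial>lborel) = Gamma (real (K - 2) + 1) / (4 * pi) ^ Suc (K - 2)"
    by (rule Gamma_laplace_integral) simp
  also have "real (K - 2) + 1 = real K - 1" using K by simp
  also have "Suc (K - 2) = K - 1" using K by simp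
  finally have "(\<integral>z. indicator unit_strip z *\<^sub>R \<Phi> z \<partial>hyp_measure) = fourier_coeff f 1 * of_real (Gamma (real K - 1) / (4 * pi) ^ (K - 1))" .
  hence "2 * petersson_inner (int K) f ?P = 2 * (fourier_coeff f 1 * of_real (Gamma (real K - 1) / (4 * pi) ^ (K - 1)))"
    using unf(2) LHS by argo
  thus ?thesis by (subst (asm) mult_left_cancel) auto
qed

section \<open>The harmonic average as a Fourier coefficient\<close>

lemma sum_fun_apply: "(\<Sum>a\<in>T. (h a :: complex \<Rightarrow> complex)) z = (\<Sum>a\<in>T. h a z)"
  by (induction T rule: infinite_finite_induct) auto

lemma petersson_inner_sum_right:
  assumes K: "K \<ge> 2" and T: "finite T" "T \<subseteq> cusp_forms (int K)" and g: "g \<in> cusp_forms (int K)"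
  shows "petersson_inner (int K) g (\<Sum>a\<in>T. scale_fun (c a) a) = (\<Sum>a\<in>T. cnj (c a) * petersson_inner (int K) g a)"
proof -
  let ?I = "\<lambda>a z. indicator fundamental_domain z *\<^sub>R (g z * cnj (a z) * of_real (Im z ^ (K - 2))) :: complex"
  have int: "integrable lborel (?I a)" if "a \<in> T" for a
    using petersson_integrable[OF g, of a "int K"] T that unfolding set_integrable_def by auto
  have "petersson_inner (int K) g (\<Sum>a\<in>T. scale_fun (c a) a) = (\<integral>z. (\<Sum>a\<in>T. cnj (c a) * ?I a z) \<partial>lborel)"
    unfolding petersson_inner_nat[OF K] set_lebesgue_integral_def
    by (intro Bochner_Integration.integral_cong refl)
       (simp add: sum_fun_apply scale_fun_def sum_distrib_left sum_distrib_right scaleR_sum_right scaleR_conv_of_real mult_ac)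
  also have "\<dots> = (\<Sum>a\<in>T. \<integral>z. cnj (c a) * ?I a z \<partial>lborel)"
    by (rule Bochner_Integration.integral_sum) (intro integrable_mult_right int)
  also have "\<dots> = (\<Sum>a\<in>T. cnj (c a) * petersson_inner (int K) g a)"
    unfolding petersson_inner_nat[OF K] set_lebesgue_integral_def
    by (intro sum.cong refl integral_mult_right_zero)
  finally show ?thesis .
qed

lemma petersson_inner_self: "petersson_inner k f f = of_real (petersson_norm_sq k f)"
proof -
  have "petersson_inner k f f = (LINT z:fundamental_domain|lborel. complex_of_real ((cmod (f z))\<^sup>2 * Im z powi (k - 2)))"
    unfolding petersson_inner_def by (simp only: complex_norm_square of_real_mult)
  thus ?thesis unfolding petersson_norm_sq_def set_lebesgue_integral_def
    by (simp add: scaleR_conv_of_real flip: of_real_mult)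
qed

text \<open>
  By orthogonality the coordinate of the Poincare series at \<open>g\<close> is \<open><P, g> / \<parallel>g\<parallel>^2\<close>, which is the
  harmonic weight of \<open>g\<close> since the first coefficient of \<open>g\<close> is \<open>1\<close>. The product is nonzero for
  every \<open>g\<close> in the basis, while the Poincare series is a combination of finitely many elements; so
  the basis is finite.
\<close>
theorem poincare_series_in_basis:
  assumes K: "K \<ge> 4" "even K" and B: "hecke_basis (int K) B"
  shows "finite B" "poincare_series K = (\<Sum>f\<in>B. scale_fun (of_real (harmonic_weight (int K) f)) f)"
proof -
  let ?P = "poincare_series K"
  define G where "G = Gamma (real K - 1) / (4 * pi) ^ (K - 1)"
  have G: "G > 0" unfolding G_def using K by (intro divide_pos_pos Gamma_real_pos) auto
  have span: "cfun.span B = cusp_forms (int K)"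
    and orth: "pairwise (\<lambda>f g. petersson_inner (int K) f g = 0) B"
    and ev: "\<And>f. f \<in> B \<Longrightarrow> hecke_lambda (int K) f 1 = 1"
    using B by (auto simp: hecke_basis_def)
  have Bc: "B \<subseteq> cusp_forms (int K)" using cfun.span_superset[of B] span by simp
  have "?P \<in> cfun.span B" unfolding span by (rule poincare_series_cusp_form(1)[OF K])
  then obtain T c where T: "finite T" "T \<subseteq> B" "?P = (\<Sum>a\<in>T. scale_fun (c a) a)"
    unfolding cfun.span_explicit by blast
  have key: "g \<in> T \<and> c g = of_real (harmonic_weight (int K) g)" if g: "g \<in> B" for g
  proof -
    have gc: "g \<in> cusp_forms (int K)" using g Bc by blast
    have "fourier_coeff g 1 = 1" using ev[OF g] by (simp add: hecke_lambda_def)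
    hence "of_real G = petersson_inner (int K) g ?P"
      using petersson_inner_poincare[OF K gc] by (simp add: G_def)
    also have "\<dots> = (\<Sum>a\<in>T. cnj (c a) * petersson_inner (int K) g a)"
      unfolding T(3) using K T Bc gc by (intro petersson_inner_sum_right) auto
    also have "\<dots> = (\<Sum>a\<in>T. if a = g then cnj (c g) * petersson_inner (int K) g g else 0)"
      using orth g T(2) by (intro sum.cong refl) (auto simp: pairwise_def)
    also have "\<dots> = (if g \<in> T then cnj (c g) * of_real (petersson_norm_sq (int K) g) else 0)"
      using T(1) by (simp add: petersson_inner_self)
    finally have eq: "of_real G = (if g \<in> T then cnj (c g) * of_real (petersson_norm_sq (int K) g) else 0)" .
    have gT: "g \<in> T" using eq G by (auto split: if_splits)
    hence eq': "of_real G = cnj (c g) * of_real (petersson_norm_sq (int K) g)" using eq by simp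
    \<comment> \<open>The left-hand side of eq' is a positive number.\<close>
    have N0: "petersson_norm_sq (int K) g \<noteq> 0" using eq' G by auto
    have "cnj (c g) = of_real (G / petersson_norm_sq (int K) g)" using eq' N0 by (simp add: field_simps)
    hence "cnj (cnj (c g)) = of_real (G / petersson_norm_sq (int K) g)" by (metis complex_cnj_complex_of_real)
    moreover have "harmonic_weight (int K) g = G / petersson_norm_sq (int K) g"
    proof -
      have e: "int K - 1 = int (K - 1)" using K by simp
      have "(4 * pi) powi (int K - 1) = (4 * pi) ^ (K - 1)" unfolding e by (rule power_int_of_nat)
      thus ?thesis by (simp add: harmonic_weight_def G_def)
    qed
    ultimately show ?thesis using gT by simp
  qed
  have TB: "T = B" using key T(2) by blast
  show "finite B" using T(1) TB by simp
  show "?P = (\<Sum>f\<in>B. scale_fun (of_real (harmonic_weight (int K) f)) f)"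
    unfolding T(3) TB by (intro sum.cong refl) (use key in simp)
qed

theorem petersson_formula:
  assumes K: "K \<ge> 4" "even K" and B: "hecke_basis (int K) B"
  shows "harmonic_average (int K) B (\<lambda>f. hecke_lambda (int K) f n) =
    poincare_coeff K n / of_real (real n powr ((real K - 1) / 2))"
proof -
  note P = poincare_series_in_basis[OF K B]
  have Bc: "f \<in> cusp_forms (int K)" if "f \<in> B" for f
    using B that by (auto simp: hecke_basis_def hecke_eigenform_def)
  have "fourier_coeff (poincare_series K) = (\<lambda>n. \<Sum>f\<in>B. of_real (harmonic_weight (int K) f) * fourier_coeff f n)"
  proof (rule fourier_coeff_eqI)
    fix z :: complex assume z: "Im z > 0"
    have "(\<lambda>n. \<Sum>f\<in>B. of_real (harmonic_weight (int K) f) * (fourier_coeff f n * exp (2 * of_real pi * \<i> * of_nat n * z)))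
       sums (\<Sum>f\<in>B. of_real (harmonic_weight (int K) f) * f z)"
      by (intro sums_sum sums_mult cusp_form_fourier(1)[OF Bc z])
    thus "(\<lambda>n. (\<Sum>f\<in>B. of_real (harmonic_weight (int K) f) * fourier_coeff f n) * exp (2 * of_real pi * \<i> * of_nat n * z))
       sums poincare_series K z"
      unfolding P(2) by (simp add: sum_fun_apply scale_fun_def sum_distrib_right mult.assoc)
  qed
  hence "poincare_coeff K n = (\<Sum>f\<in>B. of_real (harmonic_weight (int K) f) * fourier_coeff f n)"
    by (simp add: poincare_series_cusp_form(2)[OF K])
  thus ?thesis
    by (simp add: harmonic_average_def hecke_lambda_def sum_divide_distrib)
qed

section \<open>Petersson's formula with Kloosterman sums\<close>

lemma residue_class_finite: "finite {r::int. 0 \<le> r \<and> r < c \<and> coprime c r}"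
  by (rule finite_subset[of _ "{0..<c}"]) auto

lemma norm_kloosterman_le:
  assumes "c \<ge> 1" shows "norm (kloosterman n c) \<le> real_of_int c"
proof -
  let ?R = "{r::int. 0 \<le> r \<and> r < c \<and> coprime c r}"
  have "norm (kloosterman n c) \<le> (\<Sum>r\<in>?R. 1)" unfolding kloosterman_def
    by (rule sum_norm_le) (simp only: norm_qexp_of_int_divide order.refl)
  also have "\<dots> = real (card ?R)" by simp
  also have "\<dots> \<le> real (card {0..<c})" by (intro of_nat_mono card_mono) auto
  finally show ?thesis using assms by simp
qed

lemma kloosterman_1: "kloosterman n 1 = 1"
proof -
  have "{r::int. 0 \<le> r \<and> r < 1 \<and> coprime 1 r} = {0}" by auto
  thus ?thesis by (simp add: kloosterman_def)
qed

text \<open>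
  The powers of \<open>c\<close> and \<open>n\<close> in front of the Bessel-Clifford function are just those that complete
  it to \<open>J(K-1)(4\<pi> \<surd>n / c)\<close>, and \<open>(-2\<pi> i)^K\<close> gives the sign \<open>(-1)^(K/2)\<close>.
\<close>
lemma bessel_coeff_eq_bessel_J:
  assumes K: "K \<ge> 2" "even K" and n: "n \<ge> 1" and c: "c \<ge> 1"
  shows "bessel_coeff K (1 / (real_of_int c)\<^sup>2) n / of_int c ^ K / of_real (real n powr ((real K - 1) / 2)) =
     of_real (2 * pi * (-1) ^ (K div 2) / real_of_int c * bessel_J (K - 1) (4 * pi * sqrt (real n) / real_of_int c))"
proof -
  define C where "C = real_of_int c"
  define N where "N = sqrt (real n)"
  have C: "C > 0" using c by (simp add: C_def)
  have N: "N > 0" "N * N = real n" using n by (auto simp: N_def)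
  define u where "u = 2 * pi * N / C"
  have u: "u > 0" using N C by (simp add: u_def)
  define X where "X = bessel_clifford (K - 1) (u\<^sup>2)"
  have powr: "real n powr ((real K - 1) / 2) = N ^ (K - 1)"
  proof -
    have "N ^ (K - 1) = N powr (real K - 1)" using N K by (simp add: powr_realpow[symmetric])
    also have "\<dots> = (real n powr (1/2)) powr (real K - 1)" by (simp add: N_def powr_half_sqrt)
    also have "\<dots> = real n powr ((real K - 1) / 2)" by (simp add: powr_powr)
    finally show ?thesis ..
  qed
  have arg: "4 * pi\<^sup>2 * (1 / C\<^sup>2) * real n = u\<^sup>2"
    by (simp add: u_def power2_eq_square N(2)[symmetric])
  have J: "bessel_J (K - 1) (4 * pi * sqrt (real n) / C) = u ^ (K - 1) * X"
    by (simp add: bessel_J_def X_def u_def N_def mult.assoc)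
  have tau: "(- 2 * of_real pi * \<i>) ^ K = of_real ((2 * pi) ^ K * (-1) ^ (K div 2))"
  proof -
    obtain h where h: "K = 2 * h" using K(2) by blast
    have "(- 2 * of_real pi * \<i>)\<^sup>2 = of_real (- ((2 * pi)\<^sup>2))"
      by (simp add: power2_eq_square)
    hence "(- 2 * of_real pi * \<i>) ^ K = of_real ((- ((2 * pi)\<^sup>2)) ^ h)"
      unfolding h power_mult by simp
    also have "(- ((2 * pi)\<^sup>2)) ^ h = (2 * pi) ^ K * (-1) ^ h"
      unfolding h power_mult by (subst power_minus) simp
    finally show ?thesis using h by simp
  qed
  have K1: "x ^ K = x * x ^ (K - 1)" for x :: real using K by (cases K) auto
  have real_eq: "(2 * pi) ^ K * s * real n ^ (K - 1) * X / C ^ K / N ^ (K - 1) = 2 * pi * s / C * (u ^ (K - 1) * X)" for s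
  proof -
    have "real n ^ (K - 1) = N ^ (K - 1) * N ^ (K - 1)" unfolding N(2)[symmetric] power_mult_distrib ..
    hence "(2 * pi) ^ K * s * real n ^ (K - 1) * X / C ^ K / N ^ (K - 1) = (2 * pi) ^ K * s * N ^ (K - 1) * X / C ^ K"
      using N by simp
    also have "\<dots> = 2 * pi * s / C * (((2 * pi) ^ (K - 1) * N ^ (K - 1) / C ^ (K - 1)) * X)"
      unfolding K1 by simp
    also have "(2 * pi) ^ (K - 1) * N ^ (K - 1) / C ^ (K - 1) = u ^ (K - 1)"
      by (simp add: u_def power_mult_distrib power_divide)
    finally show ?thesis .
  qed
  have Cc: "complex_of_int c = of_real C" by (simp add: C_def)
  have "bessel_coeff K (1 / C\<^sup>2) n / of_real C ^ K / of_real (real n powr ((real K - 1) / 2)) =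
      of_real ((2 * pi) ^ K * (-1) ^ (K div 2) * real n ^ (K - 1) * X / C ^ K / N ^ (K - 1))"
    unfolding bessel_coeff_def arg X_def[symmetric] tau powr by simp
  also have "\<dots> = of_real (2 * pi * (-1) ^ (K div 2) / C * (u ^ (K - 1) * X))" unfolding real_eq ..
  finally show ?thesis unfolding C_def[symmetric] J Cc .
qed

theorem petersson_formula_kloosterman:
  assumes K: "K \<ge> 4" "even K" and n: "n \<ge> 2" and B: "hecke_basis (int K) B"
  shows "((\<lambda>c. kloosterman n c * of_real (2 * pi * (-1) ^ (K div 2) / real_of_int c * bessel_J (K - 1) (4 * pi * sqrt (real n) / real_of_int c)))
     has_sum harmonic_average (int K) B (\<lambda>f. hecke_lambda (int K) f n)) {1..}"
proof -
  define W where "W = complex_of_real (real n powr ((real K - 1) / 2))"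
  let ?R = "\<lambda>c::int. {r::int. 0 \<le> r \<and> r < c \<and> coprime c r}"
  define F where "F = (\<lambda>(c, r). qexp (of_int (fst (bezout_pair c r) + int n * r) / of_int c) / of_int c ^ K *
       bessel_coeff K (1 / (real_of_int c)\<^sup>2) n)"
  \<comment> \<open>The bound of the coefficients with margin 1 at q = 1; only its independence of c matters.\<close>
  define M where "M = (2 * pi) ^ K * exp (4 * pi\<^sup>2 / 1) * (real n ^ (K - 1) * (exp 1 * norm (1::complex)) ^ n)"
  have Fs: "F summable_on residue_index"
  proof (rule abs_summable_summable, rule summable_on_comparison_test)
    show "(\<lambda>p. (case p of (c, r) \<Rightarrow> 1 / real_of_int c ^ 3) * M) summable_on residue_index"
      by (intro summable_on_cmult_left residue_index_summable)
    fix p assume p: "p \<in> residue_index"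
    then obtain c r where cr: "p = (c, r)" "c \<ge> 1" by (auto simp: residue_index_def)
    have c2: "(real_of_int c)\<^sup>2 \<ge> 1" using cr by (simp add: one_le_power)
    have a: "1 / (real_of_int c)\<^sup>2 \<le> 1" using c2 by (subst divide_le_eq_1_pos) linarith+
    have "norm (F p) = 1 / real_of_int c ^ K * norm (bessel_coeff K (1 / (real_of_int c)\<^sup>2) n * 1 ^ n)"
      unfolding F_def cr prod.case norm_mult norm_divide norm_qexp_of_int_divide norm_power using cr(2) by simp
    also have "\<dots> \<le> 1 / real_of_int c ^ 3 * M"
      unfolding M_def
    proof (rule mult_mono)
      show "1 / real_of_int c ^ K \<le> 1 / real_of_int c ^ 3"
        using K cr by (intro divide_left_mono power_increasing) auto
      show "norm (bessel_coeff K (1 / (real_of_int c)\<^sup>2) n * 1 ^ n) \<le>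
         (2 * pi) ^ K * exp (4 * pi\<^sup>2 / 1) * (real n ^ (K - 1) * (exp 1 * norm (1::complex)) ^ n)"
        using K a by (intro norm_bessel_coeff_le) auto
    qed (use cr in auto)
    finally show "norm (F p) \<le> (case p of (c, r) \<Rightarrow> 1 / real_of_int c ^ 3) * M" by (simp add: cr)
  qed auto
  have inner: "((\<lambda>r. F (c, r) / W) has_sum (kloosterman n c * of_real (2 * pi * (-1) ^ (K div 2) / real_of_int c * bessel_J (K - 1) (4 * pi * sqrt (real n) / real_of_int c)))) (?R c)"
    if c: "c \<ge> 1" for c
  proof -
    have "((\<lambda>r. F (c, r) / W) has_sum (\<Sum>r\<in>?R c. F (c, r) / W)) (?R c)"
      by (rule has_sum_finite[OF residue_class_finite])
    also have "(\<Sum>r\<in>?R c. F (c, r) / W) = kloosterman n c * (bessel_coeff K (1 / (real_of_int c)\<^sup>2) n / of_int c ^ K / W)"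
      unfolding kloosterman_def F_def prod.case sum_distrib_right by (intro sum.cong refl) simp
    also have "bessel_coeff K (1 / (real_of_int c)\<^sup>2) n / of_int c ^ K / W =
       of_real (2 * pi * (-1) ^ (K div 2) / real_of_int c * bessel_J (K - 1) (4 * pi * sqrt (real n) / real_of_int c))"
      unfolding W_def using K n c by (intro bessel_coeff_eq_bessel_J) auto
    finally show ?thesis .
  qed
  have "((\<lambda>p. F p / W) has_sum (infsum F residue_index / W)) residue_index"
    using has_sum_cmult_left[OF has_sum_infsum[OF Fs], of "1 / W"] by simp
  hence "((\<lambda>c. kloosterman n c * of_real (2 * pi * (-1) ^ (K div 2) / real_of_int c * bessel_J (K - 1) (4 * pi * sqrt (real n) / real_of_int c)))
     has_sum (infsum F residue_index / W)) {1..}"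
    unfolding residue_index_def by (rule has_sum_SigmaD) (use inner in auto)
  moreover have "harmonic_average (int K) B (\<lambda>f. hecke_lambda (int K) f n) = infsum F residue_index / W"
    unfolding petersson_formula[OF K B] W_def[symmetric] poincare_coeff_def F_def using n by simp
  ultimately show ?thesis by simp
qed

section \<open>The tail of the Kloosterman series\<close>

text \<open>
  The total mass of the majorant \<open>2/(1 + c^2)\<close> of \<open>1/c^2\<close>; it enters the final constant.
\<close>
definition inverse_square_mass :: real where
  "inverse_square_mass = (\<Sum>\<^sub>\<infinity>c::int. 2 * (1 / (1 + (real_of_int c)\<^sup>2)))"

lemma inverse_square_mass_nonneg: "inverse_square_mass \<ge> 0"
  unfolding inverse_square_mass_def by (rule infsum_nonneg) auto

text \<open>
  For \<open>c \<ge> c0\<close> the Bessel argument is at most \<open>(c0/c) \<rho> Z\<close>, hence the Bessel function at most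
  \<open>((c0/c) \<rho>)^a\<close>. Two of the \<open>a\<close> factors \<open>c0/c\<close> make the sum over \<open>c\<close> converge, and \<open>\<rho>^a\<close> remains
  in front. The trivial bound \<open>c\<close> for Kloosterman sums cancels the \<open>1/c\<close> of Petersson's formula.
\<close>
lemma petersson_tail_bound:
  assumes K: "K \<ge> 4" "even K" and n: "n \<ge> 2" and B: "hecke_basis (int K) B"
    and c0: "1 \<le> c0" and Y: "4 * pi * sqrt (real n) \<le> real_of_int c0 * (\<rho> * Z)"
    and Z: "0 < Z" "Z < real K - 1" and \<rho>: "0 < \<rho>" "\<rho> \<le> 1"
    and a: "a = sqrt ((real K - 1)\<^sup>2 - Z\<^sup>2)" "2 \<le> a"
  shows "norm (harmonic_average (int K) B (\<lambda>f. hecke_lambda (int K) f n) -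
     (\<Sum>c\<in>{1..<c0}. kloosterman n c * of_real (2 * pi * (-1) ^ (K div 2) / real_of_int c *
        bessel_J (K - 1) (4 * pi * sqrt (real n) / real_of_int c))))
    \<le> 2 * pi * (real_of_int c0)\<^sup>2 * inverse_square_mass * \<rho> powr a"
proof -
  define f where "f c = kloosterman n c * of_real (2 * pi * (-1) ^ (K div 2) / real_of_int c *
        bessel_J (K - 1) (4 * pi * sqrt (real n) / real_of_int c))" for c
  define y where "y = 4 * pi * sqrt (real n)"
  have y: "y > 0" using n by (simp add: y_def)
  have hs: "(f has_sum harmonic_average (int K) B (\<lambda>f. hecke_lambda (int K) f n)) {1..}"
    unfolding f_def by (rule petersson_formula_kloosterman[OF K n B])
  have K1: "real (K - 1) = real K - 1" "K - 1 \<ge> 1" using K by auto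
  define g where "g c = 2 * pi * (real_of_int c0)\<^sup>2 * \<rho> powr a * (2 * (1 / (1 + (real_of_int c)\<^sup>2)))" for c
  have le: "norm (f c) \<le> g c" if c: "c \<in> {c0..}" for c
  proof -
    define C where "C = real_of_int c"
    have C: "C \<ge> 1" "C \<ge> real_of_int c0" "c \<ge> 1" using c c0 by (auto simp: C_def)
    have c0': "real_of_int c0 \<ge> 1" using c0 by simp
    have yC: "y / C \<le> (real_of_int c0 / C) * (\<rho> * Z)"
      using Y C by (simp add: y_def divide_right_mono)
    also have "\<dots> \<le> 1 * (1 * Z)" using C c0' \<rho> Z by (intro mult_mono) auto
    finally have yZ: "y / C \<le> Z" by simp
    have J0: "bessel_J (K - 1) (y / C) \<ge> 0"
      by (rule bessel_J_nonneg) (use K1 y C yZ Z in auto)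
    have "bessel_J (K - 1) (y / C) \<le> (y / C / Z) powr a"
      unfolding a K1(1)[symmetric] by (rule bessel_J_le_powr) (use K1 y C yZ Z in auto)
    also have "\<dots> \<le> (real_of_int c0 / C * \<rho>) powr a"
    proof (rule powr_mono2)
      show "y / C / Z \<le> real_of_int c0 / C * \<rho>"
        unfolding pos_divide_le_eq[OF Z(1)] using yC by (simp only: mult.assoc)
    qed (use a y C Z in auto)
    also have "\<dots> = (real_of_int c0 / C) powr a * \<rho> powr a" by (rule powr_mult)
    also have "\<dots> \<le> (real_of_int c0 / C) powr 2 * \<rho> powr a"
    proof (intro mult_right_mono)
      show "(real_of_int c0 / C) powr a \<le> (real_of_int c0 / C) powr 2"
        using C c0' a by (intro powr_mono') auto
    qed auto
    also have "(real_of_int c0 / C) powr 2 = (real_of_int c0)\<^sup>2 * (1 / C\<^sup>2)"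
      using C c0' by (simp add: powr_numeral power_divide)
    also have "(real_of_int c0)\<^sup>2 * (1 / C\<^sup>2) * \<rho> powr a \<le> (real_of_int c0)\<^sup>2 * (2 * (1 / (1 + C\<^sup>2))) * \<rho> powr a"
    proof (intro mult_right_mono mult_left_mono)
      have "C\<^sup>2 \<ge> 1" using C by (simp add: one_le_power)
      thus "1 / C\<^sup>2 \<le> 2 * (1 / (1 + C\<^sup>2))" by (simp add: divide_simps)
    qed auto
    finally have J: "bessel_J (K - 1) (y / C) \<le> (real_of_int c0)\<^sup>2 * (2 * (1 / (1 + C\<^sup>2))) * \<rho> powr a" .
    have "norm (f c) = norm (kloosterman n c) * (2 * pi / C * bessel_J (K - 1) (y / C))"
      using C J0 unfolding f_def norm_mult norm_of_real
      by (simp add: C_def[symmetric] y_def[symmetric] abs_mult power_abs)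
    also have "\<dots> \<le> C * (2 * pi / C * bessel_J (K - 1) (y / C))"
      using norm_kloosterman_le[OF C(3), of n] J0 C by (intro mult_right_mono) (auto simp: C_def)
    also have "\<dots> = 2 * pi * bessel_J (K - 1) (y / C)" using C by simp
    also have "\<dots> \<le> 2 * pi * ((real_of_int c0)\<^sup>2 * (2 * (1 / (1 + C\<^sup>2))) * \<rho> powr a)"
      using J by (intro mult_left_mono) auto
    also have "\<dots> = g c" by (simp add: g_def C_def)
    finally show ?thesis .
  qed
  have gU: "g summable_on UNIV" unfolding g_def
    by (intro summable_on_cmult_right summable_on_inverse_square_int)
  have g0: "g c \<ge> 0" for c by (simp add: g_def)
  have gs: "g summable_on {c0..}" using gU by (rule summable_on_subset) auto
  have fn: "(\<lambda>c. norm (f c)) summable_on {c0..}"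
    by (rule summable_on_comparison_test[OF gs le]) auto
  have split: "{1..} = {1..<c0} \<union> {c0..}" using c0 by auto
  have "harmonic_average (int K) B (\<lambda>f. hecke_lambda (int K) f n) = infsum f {1..}"
    using hs by (simp add: infsumI)
  also have "\<dots> = infsum f {1..<c0} + infsum f {c0..}"
    unfolding split by (intro infsum_Un_disjoint abs_summable_summable[OF fn]) auto
  finally have "harmonic_average (int K) B (\<lambda>f. hecke_lambda (int K) f n) - (\<Sum>c\<in>{1..<c0}. f c) = infsum f {c0..}"
    by simp
  moreover have "norm (infsum f {c0..}) \<le> infsum (\<lambda>c. norm (f c)) {c0..}" by (rule norm_infsum_bound[OF fn])
  moreover have "infsum (\<lambda>c. norm (f c)) {c0..} \<le> infsum g {c0..}" by (rule infsum_mono[OF fn gs le])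
  moreover have "infsum g {c0..} \<le> infsum g UNIV"
    by (rule infsum_mono_neutral[OF gs gU]) (use g0 in auto)
  moreover have "infsum g UNIV = 2 * pi * (real_of_int c0)\<^sup>2 * \<rho> powr a * inverse_square_mass"
    unfolding g_def inverse_square_mass_def by (rule infsum_cmult_right')
  ultimately show ?thesis unfolding f_def[symmetric] by (simp add: mult_ac)
qed

lemma card_dyadic:
  assumes "x > 0" shows "real (card {n. x < real n \<and> real n \<le> 2 * x}) \<le> 2 * x"
proof -
  have "{n. x < real n \<and> real n \<le> 2 * x} \<subseteq> {1..nat \<lfloor>2 * x\<rfloor>}"
  proof
    fix n assume n: "n \<in> {n. x < real n \<and> real n \<le> 2 * x}"
    hence "real n > 0" using assms by auto
    thus "n \<in> {1..nat \<lfloor>2 * x\<rfloor>}" using n by (auto simp: le_nat_iff le_floor_iff)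
  qed
  hence "card {n. x < real n \<and> real n \<le> 2 * x} \<le> card {1..nat \<lfloor>2 * x\<rfloor>}" by (intro card_mono) auto
  hence "real (card {n. x < real n \<and> real n \<le> 2 * x}) \<le> real (nat \<lfloor>2 * x\<rfloor>)" by simp
  also have "\<dots> \<le> 2 * x" using assms by linarith
  finally show ?thesis .
qed

lemma harmonic_average_hecke_sum:
  "harmonic_average k B (hecke_sum k x) =
    (\<Sum>n | x < real n \<and> real n \<le> 2 * x. harmonic_average k B (\<lambda>f. hecke_lambda k f n))"
  unfolding harmonic_average_def hecke_sum_def sum_distrib_left by (rule sum.swap)

section \<open>The two ranges of the dyadic sum\<close>

text \<open>
  For \<open>x = K^2/(32\<pi>^2+1)\<close> the largest argument \<open>4\<pi> \<surd>(2x)\<close> is \<open>\<theta>0 K\<close>. Two points divide the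
  interval from \<open>\<theta>0\<close> to \<open>1\<close> into thirds: \<open>(2\<theta>0+1)/3\<close> leaves room to replace \<open>\<theta>0 K\<close> by a multiple
  of the order \<open>K-1\<close>, and \<open>(\<theta>0+2)/3 (K-1)\<close> is the point \<open>Z\<close> in the decay estimate. Their ratio
  \<open>\<rho>0 < 1\<close> is the base of the decay and \<open>\<kappa>0 (K-1) = \<surd>((K-1)^2 - Z^2)\<close> is the exponent.
\<close>
definition \<theta>0 :: real where "\<theta>0 = sqrt (32 * pi\<^sup>2 / (32 * pi\<^sup>2 + 1))"
definition \<rho>0 :: real where "\<rho>0 = ((2 * \<theta>0 + 1) / 3) / ((\<theta>0 + 2) / 3)"
definition \<kappa>0 :: real where "\<kappa>0 = sqrt (1 - ((\<theta>0 + 2) / 3)\<^sup>2)"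

lemma theta_bounds: "0 < \<theta>0" "\<theta>0 < 1" "\<theta>0\<^sup>2 = 32 * pi\<^sup>2 / (32 * pi\<^sup>2 + 1)"
proof -
  have p: "pi\<^sup>2 > 0" by simp
  have q: "32 * pi\<^sup>2 / (32 * pi\<^sup>2 + 1) < 1" using p by (intro divide_less_eq_1_pos[THEN iffD2]) (auto intro: add_nonneg_pos)
  have r: "32 * pi\<^sup>2 / (32 * pi\<^sup>2 + 1) > 0" using p by (intro divide_pos_pos add_pos_pos) auto
  show "0 < \<theta>0" unfolding \<theta>0_def using r by simp
  show "\<theta>0 < 1" unfolding \<theta>0_def using real_sqrt_less_mono[OF q] by simp
  show "\<theta>0\<^sup>2 = 32 * pi\<^sup>2 / (32 * pi\<^sup>2 + 1)" unfolding \<theta>0_def using r by (intro real_sqrt_pow2) auto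
qed

lemma rho_kappa_bounds: "0 < \<rho>0" "\<rho>0 < 1" "0 < \<kappa>0"
proof -
  show "0 < \<rho>0" "\<rho>0 < 1" using theta_bounds by (auto simp: \<rho>0_def divide_simps)
  have "((\<theta>0 + 2) / 3)\<^sup>2 < 1\<^sup>2" using theta_bounds by (intro power_strict_mono) auto
  thus "0 < \<kappa>0" by (simp add: \<kappa>0_def)
qed

text \<open>
  How large the weight has to be: the first condition makes \<open>x \<ge> 1\<close> in the second range, since
  \<open>20^2 \<ge> 32\<pi>^2 - 1\<close>; the second fits \<open>\<theta>0 t\<close> below the first third point; the third makes
  \<open>\<Sum>c. (1/c)^a\<close> converge; the last makes the exponential decay beat the at most \<open>t^2\<close> terms of the
  sum.
\<close>
definition large_weight :: "real \<Rightarrow> bool" where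
  "large_weight t \<longleftrightarrow> t \<ge> 20 \<and> \<theta>0 * t \<le> (2 * \<theta>0 + 1) / 3 * (t - 1) \<and> \<kappa>0 * (t - 1) \<ge> 2 \<and>
     t\<^sup>2 * \<rho>0 powr (\<kappa>0 * (t - 1)) \<le> exp (- sqrt t)"

lemma eventually_large_weight: "eventually large_weight at_top"
proof -
  define l where "l = - \<kappa>0 * ln \<rho>0"
  have l: "l > 0" using rho_kappa_bounds by (auto simp: l_def mult_pos_neg)
  have "((\<lambda>t::real. t\<^sup>2 * exp (- l * (t - 1)) * exp (sqrt t)) \<longlongrightarrow> 0) at_top"
    using l by real_asymp
  hence "eventually (\<lambda>t::real. t\<^sup>2 * exp (- l * (t - 1)) * exp (sqrt t) < 1) at_top"
    by (rule order_tendstoD) simp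
  moreover have "eventually (\<lambda>t::real. t \<ge> 20) at_top" by (rule eventually_ge_at_top)
  moreover have "eventually (\<lambda>t::real. t \<ge> (2 * \<theta>0 + 1) / (1 - \<theta>0)) at_top" by (rule eventually_ge_at_top)
  moreover have "eventually (\<lambda>t::real. t \<ge> 2 / \<kappa>0 + 1) at_top" by (rule eventually_ge_at_top)
  ultimately show ?thesis
  proof eventually_elim
    case (elim t)
    have "\<theta>0 * t \<le> (2 * \<theta>0 + 1) / 3 * (t - 1)"
      using elim(3) theta_bounds by (simp add: field_simps)
    moreover have "\<kappa>0 * (t - 1) \<ge> 2" using elim(4) rho_kappa_bounds by (simp add: field_simps)
    moreover have "\<rho>0 powr (\<kappa>0 * (t - 1)) = exp (- l * (t - 1))"
      using rho_kappa_bounds by (simp add: powr_def l_def mult_ac)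
    hence "t\<^sup>2 * \<rho>0 powr (\<kappa>0 * (t - 1)) \<le> exp (- sqrt t)"
      using elim(1) by (simp add: exp_minus field_simps)
    ultimately show ?case using elim(2) by (simp add: large_weight_def)
  qed
qed

lemma pi_sq_large: "pi\<^sup>2 > 1"
  using pi_gt3 by (intro one_less_power) auto

text \<open>
  For \<open>x \<ge> K^2/(32\<pi>^2-1)\<close> the argument \<open>Y = 4\<pi> \<surd>(2x)\<close> satisfies \<open>Y^2 \<ge> (1 + \<mu>0) K^2\<close>: it is beyond
  the transition by a constant factor.
\<close>
definition \<mu>0 :: real where "\<mu>0 = 1 / (32 * pi\<^sup>2 - 1)"

lemma mu_pos: "\<mu>0 > 0" using pi_sq_large by (simp add: \<mu>0_def)

definition cutoff :: "nat \<Rightarrow> real" where "cutoff K = (\<theta>0 + 2) / 3 * (real K - 1)"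

context
  fixes K :: nat and B :: "(complex \<Rightarrow> complex) set"
  assumes large: "large_weight (real K)" and ev: "even K" and basis: "hecke_basis (int K) B"
begin

lemma weight_facts:
  shows "real K \<ge> 20" "K \<ge> 4" "\<theta>0 * real K \<le> \<rho>0 * cutoff K" "0 < cutoff K" "cutoff K < real K - 1"
    "\<kappa>0 * (real K - 1) = sqrt ((real K - 1)\<^sup>2 - (cutoff K)\<^sup>2)" "2 \<le> \<kappa>0 * (real K - 1)"
    "(real K)\<^sup>2 * \<rho>0 powr (\<kappa>0 * (real K - 1)) \<le> exp (- sqrt (real K))"
proof -
  note L = large[unfolded large_weight_def]
  show K20: "real K \<ge> 20" using L by simp
  thus "K \<ge> 4" by linarith
  have "\<rho>0 * cutoff K = (2 * \<theta>0 + 1) / 3 * (real K - 1)"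
  proof -
    define u v where "u = (2 * \<theta>0 + 1) / 3" and "v = (\<theta>0 + 2) / 3"
    have "v \<noteq> 0" using theta_bounds(1) by (simp add: v_def)
    thus ?thesis unfolding \<rho>0_def cutoff_def u_def[symmetric] v_def[symmetric] by simp
  qed
  thus "\<theta>0 * real K \<le> \<rho>0 * cutoff K" using L by simp
  show "0 < cutoff K" using K20 theta_bounds by (simp add: cutoff_def)
  have "(\<theta>0 + 2) / 3 * (real K - 1) < 1 * (real K - 1)" using K20 theta_bounds by (intro mult_strict_right_mono) auto
  thus "cutoff K < real K - 1" by (simp add: cutoff_def)
  have "(real K - 1)\<^sup>2 - (cutoff K)\<^sup>2 = (1 - ((\<theta>0 + 2) / 3)\<^sup>2) * (real K - 1)\<^sup>2"
    unfolding cutoff_def power_mult_distrib by (simp only: left_diff_distrib mult_1)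
  thus "\<kappa>0 * (real K - 1) = sqrt ((real K - 1)\<^sup>2 - (cutoff K)\<^sup>2)"
    using K20 by (simp add: \<kappa>0_def real_sqrt_mult)
  show "2 \<le> \<kappa>0 * (real K - 1)" "(real K)\<^sup>2 * \<rho>0 powr (\<kappa>0 * (real K - 1)) \<le> exp (- sqrt (real K))"
    using L by auto
qed

text \<open>
  With \<open>t = x/4\<close> this also serves the moduli \<open>c \<ge> 2\<close> in the second range, and with \<open>t = x/2\<close> the
  lower end of that range.
\<close>
lemma sqrt_le_theta:
  assumes "0 \<le> t" "(32 * pi\<^sup>2 + 1) * t \<le> (real K)\<^sup>2"
  shows "4 * pi * sqrt (2 * t) \<le> \<theta>0 * real K"
proof (rule power2_le_imp_le)
  show "0 \<le> \<theta>0 * real K" using theta_bounds by simp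
  have p: "32 * pi\<^sup>2 + 1 > 0" by (intro add_nonneg_pos) auto
  have "(4 * pi * sqrt (2 * t))\<^sup>2 = 32 * pi\<^sup>2 * t" using assms by (simp add: power_mult_distrib)
  also have "\<dots> \<le> 32 * pi\<^sup>2 * ((real K)\<^sup>2 / (32 * pi\<^sup>2 + 1))"
    using assms p by (intro mult_left_mono) (auto simp: pos_le_divide_eq mult.commute)
  also have "\<dots> = (\<theta>0 * real K)\<^sup>2" by (simp add: power_mult_distrib theta_bounds(3))
  finally show "(4 * pi * sqrt (2 * t))\<^sup>2 \<le> (\<theta>0 * real K)\<^sup>2" .
qed

text \<open>
  Either all moduli are in the range of exponential decay (\<open>c0 = 1\<close>), or all but the modulus \<open>1\<close>,
  whose Kloosterman sum is \<open>1\<close> (\<open>c0 = 2\<close>).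
\<close>
lemma average_bound:
  assumes c0: "c0 = 1 \<or> c0 = 2" and n: "n \<ge> 2" and y: "4 * pi * sqrt (real n) \<le> real_of_int c0 * (\<theta>0 * real K)"
  shows "norm (harmonic_average (int K) B (\<lambda>f. hecke_lambda (int K) f n) -
     (if c0 = 1 then 0 else of_real (2 * pi * (-1) ^ (K div 2) * bessel_J (K - 1) (4 * pi * sqrt (real n)))))
    \<le> 8 * pi * inverse_square_mass * \<rho>0 powr (\<kappa>0 * (real K - 1))"
proof -
  note W = weight_facts
  have "norm (harmonic_average (int K) B (\<lambda>f. hecke_lambda (int K) f n) -
     (\<Sum>c\<in>{1..<c0}. kloosterman n c * of_real (2 * pi * (-1) ^ (K div 2) / real_of_int c *
        bessel_J (K - 1) (4 * pi * sqrt (real n) / real_of_int c))))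
    \<le> 2 * pi * (real_of_int c0)\<^sup>2 * inverse_square_mass * \<rho>0 powr (\<kappa>0 * (real K - 1))"
  proof (rule petersson_tail_bound[OF W(2) ev n basis _ _ W(4,5) rho_kappa_bounds(1) less_imp_le[OF rho_kappa_bounds(2)] W(6,7)])
    show "1 \<le> c0" using c0 by auto
    have "real_of_int c0 * (\<theta>0 * real K) \<le> real_of_int c0 * (\<rho>0 * cutoff K)"
      using W(3) c0 by (intro mult_left_mono) auto
    thus "4 * pi * sqrt (real n) \<le> real_of_int c0 * (\<rho>0 * cutoff K)" using y by linarith
  qed
  also have "\<dots> \<le> 2 * pi * 4 * inverse_square_mass * \<rho>0 powr (\<kappa>0 * (real K - 1))"
    using c0 inverse_square_mass_nonneg by (intro mult_right_mono mult_left_mono) auto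
  also have "(\<Sum>c\<in>{1..<c0}. kloosterman n c * of_real (2 * pi * (-1) ^ (K div 2) / real_of_int c *
        bessel_J (K - 1) (4 * pi * sqrt (real n) / real_of_int c))) =
     (if c0 = 1 then 0 else of_real (2 * pi * (-1) ^ (K div 2) * bessel_J (K - 1) (4 * pi * sqrt (real n))))"
  proof (cases "c0 = 1")
    case False
    hence "{1..<c0} = {1}" using c0 by auto
    thus ?thesis using False by (simp add: kloosterman_1)
  qed simp
  finally show ?thesis by simp
qed

lemma average_sum_bound:
  assumes x: "0 < x" "x \<notin> {1/2..<1}" "2 * x \<le> (real K)\<^sup>2"
    and c0: "c0 = 1 \<or> c0 = 2" and y: "4 * pi * sqrt (2 * x) \<le> real_of_int c0 * (\<theta>0 * real K)"
  shows "norm (harmonic_average (int K) B (hecke_sum (int K) x) -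
     (if c0 = 1 then 0 else of_real (2 * pi * (-1) ^ (K div 2) *
        (\<Sum>n | x < real n \<and> real n \<le> 2 * x. bessel_J (K - 1) (4 * pi * sqrt (real n))))))
    \<le> 8 * pi * inverse_square_mass * exp (- sqrt (real K))"
proof -
  define A where "A = {n. x < real n \<and> real n \<le> 2 * x}"
  define h where "h n = harmonic_average (int K) B (\<lambda>f. hecke_lambda (int K) f n)" for n
  define m :: "nat \<Rightarrow> complex" where "m n = (if c0 = 1 then 0 else of_real (2 * pi * (-1) ^ (K div 2) *
     bessel_J (K - 1) (4 * pi * sqrt (real n))))" for n
  define e where "e = \<rho>0 powr (\<kappa>0 * (real K - 1))"
  have e: "e \<ge> 0" by (simp add: e_def)
  have bound: "norm (h n - m n) \<le> 8 * pi * inverse_square_mass * e" if "n \<in> A" for n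
  proof -
    have n: "x < real n" "real n \<le> 2 * x" using that by (auto simp: A_def)
    \<comment> \<open>The only way to have n = 1 in the range is 1/2 <= x < 1.\<close>
    have "n \<noteq> 1" using n x(1,2) by auto
    moreover have "n \<noteq> 0" using n x(1) by auto
    ultimately have n2: "n \<ge> 2" by linarith
    have "4 * pi * sqrt (real n) \<le> 4 * pi * sqrt (2 * x)" using n by simp
    hence "4 * pi * sqrt (real n) \<le> real_of_int c0 * (\<theta>0 * real K)" using y by linarith
    from average_bound[OF c0 n2 this] show ?thesis unfolding h_def m_def e_def .
  qed
  have m: "(if c0 = 1 then 0 else of_real (2 * pi * (-1) ^ (K div 2) *
        (\<Sum>n\<in>A. bessel_J (K - 1) (4 * pi * sqrt (real n))))) = (\<Sum>n\<in>A. m n)"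
    by (simp add: m_def sum_distrib_left)
  have "norm ((\<Sum>n\<in>A. h n) - (\<Sum>n\<in>A. m n)) = norm (\<Sum>n\<in>A. h n - m n)"
    by (simp only: sum_subtractf)
  also have "\<dots> \<le> (\<Sum>n\<in>A. norm (h n - m n))" by (rule norm_sum)
  also have "\<dots> \<le> real (card A) * (8 * pi * inverse_square_mass * e)"
    by (rule sum_bounded_above) (rule bound)
  also have "\<dots> \<le> (real K)\<^sup>2 * (8 * pi * inverse_square_mass * e)"
  proof (rule mult_right_mono)
    show "real (card A) \<le> (real K)\<^sup>2" using card_dyadic[OF x(1)] x(3) unfolding A_def by linarith
  qed (use inverse_square_mass_nonneg e in simp)
  also have "\<dots> = 8 * pi * inverse_square_mass * ((real K)\<^sup>2 * e)" by simp
  also have "\<dots> \<le> 8 * pi * inverse_square_mass * exp (- sqrt (real K))"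
    using weight_facts(8) inverse_square_mass_nonneg unfolding e_def by (intro mult_left_mono) auto
  finally show ?thesis
    unfolding harmonic_average_hecke_sum A_def[symmetric] m h_def .
qed

lemma average_below_transition:
  assumes x: "0 < x" "x \<notin> {1/2..<1}" "x \<le> (real K)\<^sup>2 / (32 * pi\<^sup>2 + 1)"
  shows "norm (harmonic_average (int K) B (hecke_sum (int K) x))
    \<le> 8 * pi * inverse_square_mass * exp (- sqrt (real K))"
proof -
  have p: "32 * pi\<^sup>2 + 1 > 0" by (intro add_nonneg_pos) auto
  have xx: "(32 * pi\<^sup>2 + 1) * x \<le> (real K)\<^sup>2" using x(3) p by (simp add: pos_le_divide_eq mult.commute)
  have "2 * x \<le> (32 * pi\<^sup>2 + 1) * x" using x(1) pi_sq_large by (intro mult_right_mono) auto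
  hence "2 * x \<le> (real K)\<^sup>2" using xx by linarith
  moreover have "4 * pi * sqrt (2 * x) \<le> real_of_int 1 * (\<theta>0 * real K)"
    using sqrt_le_theta[of x] xx x(1) by simp
  ultimately show ?thesis using average_sum_bound[OF x(1,2), of 1] by simp
qed

text \<open>
  The lower limit \<open>4\<pi> \<surd>x\<close> of the moment integral is still in the range of exponential decay.
\<close>
lemma prim_below_transition:
  assumes x: "0 < x" "x \<le> (real K)\<^sup>2 / (16 * pi\<^sup>2 + 1)"
  shows "0 \<le> bessel_prim (K - 1) x" "bessel_prim (K - 1) x \<le> 1"
proof -
  note W = weight_facts
  define Y where "Y = 4 * pi * sqrt x"
  have Y: "Y > 0" using x by (simp add: Y_def)
  have p: "16 * pi\<^sup>2 + 1 > 0" by (intro add_nonneg_pos) auto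
  have "(32 * pi\<^sup>2 + 1) * (x / 2) \<le> (16 * pi\<^sup>2 + 1) * x" using x(1) by (simp add: algebra_simps)
  also have "\<dots> \<le> (real K)\<^sup>2" using x(2) p by (simp add: pos_le_divide_eq mult.commute)
  finally have YK: "Y \<le> \<theta>0 * real K" using sqrt_le_theta[of "x / 2"] x(1) by (simp add: Y_def)
  hence Y\<rho>: "Y \<le> \<rho>0 * cutoff K" using W(3) by linarith
  also have "\<dots> \<le> 1 * cutoff K" using rho_kappa_bounds W(4) by (intro mult_right_mono) auto
  finally have YZ: "Y \<le> cutoff K" by simp
  have K1: "real (K - 1) = real K - 1" "K - 1 \<ge> 1" using W(2) by auto
  have M: "0 \<le> bessel_moment (K - 1) Y"
    "bessel_moment (K - 1) Y \<le> Y\<^sup>2 * (Y / cutoff K) powr (\<kappa>0 * (real K - 1))"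
    using bessel_moment_small[of "K - 1" Y "cutoff K"] K1 Y YZ W(5) unfolding W(6) K1(1) by auto
  have "Y \<le> 1 * real K" using YK mult_right_mono[of \<theta>0 1 "real K"] theta_bounds by simp
  hence "Y\<^sup>2 \<le> (real K)\<^sup>2" using Y by (intro power_mono) auto
  moreover have "(Y / cutoff K) powr (\<kappa>0 * (real K - 1)) \<le> \<rho>0 powr (\<kappa>0 * (real K - 1))"
    using Y\<rho> Y W(4,7) by (intro powr_mono2) (auto simp: pos_divide_le_eq)
  ultimately have "Y\<^sup>2 * (Y / cutoff K) powr (\<kappa>0 * (real K - 1)) \<le> (real K)\<^sup>2 * \<rho>0 powr (\<kappa>0 * (real K - 1))"
    by (intro mult_mono) auto
  hence "bessel_moment (K - 1) Y \<le> exp (- sqrt (real K))" using M(2) W(8) by linarith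
  also have "\<dots> \<le> 1" by simp
  finally have M1: "bessel_moment (K - 1) Y \<le> 1" .
  show "0 \<le> bessel_prim (K - 1) x" using M(1) by (simp add: bessel_prim_def Y_def)
  have "bessel_moment (K - 1) Y \<le> 8 * pi\<^sup>2" using M1 pi_sq_large by linarith
  thus "bessel_prim (K - 1) x \<le> 1" by (simp add: bessel_prim_def Y_def)
qed

text \<open>
  At the upper limit the moment has passed the transition and equals its full mass \<open>K-1\<close> up to
  \<open>O(\<surd>K)\<close>.
\<close>
lemma prim_above_transition:
  assumes x: "0 < x" "(real K)\<^sup>2 / (32 * pi\<^sup>2 - 1) \<le> x" "x \<le> (real K)\<^sup>2 / (16 * pi\<^sup>2 + 1)"
  shows "\<bar>8 * pi\<^sup>2 * bessel_prim (K - 1) (2 * x) - (real K - 1)\<bar> \<le> (8 / \<mu>0 + 4) * sqrt (real K)"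
proof -
  note W = weight_facts
  define Y where "Y = 4 * pi * sqrt (2 * x)"
  define k where "k = real K"
  have k: "k \<ge> 20" using W(1) by (simp add: k_def)
  have K1: "real (K - 1) = k - 1" "K - 1 \<ge> 1" using W(2) by (auto simp: k_def)
  have Y: "Y > 0" using x by (simp add: Y_def)
  have Y2: "Y\<^sup>2 = 32 * pi\<^sup>2 * x" using x by (simp add: Y_def power_mult_distrib)
  have q: "32 * pi\<^sup>2 - 1 > 0" using pi_sq_large by simp
  have p: "16 * pi\<^sup>2 + 1 > 0" by (intro add_nonneg_pos) auto
  have "32 * pi\<^sup>2 * (k\<^sup>2 / (32 * pi\<^sup>2 - 1)) \<le> Y\<^sup>2"
    unfolding Y2 using x(2) by (intro mult_left_mono) (auto simp: k_def)
  moreover have "32 * pi\<^sup>2 * (k\<^sup>2 / (32 * pi\<^sup>2 - 1)) = k\<^sup>2 + \<mu>0 * k\<^sup>2"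
    using q by (simp add: \<mu>0_def field_simps)
  ultimately have lo: "k\<^sup>2 + \<mu>0 * k\<^sup>2 \<le> Y\<^sup>2" by simp
  have \<mu>k: "\<mu>0 * k\<^sup>2 > 0" using mu_pos k by simp
  have kY: "k < Y" using lo \<mu>k Y by (intro power2_less_imp_less[of k Y]) auto
  have "(16 * pi\<^sup>2 + 1) * x \<le> k\<^sup>2" using x(3) p by (simp add: pos_le_divide_eq mult.commute k_def)
  hence "Y\<^sup>2 \<le> 2 * k\<^sup>2" using x(1) unfolding Y2 by (simp add: algebra_simps)
  also have "\<dots> \<le> (2 * k)\<^sup>2" by (simp add: power_mult_distrib)
  finally have Yk: "Y \<le> 2 * k" using k by (intro power2_le_imp_le[of Y "2 * k"]) auto
  have "(k - 1)\<^sup>2 \<le> k\<^sup>2" using k by (intro power_mono) auto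
  hence D: "\<mu>0 * k\<^sup>2 \<le> Y\<^sup>2 - (k - 1)\<^sup>2" using lo by linarith
  have sk: "sqrt k > 0" "sqrt k * sqrt k = k" using k by auto
  have s1: "sqrt (k - 1) \<le> sqrt k" "sqrt (k - 1) > 0" using k by auto
  have s2: "sqrt k / 2 \<le> sqrt (k - 1)"
  proof (rule power2_le_imp_le)
    show "(sqrt k / 2)\<^sup>2 \<le> (sqrt (k - 1))\<^sup>2" using k by (simp add: power_divide)
  qed (use k in auto)
  have "\<bar>bessel_moment (K - 1) Y - (k - 1)\<bar> \<le>
      (k - 1) * (4 * sqrt (k - 1) * Y / (Y\<^sup>2 - (k - 1)\<^sup>2)) + Y / sqrt (k - 1)"
    using bessel_moment_approx[of "K - 1" Y] K1 kY by simp
  also have "(k - 1) * (4 * sqrt (k - 1) * Y / (Y\<^sup>2 - (k - 1)\<^sup>2)) \<le>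
      k * (4 * sqrt k * (2 * k) / (\<mu>0 * k\<^sup>2))"
    using k s1 Y Yk D \<mu>k kY by (intro mult_mono frac_le divide_nonneg_nonneg) auto
  also have "k * (4 * sqrt k * (2 * k) / (\<mu>0 * k\<^sup>2)) = 8 / \<mu>0 * sqrt k"
    using k mu_pos by (simp add: power2_eq_square)
  also have "Y / sqrt (k - 1) \<le> 2 * k / (sqrt k / 2)"
    using k s1 s2 sk Y Yk by (intro frac_le) auto
  also have "2 * k / (sqrt k / 2) = 4 * sqrt k" using sk by (simp add: field_simps)
  finally have "\<bar>bessel_moment (K - 1) Y - (k - 1)\<bar> \<le> (8 / \<mu>0 + 4) * sqrt k"
    by (simp add: distrib_right)
  thus ?thesis by (simp add: bessel_prim_def Y_def k_def)
qed

text \<open>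
  Only the modulus \<open>1\<close> is left; its dyadic sum is the difference of two primitives up to the
  variation \<open>O(\<surd>K)\<close>, and the upper primitive carries the main term.
\<close>
lemma average_above_transition:
  assumes x: "(real K)\<^sup>2 / (32 * pi\<^sup>2 - 1) \<le> x" "x \<le> (real K)\<^sup>2 / (16 * pi\<^sup>2 + 1)"
  shows "norm (harmonic_average (int K) B (hecke_sum (int K) x) -
      of_real ((-1) ^ (K div 2) / (4 * pi) * real K))
    \<le> (8 * pi * inverse_square_mass + 17 * pi + (8 / \<mu>0 + 4)) * sqrt (real K)"
proof -
  note W = weight_facts
  define k where "k = real K"
  define \<sigma> :: real where "\<sigma> = (-1) ^ (K div 2)"
  define J where "J = (\<Sum>n | x < real n \<and> real n \<le> 2 * x. bessel_J (K - 1) (4 * pi * sqrt (real n)))"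
  have \<sigma>: "\<bar>\<sigma>\<bar> = 1" by (simp add: \<sigma>_def power_abs)
  have k: "k \<ge> 20" using W(1) by (simp add: k_def)
  have K1: "real (K - 1) = k - 1" "K - 1 \<ge> 1" using W(2) by (auto simp: k_def)
  have q: "32 * pi\<^sup>2 - 1 > 0" using pi_sq_large by simp
  have p: "16 * pi\<^sup>2 + 1 > 0" by (intro add_nonneg_pos) auto
  have "pi \<le> 3.15" using pi_approx by simp
  hence "pi\<^sup>2 \<le> 3.15\<^sup>2" by (intro power_mono) auto
  \<comment> \<open>This and K >= 20 give x >= 1.\<close>
  hence pi2: "32 * pi\<^sup>2 - 1 \<le> 400" by (simp add: power2_eq_square)
  have "20\<^sup>2 \<le> k\<^sup>2" using k by (intro power_mono) auto
  hence k2: "k\<^sup>2 \<ge> 400" by simp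
  have "1 \<le> k\<^sup>2 / (32 * pi\<^sup>2 - 1)" using pi2 k2 q by (simp add: pos_le_divide_eq)
  hence x1: "x \<ge> 1" using x(1) by (simp add: k_def)
  have xu: "(16 * pi\<^sup>2 + 1) * x \<le> k\<^sup>2" using x(2) p by (simp add: pos_le_divide_eq mult.commute k_def)
  have "2 * x \<le> (16 * pi\<^sup>2 + 1) * x" using x1 pi_sq_large by (intro mult_right_mono) auto
  hence x2: "2 * x \<le> (real K)\<^sup>2" using xu by (simp add: k_def)
  have "(32 * pi\<^sup>2 + 1) * (x / 4) \<le> (16 * pi\<^sup>2 + 1) * x"
    using x1 by (simp add: algebra_simps)
  hence "(32 * pi\<^sup>2 + 1) * (x / 4) \<le> (real K)\<^sup>2" using xu by (simp add: k_def)
  hence "4 * pi * sqrt (2 * (x / 4)) \<le> \<theta>0 * real K" using x1 by (intro sqrt_le_theta) auto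
  moreover have "sqrt (2 * (x / 4)) = sqrt (2 * x) / 2"
    using real_sqrt_divide[of "2 * x" 4] by simp
  ultimately have "4 * pi * (sqrt (2 * x) / 2) \<le> \<theta>0 * real K" by (simp only:)
  hence y: "4 * pi * sqrt (2 * x) \<le> real_of_int 2 * (\<theta>0 * real K)" by (simp add: field_simps)
  have avg: "norm (harmonic_average (int K) B (hecke_sum (int K) x) - of_real (2 * pi * \<sigma> * J))
      \<le> 8 * pi * inverse_square_mass * exp (- sqrt k)"
    using average_sum_bound[OF _ _ x2 _ y] x1 by (simp add: J_def \<sigma>_def k_def)
  define p1 p2 where "p1 = bessel_prim (K - 1) x" and "p2 = bessel_prim (K - 1) (2 * x)"
  have p1: "\<bar>p1\<bar> \<le> 1" using prim_below_transition[of x] x x1 by (simp add: p1_def)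
  have p2: "\<bar>8 * pi\<^sup>2 * p2 - (k - 1)\<bar> \<le> (8 / \<mu>0 + 4) * sqrt k"
    using prim_above_transition[of x] x x1 by (simp add: p2_def k_def)
  have sk: "sqrt k \<ge> 1" "sqrt k * sqrt k = k" using k by auto
  have s2: "sqrt k / 2 \<le> sqrt (k - 1)"
  proof (rule power2_le_imp_le)
    show "(sqrt k / 2)\<^sup>2 \<le> (sqrt (k - 1))\<^sup>2" using k by (simp add: power_divide)
  qed (use k in auto)
  have "\<theta>0 * real K \<le> 1 * k" using theta_bounds by (simp add: k_def mult_left_le_one_le)
  hence "4 * pi * sqrt (2 * x) / sqrt (k - 1) \<le> 2 * k / (sqrt k / 2)"
    using y s2 sk k by (intro frac_le) auto
  also have "2 * k / (sqrt k / 2) = 4 * sqrt k" using sk by (simp add: field_simps)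
  finally have Jp: "\<bar>J - (p2 - p1)\<bar> \<le> 3 + 4 * sqrt k"
    using sum_bessel_approx[of "K - 1" x "2 * x"] K1 x1 unfolding J_def p1_def p2_def by simp
  have "\<bar>2 * pi * \<sigma> * J - \<sigma> / (4 * pi) * k\<bar> = \<bar>\<sigma>\<bar> * \<bar>2 * pi * J - k / (4 * pi)\<bar>"
    by (simp add: abs_mult[symmetric] algebra_simps)
  also have "2 * pi * J - k / (4 * pi) =
     2 * pi * (J - (p2 - p1)) - 2 * pi * p1 + (8 * pi\<^sup>2 * p2 - (k - 1)) / (4 * pi) - 1 / (4 * pi)"
    by (simp add: field_simps power2_eq_square)
  also have "\<bar>\<sigma>\<bar> * \<bar>\<dots>\<bar> \<le> 2 * pi * \<bar>J - (p2 - p1)\<bar> + 2 * pi * \<bar>p1\<bar> +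
      \<bar>8 * pi\<^sup>2 * p2 - (k - 1)\<bar> / (4 * pi) + 1 / (4 * pi)"
  proof -
    have tri: "\<bar>a - b + c - d\<bar> \<le> \<bar>a\<bar> + \<bar>b\<bar> + \<bar>c\<bar> + \<bar>d\<bar>" for a b c d :: real by linarith
    show ?thesis
      using tri[of "2 * pi * (J - (p2 - p1))" "2 * pi * p1" "(8 * pi\<^sup>2 * p2 - (k - 1)) / (4 * pi)" "1 / (4 * pi)"]
      unfolding \<sigma> by (simp add: abs_mult)
  qed
  also have "\<dots> \<le> 2 * pi * (3 + 4 * sqrt k) + 2 * pi * 1 + (8 / \<mu>0 + 4) * sqrt k / 1 + pi"
  proof (intro add_mono mult_left_mono Jp p1 frac_le p2)
    have "1 / (4 * pi) \<le> 1" using pi_gt3 by simp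
    thus "1 / (4 * pi) \<le> pi" using pi_gt3 by linarith
    show "1 \<le> 4 * pi" using pi_gt3 by simp
    show "0 \<le> (8 / \<mu>0 + 4) * sqrt k" using p2 by linarith
  qed auto
  also have "\<dots> = (9 * pi) * 1 + 8 * pi * sqrt k + (8 / \<mu>0 + 4) * sqrt k" by (simp add: algebra_simps)
  also have "\<dots> \<le> (9 * pi) * sqrt k + 8 * pi * sqrt k + (8 / \<mu>0 + 4) * sqrt k"
    using sk by (intro add_right_mono mult_left_mono) auto
  also have "\<dots> = 17 * pi * sqrt k + (8 / \<mu>0 + 4) * sqrt k" by (simp add: algebra_simps)
  finally have main: "\<bar>2 * pi * \<sigma> * J - \<sigma> / (4 * pi) * k\<bar> \<le> 17 * pi * sqrt k + (8 / \<mu>0 + 4) * sqrt k" by simp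
  have "norm (harmonic_average (int K) B (hecke_sum (int K) x) - of_real (\<sigma> / (4 * pi) * k)) =
      norm ((harmonic_average (int K) B (hecke_sum (int K) x) - of_real (2 * pi * \<sigma> * J))
        + of_real (2 * pi * \<sigma> * J - \<sigma> / (4 * pi) * k))" by simp
  also have "\<dots> \<le> norm (harmonic_average (int K) B (hecke_sum (int K) x) - of_real (2 * pi * \<sigma> * J)) +
      norm (complex_of_real (2 * pi * \<sigma> * J - \<sigma> / (4 * pi) * k))" by (rule norm_triangle_ineq)
  also have "norm (complex_of_real (2 * pi * \<sigma> * J - \<sigma> / (4 * pi) * k)) = \<bar>2 * pi * \<sigma> * J - \<sigma> / (4 * pi) * k\<bar>"
    by (rule norm_of_real)
  also have "norm (harmonic_average (int K) B (hecke_sum (int K) x) - of_real (2 * pi * \<sigma> * J)) \<le>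
     8 * pi * inverse_square_mass * sqrt k"
  proof (rule order_trans[OF avg], intro mult_left_mono)
    have "exp (- sqrt k) \<le> 1" using k by simp
    thus "exp (- sqrt k) \<le> sqrt k" using sk by linarith
  qed (use inverse_square_mass_nonneg in auto)
  finally have "norm (harmonic_average (int K) B (hecke_sum (int K) x) - of_real (\<sigma> / (4 * pi) * k)) \<le>
     8 * pi * inverse_square_mass * sqrt k + \<bar>2 * pi * \<sigma> * J - \<sigma> / (4 * pi) * k\<bar>" by simp
  also have "\<dots> \<le> 8 * pi * inverse_square_mass * sqrt k + (17 * pi * sqrt k + (8 / \<mu>0 + 4) * sqrt k)"
    using main by simp
  finally show ?thesis by (simp add: distrib_right \<sigma>_def k_def)
qed

end

theorem theorem1p1:
  "\<exists>C>0. \<forall>\<^sub>F k :: int in at_top. even k \<longrightarrow>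
     (\<forall>B. hecke_basis k B \<longrightarrow>
       (\<forall>x::real. x > 0 \<longrightarrow>
         (x \<notin> {1/2..<1} \<and> x \<le> (real_of_int k)\<^sup>2 / (32 * pi\<^sup>2 + 1) \<longrightarrow>
            cmod (harmonic_average k B (hecke_sum k x)) \<le> C * exp (- sqrt (real_of_int k)))
         \<and>
         ((real_of_int k)\<^sup>2 / (32 * pi\<^sup>2 - 1) \<le> x \<and>
          x \<le> (real_of_int k)\<^sup>2 / (16 * pi\<^sup>2 + 1) \<longrightarrow>
            cmod (harmonic_average k B (hecke_sum k x) -
                  of_real ((-1) powi (k div 2) / (4 * pi) * real_of_int k))
              \<le> C * real_of_int k powr (7 / 8))))"
proof -
  define C where "C = 8 * pi * inverse_square_mass + 17 * pi + (8 / \<mu>0 + 4)"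
  have S: "8 * pi * inverse_square_mass \<ge> 0" using inverse_square_mass_nonneg by simp
  have M: "8 / \<mu>0 > 0" using mu_pos by simp
  have C: "C > 0" "8 * pi * inverse_square_mass \<le> C" using S M pi_gt_zero unfolding C_def by linarith+
  have "eventually (\<lambda>k::int. large_weight (real_of_int k)) at_top"
    using eventually_large_weight filterlim_real_of_int_at_top by (rule eventually_compose_filterlim)
  hence "\<forall>\<^sub>F k :: int in at_top. even k \<longrightarrow>
     (\<forall>B. hecke_basis k B \<longrightarrow>
       (\<forall>x::real. x > 0 \<longrightarrow>
         (x \<notin> {1/2..<1} \<and> x \<le> (real_of_int k)\<^sup>2 / (32 * pi\<^sup>2 + 1) \<longrightarrow>
            cmod (harmonic_average k B (hecke_sum k x)) \<le> C * exp (- sqrt (real_of_int k)))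
         \<and>
         ((real_of_int k)\<^sup>2 / (32 * pi\<^sup>2 - 1) \<le> x \<and>
          x \<le> (real_of_int k)\<^sup>2 / (16 * pi\<^sup>2 + 1) \<longrightarrow>
            cmod (harmonic_average k B (hecke_sum k x) -
                  of_real ((-1) powi (k div 2) / (4 * pi) * real_of_int k))
              \<le> C * real_of_int k powr (7 / 8))))"
  proof (rule eventually_mono, intro impI allI conjI)
    fix k :: int and B and x :: real
    assume large: "large_weight (real_of_int k)" and ev: "even k" and B: "hecke_basis k B" and x0: "x > 0"
    define K where "K = nat k"
    have k20: "real_of_int k \<ge> 20" using large by (simp add: large_weight_def)
    hence kK: "k = int K" by (simp add: K_def)
    have K: "large_weight (real K)" "even K" "hecke_basis (int K) B" using large ev B by (auto simp: kK)
    {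
      assume "x \<notin> {1/2..<1} \<and> x \<le> (real_of_int k)\<^sup>2 / (32 * pi\<^sup>2 + 1)"
      hence "cmod (harmonic_average k B (hecke_sum k x)) \<le> 8 * pi * inverse_square_mass * exp (- sqrt (real K))"
        using average_below_transition[OF K x0] by (simp add: kK)
      also have "\<dots> \<le> C * exp (- sqrt (real K))" using C by (intro mult_right_mono) auto
      finally show "cmod (harmonic_average k B (hecke_sum k x)) \<le> C * exp (- sqrt (real_of_int k))"
        by (simp add: kK)
    }
    {
      assume "(real_of_int k)\<^sup>2 / (32 * pi\<^sup>2 - 1) \<le> x \<and> x \<le> (real_of_int k)\<^sup>2 / (16 * pi\<^sup>2 + 1)"
      hence *: "norm (harmonic_average (int K) B (hecke_sum (int K) x) -
          of_real ((-1) ^ (K div 2) / (4 * pi) * real K)) \<le> C * sqrt (real K)"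
        using average_above_transition[OF K, of x] by (simp add: kK C_def)
      have "int K div 2 = int (K div 2)" by simp
      hence s: "(-1::real) powi (k div 2) = (-1) ^ (K div 2)" by (simp only: kK power_int_of_nat)
      have "sqrt (real K) = real K powr (1 / 2)" by (simp add: powr_half_sqrt)
      also have "\<dots> \<le> real K powr (7 / 8)" using k20 by (intro powr_mono) (auto simp: kK)
      finally have "C * sqrt (real K) \<le> C * real K powr (7 / 8)" using C by (intro mult_left_mono) auto
      with * show "cmod (harmonic_average k B (hecke_sum k x) -
          of_real ((-1) powi (k div 2) / (4 * pi) * real_of_int k)) \<le> C * real_of_int k powr (7 / 8)"
        unfolding s by (simp add: kK)
    }
  qed
  thus ?thesis using C(1) by blast
qed

end
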